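(* Let the sequence $(z_k)_{k\in\mathbb{N}}$ be given by the globalized semismooth Newton algorithm described in the context. (a) If the ratio test $\Phi_{\mathrm{FB}}(z_k+d_k)/\Phi_{\mathrm{FB}}(z_k)\le q$ (for the Newton step $d_k$) is satisfied infinitely often, then $\Phi_{\mathrm{FB}}(z_k)\to0$. In this case, any accumulation point of $(z_k)_{k\in\mathbb{N}}$ is a primal-dual M-stationary tuple. (b) All accumulation points of $(z_k)_{k\in\mathbb{N}}$ are stationary points of $\Phi_{\mathrm{FB}}$. (c) Suppose that an accumulation point $\bar z=(\bar x,\bar\lambda,\bar\eta,\bar\mu,\bar\nu)$ of $(z_k)_{k\in\mathbb{N}}$ is such that $\bar x$ is an M-stationary point of (MPCC) where MPCC-LICQ holds, $(\bar\lambda,\bar\eta,\bar\mu,\bar\nu)\in\Lambda^{\mathrm M}(\bar x)$, and MPCC-SSOC holds at $\bar x$ with respect to $(\bar\lambda,\bar\eta,\bar\mu,\bar\nu)$. Then the entire sequence converges superlinearly towards $\bar z$. If, additionally, the second-order derivatives of the data functions $f$, $g$, $h$, $G$, and $H$ are locally Lipschitz continuous, then the convergence is quadratic.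
   Context: **Problem.** Let $f\colon\mathbb{R}^n\to\mathbb{R}$, $g\colon\mathbb{R}^n\to\mathbb{R}^\ell$, $h\colon\mathbb{R}^n\to\mathbb{R}^m$, $G,H\colon\mathbb{R}^n\to\mathbb{R}^p$ be twice continuously differentiable. (MPCC) is the problem of minimizing $f(x)$ subject to $g(x)\le 0$, $h(x)=0$, $G(x)\ge 0$, $H(x)\ge 0$, $G(x)^\top H(x)=0$. Put $I^\ell=\{1,\dots,\ell\}$, $I^p=\{1,\dots,p\}$. For a matrix $V$ and a set $I$ of row indices, $V_I$ is the matrix of the rows of $V$ with index in $I$ (similarly for vectors); $[v_i]_I$ is the matrix (or vector) obtained by stacking the blocks $v_i$, $i\in I$. The Lagrangian is $\mathcal L(x,\lambda,\eta,\mu,\nu)=f(x)+\lambda^\top g(x)+\eta^\top h(x)+\mu^\top G(x)+\nu^\top H(x)$. $\|\cdot\|$ is the Euclidean norm. **Index sets.** For $\bar x$ feasible: $I^g(\bar x)=\{i\in I^\ell: g_i(\bar x)=0\}$, $I^{+0}(\bar x)=\{i\in I^p:G_i(\bar x)>0, H_i(\bar x)=0\}$, $I^{0+}(\bar x)=\{i\in I^p:G_i(\bar x)=0,H_i(\bar x)>0\}$, $I^{00}(\bar x)=\{i\in I^p:G_i(\bar x)=H_i(\bar x)=0\}$. For $\mu,\nu\in\mathbb{R}^p$: $I^{00}_{\pm\mathbb R}(\bar x,\mu,\nu)=\{i\in I^{00}(\bar x):\mu_i\ne 0\}$, $I^{00}_{\mathbb R\pm}(\bar x,\mu,\nu)=\{i\in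 I^{00}(\bar x):\nu_i\neq 0\}$, $I^{00}_{00}(\bar x,\mu,\nu)=\{i\in I^{00}(\bar x):\mu_i=\nu_i=0\}$. **M-stationarity.** A feasible point $\bar x$ is M-stationary if there are $\lambda\in\mathbb{R}^\ell,\eta\in\mathbb{R}^m,\mu,\nu\in\mathbb{R}^p$ with $\nabla_x\mathcal L(\bar x,\lambda,\eta,\mu,\nu)=0$; $\lambda_{I^g(\bar x)}\ge0$, $\lambda_{I^\ell\setminus I^g(\bar x)}=0$; $\mu_{I^{+0}(\bar x)}=0$; $\nu_{I^{0+}(\bar x)}=0$; and for all $i\in I^{00}(\bar x)$: $\mu_i\nu_i=0$ or ($\mu_i<0$ and $\nu_i<0$). $\Lambda^{\mathrm M}(\bar x)$ is the set of all such $(\lambda,\eta,\mu,\nu)$. A tuple $(x,\lambda,\eta,\mu,\nu)$ is a primal-dual M-stationary tuple if $x$ is feasible for (MPCC) and $(\lambda,\eta,\mu,\nu)\in\Lambda^{\mathrm M}(x)$. **MPCC-LICQ** holds at $\bar x$ if the matrix obtained by stacking $g'(\bar x)_{I^g(\bar x)}$, $h'(\bar x)$, $G'(\bar x)_{I^{0+}(\bar x)\cup I^{00}(\bar x)}$, $H'(\bar x)_{I^{+0}(\bar x)\cup I^{00}(\bar x)}$ has full row rank. **MPCC-SSOC** holds at an M-stationary point $\bar x$ w.r.t. $(\lambda,\eta,\mu,\nu)\in\Lambda^{\mathrm M}(\bar x)$ if $\delta x^\top\nabla^2_{xx}\mathcal L(\bar x,\lambda,\eta,\mu,\nu)\,\delta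 x>0$ for all $\delta x\in S(\bar x,\lambda,\mu,\nu)\setminus\{0\}$, where $S(\bar x,\lambda,\mu,\nu)$ is the set of $\delta x\in\mathbb{R}^n$ with: $\nabla g_i(\bar x)^\top\delta x=0$ for $i\in I^g(\bar x)$ with $\lambda_i>0$; $h'(\bar x)\delta x=0$; $\nabla G_i(\bar x)^\top\delta x=0$ for $i\in I^{0+}(\bar x)\cup I^{00}_{\pm\mathbb R}(\bar x,\mu,\nu)$; $\nabla H_i(\bar x)^\top\delta x=0$ for $i\in I^{+0}(\bar x)\cup I^{00}_{\mathbb R\pm}(\bar x,\mu,\nu)$; $(\nabla G_i(\bar x)^\top\delta x)(\nabla H_i(\bar x)^\top\delta x)=0$ for $i\in I^{00}_{00}(\bar x,\mu,\nu)$. **The function $\varphi$ and its Newton derivative.** For $w=(a,b,\mu,\nu)\in\mathbb{R}^4$ let $\psi_1(w)=\max(-a,|b|,|\mu|)$, $\psi_2(w)=\max(-b,|a|,|\nu|)$, $\psi_3(w)=\max(|a|,|b|,\mu,\nu)$, $\varphi_1(w)=\min(\psi_1(w),\psi_2(w),\psi_3(w))$. Let $s(t)=1$ if $t\ge0$ and $s(t)=-1$ if $t<0$. $D\varphi_1(w)\in\mathbb{R}^{1\times4}$ is defined as follows (priority to first-listed entries): let $i$ be the smallest index with $\psi_i(w)=\varphi_1(w)$, and take the first argument of the maximum defining $\psi_i(w)$ which attains this maximum, where the arguments are ordered as $-a,|b|,|\mu|$ for $i=1$, as $-b,|a|,|\nu|$ for $i=2$, and as $|a|,|b|,\mu,\nu$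 for $i=3$; $D\varphi_1(w)$ is $-e_1^\top$, $s(a)e_1^\top$, $-e_2^\top$, $s(b)e_2^\top$, $e_3^\top$, $s(\mu)e_3^\top$, $e_4^\top$, $s(\nu)e_4^\top$ if this argument is $-a$, $|a|$, $-b$, $|b|$, $\mu$, $|\mu|$, $\nu$, $|\nu|$, respectively. Further: - if $D\varphi_1(w)=\pm e_1^\top$: $\varphi_2(w)=\min(|b|,|\nu|)$, and $D\varphi_2(w)=s(b)e_2^\top$ if $|b|\le|\nu|$, else $s(\nu)e_4^\top$; - if $D\varphi_1(w)=\pm e_2^\top$: $\varphi_2(w)=\min(|a|,|\mu|)$, and $D\varphi_2(w)=s(a)e_1^\top$ if $|a|\le|\mu|$, else $s(\mu)e_3^\top$; - if $D\varphi_1(w)=\pm e_3^\top$: $\varphi_2(w)=|b|$, $D\varphi_2(w)=s(b)e_2^\top$; - if $D\varphi_1(w)=\pm e_4^\top$: $\varphi_2(w)=|a|$, $D\varphi_2(w)=s(a)e_1^\top$. Put $\varphi=(\varphi_1,\varphi_2)\colon\mathbb{R}^4\to\mathbb{R}^2$ and let $D\varphi(w)\in\mathbb{R}^{2\times4}$ have rows $D\varphi_1(w),D\varphi_2(w)$; its columns are denoted $D_a\varphi,D_b\varphi,D_\mu\varphi,D_\nu\varphi$. Let $\pi_{\min}(a,b)=\min(a,b)$ with $D\pi_{\min}(a,b)=(D_a\pi_{\min},D_b\pi_{\min})=(1,0)$ if $a\le b$ and $(0,1)$ otherwise. **The map $F$ and $DF$.** For $z=(x,\lambda,\eta,\mu,\nu)\in\mathbb{R}^{n+\ell+m+2p}$,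 $$F(z)=\begin{bmatrix}\nabla_x\mathcal L(z)\\ [\pi_{\min}(-g_i(x),\lambda_i)]_{I^\ell}\\ h(x)\\ [\varphi(G_i(x),H_i(x),\mu_i,\nu_i)]_{I^p}\end{bmatrix},\qquad DF(z)=\begin{bmatrix}\nabla^2_{xx}\mathcal L(z)&g'(x)^\top&h'(x)^\top&G'(x)^\top&H'(x)^\top\\ A_1(z)&A_2(z)&0&0&0\\ h'(x)&0&0&0&0\\ A_3(z)&0&0&A_4(z)&A_5(z)\end{bmatrix},$$ where, with $\pi_{\min}$ and its derivatives evaluated at $(-g_i(x),\lambda_i)$ and those of $\varphi$ at $(G_i(x),H_i(x),\mu_i,\nu_i)$, $A_1=[-D_a\pi_{\min}\nabla g_i(x)^\top]_{I^\ell}$, $A_2=[D_b\pi_{\min}e_i^\top]_{I^\ell}$, $A_3=[D_a\varphi\,\nabla G_i(x)^\top+D_b\varphi\,\nabla H_i(x)^\top]_{I^p}$, $A_4=[D_\mu\varphi\, e_i^\top]_{I^p}$, $A_5=[D_\nu\varphi\, e_i^\top]_{I^p}$. **Merit function.** Let $\pi_{\mathrm{FB}}(a,b)=\sqrt{a^2+b^2}-a-b$ and, for $w=(a,b,\mu,\nu)$, $\theta_{1,\mathrm{FB}}(w)=|\pi_{\mathrm{FB}}(a,b)|$, $\theta_{2,\mathrm{FB}}(w)=\pi_{\mathrm{FB}}(|a|,|\mu|)$, $\theta_{3,\mathrm{FB}}(w)=\pi_{\mathrm{FB}}(|b|,|\nu|)$, $\theta_{4,\mathrm{FB}}(w)=0$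 if $\mu,\nu\le0$ and $\theta_{4,\mathrm{FB}}(w)=\pi_{\mathrm{FB}}(|\mu|,|\nu|)$ otherwise; $\theta_{\mathrm{FB}}=[\theta_{i,\mathrm{FB}}]_{i=1,\dots,4}$. Let $$F_{\mathrm{FB}}(z)=\begin{bmatrix}\nabla_x\mathcal L(z)\\ [\pi_{\mathrm{FB}}(-g_i(x),\lambda_i)]_{I^\ell}\\ h(x)\\ [\theta_{\mathrm{FB}}(G_i(x),H_i(x),\mu_i,\nu_i)]_{I^p}\end{bmatrix},\qquad \Phi_{\mathrm{FB}}(z)=\tfrac12\|F_{\mathrm{FB}}(z)\|^2 .$$ The function $\Phi_{\mathrm{FB}}$ is continuously differentiable; a stationary point of it is a point with $\nabla\Phi_{\mathrm{FB}}(z)=0$. **Algorithm.** Parameters $q,\tau_{\mathrm{abs}},\rho,\sigma,\beta\in(0,1)$, starting point $z_0\in\mathbb{R}^{n+\ell+m+2p}$. Set $k=0$. While $\|F(z_k)\|>\tau_{\mathrm{abs}}$, do: 1. Solve $DF(z_k)d_k=-F(z_k)$ for $d_k$ ($d_k$ is called well defined if this Newton system could be solved). 2. If $d_k$ is well defined and the ratio test $\Phi_{\mathrm{FB}}(z_k+d_k)/\Phi_{\mathrm{FB}}(z_k)\le q$ is satisfied, set $z_{k+1}=z_k+d_k$. 3. Otherwise: if $d_k$ is not well defined or $\nabla\Phi_{\mathrm{FB}}(z_k)^\top d_k>-\rho\|d_k\|\,\|\nabla\Phi_{\mathrm{FB}}(z_k)\|$, (re)set $d_k=-\nabla\Phi_{\mathrm{FB}}(z_k)$.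 Then set $z_{k+1}=z_k+\alpha_kd_k$ with $\alpha_k=\beta^{i_k}$, where $i_k\in\mathbb{N}_0$ is the smallest non-negative integer with $\Phi_{\mathrm{FB}}(z_k+\beta^{i_k}d_k)\le\Phi_{\mathrm{FB}}(z_k)+\sigma\beta^{i_k}\nabla\Phi_{\mathrm{FB}}(z_k)^\top d_k$. 4. Set $k=k+1$. Superlinear convergence means $z_k\to\bar z$ and $\|z_{k+1}-\bar z\|=o(\|z_k-\bar z\|)$; quadratic convergence means $z_k\to\bar z$ and $\|z_{k+1}-\bar z\|=O(\|z_k-\bar z\|^2)$. *)

theory Defs
  imports "HOL-Analysis.Analysis" "HOL-Library.Landau_Symbols"
begin

section \<open>Derivatives\<close>

definition grad :: "('a::real_inner \<Rightarrow> real) \<Rightarrow> 'a \<Rightarrow> 'a" where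
  "grad f x = (THE D. GDERIV f x :> D)"

definition hessian :: "(real^'n \<Rightarrow> real) \<Rightarrow> real^'n \<Rightarrow> real^'n^'n" where
  "hessian f x = jacobian (grad f) (at x)"

definition second_derivative ::
    "('a::real_normed_vector \<Rightarrow> 'b::real_normed_vector) \<Rightarrow> ('a \<Rightarrow> 'a \<Rightarrow>\<^sub>L 'a \<Rightarrow>\<^sub>L 'b) \<Rightarrow> bool" where
  "second_derivative f f'' \<longleftrightarrow> (\<exists>f' :: 'a \<Rightarrow> 'a \<Rightarrow>\<^sub>L 'b.
      (\<forall>x. (f has_derivative blinfun_apply (f' x)) (at x)) \<and>
      (\<forall>x. (f' has_derivative blinfun_apply (f'' x)) (at x)))"

definition twice_continuously_differentiable ::
    "('a::real_normed_vector \<Rightarrow> 'b::real_normed_vector) \<Rightarrow> bool" where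
  "twice_continuously_differentiable f \<longleftrightarrow>
     (\<exists>f''. second_derivative f f'' \<and> continuous_on UNIV f'')"

definition locally_lipschitz :: "('a::metric_space \<Rightarrow> 'b::metric_space) \<Rightarrow> bool" where
  "locally_lipschitz f \<longleftrightarrow> (\<forall>x. \<exists>r>0. \<exists>L. L-lipschitz_on (ball x r) f)"

definition locally_lipschitz_second_derivative ::
    "('a::real_normed_vector \<Rightarrow> 'b::real_normed_vector) \<Rightarrow> bool" where
  "locally_lipschitz_second_derivative f \<longleftrightarrow>
     (\<exists>f''. second_derivative f f'' \<and> locally_lipschitz f'')"


section \<open>The problem (MPCC)\<close>

text \<open>
  Minimize \<open>f(x)\<close> subject to \<open>g(x) \<le> 0\<close>, \<open>h(x) = 0\<close>, \<open>G(x) \<ge> 0\<close>, \<open>H(x) \<ge> 0\<close>,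
  \<open>G(x)\<^sup>T H(x) = 0\<close>; the fields are these five functions in this order.
\<close>

record ('n::finite, 'l::finite, 'm::finite, 'p::finite) mpcc =
  obj :: "real^'n \<Rightarrow> real"
  ineq :: "real^'n \<Rightarrow> real^'l"
  eqn :: "real^'n \<Rightarrow> real^'m"
  cG :: "real^'n \<Rightarrow> real^'p"
  cH :: "real^'n \<Rightarrow> real^'p"

type_synonym ('l, 'm, 'p) multipliers =
  "(real^'l) \<times> (real^'m) \<times> (real^'p) \<times> (real^'p)"

text \<open>
  The norm and inner product of the product type are the Euclidean ones, so this is
  the Euclidean space of dimension \<open>n + l + m + 2p\<close>.
\<close>

type_synonym ('n, 'l, 'm, 'p) primal_dual =
  "(real^'n) \<times> (real^'l) \<times> (real^'m) \<times> (real^'p) \<times> (real^'p)"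

definition feasible :: "('n::finite, 'l::finite, 'm::finite, 'p::finite) mpcc \<Rightarrow> real^'n \<Rightarrow> bool" where
  "feasible P x \<longleftrightarrow> (\<forall>i. ineq P x $ i \<le> 0) \<and> eqn P x = 0 \<and>
     (\<forall>i. cG P x $ i \<ge> 0) \<and> (\<forall>i. cH P x $ i \<ge> 0) \<and> cG P x \<bullet> cH P x = 0"

definition Ig :: "('n::finite, 'l::finite, 'm::finite, 'p::finite) mpcc \<Rightarrow> real^'n \<Rightarrow> 'l set" where
  "Ig P x = {i. ineq P x $ i = 0}"

definition Ip0 :: "('n::finite, 'l::finite, 'm::finite, 'p::finite) mpcc \<Rightarrow> real^'n \<Rightarrow> 'p set" where
  "Ip0 P x = {i. cG P x $ i > 0 \<and> cH P x $ i = 0}"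

definition I0p :: "('n::finite, 'l::finite, 'm::finite, 'p::finite) mpcc \<Rightarrow> real^'n \<Rightarrow> 'p set" where
  "I0p P x = {i. cG P x $ i = 0 \<and> cH P x $ i > 0}"

definition I00 :: "('n::finite, 'l::finite, 'm::finite, 'p::finite) mpcc \<Rightarrow> real^'n \<Rightarrow> 'p set" where
  "I00 P x = {i. cG P x $ i = 0 \<and> cH P x $ i = 0}"

text \<open>The subsets of \<open>I00\<close> where \<open>\<mu>\<close> does not vanish, where \<open>\<nu>\<close> does not vanish,
  and where both vanish.\<close>

definition I00_mu :: "('n::finite, 'l::finite, 'm::finite, 'p::finite) mpcc \<Rightarrow> real^'n \<Rightarrow> real^'p \<Rightarrow> real^'p \<Rightarrow> 'p set" where
  "I00_mu P x \<mu> \<nu> = {i \<in> I00 P x. \<mu> $ i \<noteq> 0}"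

definition I00_nu :: "('n::finite, 'l::finite, 'm::finite, 'p::finite) mpcc \<Rightarrow> real^'n \<Rightarrow> real^'p \<Rightarrow> real^'p \<Rightarrow> 'p set" where
  "I00_nu P x \<mu> \<nu> = {i \<in> I00 P x. \<nu> $ i \<noteq> 0}"

definition I00_00 :: "('n::finite, 'l::finite, 'm::finite, 'p::finite) mpcc \<Rightarrow> real^'n \<Rightarrow> real^'p \<Rightarrow> real^'p \<Rightarrow> 'p set" where
  "I00_00 P x \<mu> \<nu> = {i \<in> I00 P x. \<mu> $ i = 0 \<and> \<nu> $ i = 0}"

fun lagrangian :: "('n::finite, 'l::finite, 'm::finite, 'p::finite) mpcc \<Rightarrow> ('l, 'm, 'p) multipliers \<Rightarrow> real^'n \<Rightarrow> real" where
  "lagrangian P (lam, \<eta>, \<mu>, \<nu>) x =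
     obj P x + lam \<bullet> ineq P x + \<eta> \<bullet> eqn P x + \<mu> \<bullet> cG P x + \<nu> \<bullet> cH P x"


section \<open>M-stationarity, MPCC-LICQ, MPCC-SSOC\<close>

definition M_multipliers :: "('n::finite, 'l::finite, 'm::finite, 'p::finite) mpcc \<Rightarrow> real^'n \<Rightarrow> ('l, 'm, 'p) multipliers set" where
  "M_multipliers P x = {(lam, \<eta>, \<mu>, \<nu>).
      grad (lagrangian P (lam, \<eta>, \<mu>, \<nu>)) x = 0 \<and>
      (\<forall>i\<in>Ig P x. lam $ i \<ge> 0) \<and> (\<forall>i\<in>- Ig P x. lam $ i = 0) \<and>
      (\<forall>i\<in>Ip0 P x. \<mu> $ i = 0) \<and> (\<forall>i\<in>I0p P x. \<nu> $ i = 0) \<and>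
      (\<forall>i\<in>I00 P x. \<mu> $ i * \<nu> $ i = 0 \<or> (\<mu> $ i < 0 \<and> \<nu> $ i < 0))}"

definition M_stationary :: "('n::finite, 'l::finite, 'm::finite, 'p::finite) mpcc \<Rightarrow> real^'n \<Rightarrow> bool" where
  "M_stationary P x \<longleftrightarrow> feasible P x \<and> M_multipliers P x \<noteq> {}"

fun primal_dual_M_stationary :: "('n::finite, 'l::finite, 'm::finite, 'p::finite) mpcc \<Rightarrow> ('n, 'l, 'm, 'p) primal_dual \<Rightarrow> bool" where
  "primal_dual_M_stationary P (x, u) \<longleftrightarrow> feasible P x \<and> u \<in> M_multipliers P x"

text \<open>The Jacobians of \<open>g\<close>, \<open>h\<close>, \<open>G\<close>, \<open>H\<close> stacked on top of each other.\<close>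

definition constraint_jacobian :: "('n::finite, 'l::finite, 'm::finite, 'p::finite) mpcc \<Rightarrow> real^'n \<Rightarrow> real^'n^('l + 'm + 'p + 'p)" where
  "constraint_jacobian P x = (\<chi> k. case k of
       Inl i \<Rightarrow> jacobian (ineq P) (at x) $ i
     | Inr (Inl i) \<Rightarrow> jacobian (eqn P) (at x) $ i
     | Inr (Inr (Inl i)) \<Rightarrow> jacobian (cG P) (at x) $ i
     | Inr (Inr (Inr i)) \<Rightarrow> jacobian (cH P) (at x) $ i)"

text \<open>
  The submatrix \<open>V\<^sub>I\<close> has full row rank: its rank, i.e. the dimension of the span of its
  rows, is the number of its rows. Counting row indices on the right-hand side makes
  repeated rows violate the condition.
\<close>

definition full_row_rank_on :: "'r set \<Rightarrow> real^'n^'r::finite \<Rightarrow> bool" where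
  "full_row_rank_on I V \<longleftrightarrow> dim ((\<lambda>i. row i V) ` I) = card I"

definition MPCC_LICQ :: "('n::finite, 'l::finite, 'm::finite, 'p::finite) mpcc \<Rightarrow> real^'n \<Rightarrow> bool" where
  "MPCC_LICQ P x \<longleftrightarrow>
     full_row_rank_on (Ig P x <+> UNIV <+> (I0p P x \<union> I00 P x) <+> (Ip0 P x \<union> I00 P x))
       (constraint_jacobian P x)"

definition SSOC_directions :: "('n::finite, 'l::finite, 'm::finite, 'p::finite) mpcc \<Rightarrow> real^'n \<Rightarrow> real^'l \<Rightarrow> real^'p \<Rightarrow> real^'p \<Rightarrow> (real^'n) set" where
  "SSOC_directions P x lam \<mu> \<nu> = {d.
     (\<forall>i\<in>Ig P x. lam $ i > 0 \<longrightarrow> jacobian (ineq P) (at x) $ i \<bullet> d = 0) \<and>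
     jacobian (eqn P) (at x) *v d = 0 \<and>
     (\<forall>i\<in>I0p P x \<union> I00_mu P x \<mu> \<nu>. jacobian (cG P) (at x) $ i \<bullet> d = 0) \<and>
     (\<forall>i\<in>Ip0 P x \<union> I00_nu P x \<mu> \<nu>. jacobian (cH P) (at x) $ i \<bullet> d = 0) \<and>
     (\<forall>i\<in>I00_00 P x \<mu> \<nu>.
        (jacobian (cG P) (at x) $ i \<bullet> d) * (jacobian (cH P) (at x) $ i \<bullet> d) = 0)}"

fun MPCC_SSOC :: "('n::finite, 'l::finite, 'm::finite, 'p::finite) mpcc \<Rightarrow> real^'n \<Rightarrow> ('l, 'm, 'p) multipliers \<Rightarrow> bool" where
  "MPCC_SSOC P x (lam, \<eta>, \<mu>, \<nu>) \<longleftrightarrow>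
     (\<forall>d \<in> SSOC_directions P x lam \<mu> \<nu> - {0}.
        d \<bullet> (hessian (lagrangian P (lam, \<eta>, \<mu>, \<nu>)) x *v d) > 0)"


section \<open>The function \<open>\<phi>\<close> and its Newton derivative\<close>

fun psi1 :: "real \<times> real \<times> real \<times> real \<Rightarrow> real" where
  "psi1 (a, b, \<mu>, \<nu>) = max (- a) (max \<bar>b\<bar> \<bar>\<mu>\<bar>)"

fun psi2 :: "real \<times> real \<times> real \<times> real \<Rightarrow> real" where
  "psi2 (a, b, \<mu>, \<nu>) = max (- b) (max \<bar>a\<bar> \<bar>\<nu>\<bar>)"

fun psi3 :: "real \<times> real \<times> real \<times> real \<Rightarrow> real" where
  "psi3 (a, b, \<mu>, \<nu>) = max \<bar>a\<bar> (max \<bar>b\<bar> (max \<mu> \<nu>))"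

definition phi1 :: "real \<times> real \<times> real \<times> real \<Rightarrow> real" where
  "phi1 w = min (psi1 w) (min (psi2 w) (psi3 w))"

text \<open>The sign with value \<open>1\<close> at \<open>0\<close>, unlike \<open>sgn\<close>.\<close>

definition sg :: "real \<Rightarrow> real" where
  "sg t = (if t \<ge> 0 then 1 else - 1)"

text \<open>
  The case distinctions give priority to the entries listed first. The unit row vectors
  are \<open>axis 1 1\<close>, \<open>axis 2 1\<close>, \<open>axis 3 1\<close>, \<open>axis 4 1\<close>, and \<open>axis i c\<close> is \<open>c\<close> times
  the \<open>i\<close>-th one.
\<close>

fun Dphi1 :: "real \<times> real \<times> real \<times> real \<Rightarrow> real^4" where
  "Dphi1 (a, b, \<mu>, \<nu>) = (let w = (a, b, \<mu>, \<nu>) in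
     if psi1 w = phi1 w then
       (if - a = psi1 w then axis 1 (- 1)
        else if \<bar>b\<bar> = psi1 w then axis 2 (sg b)
        else axis 3 (sg \<mu>))
     else if psi2 w = phi1 w then
       (if - b = psi2 w then axis 2 (- 1)
        else if \<bar>a\<bar> = psi2 w then axis 1 (sg a)
        else axis 4 (sg \<nu>))
     else
       (if \<bar>a\<bar> = psi3 w then axis 1 (sg a)
        else if \<bar>b\<bar> = psi3 w then axis 2 (sg b)
        else if \<mu> = psi3 w then axis 3 1
        else axis 4 1))"

fun phi2 :: "real \<times> real \<times> real \<times> real \<Rightarrow> real" where
  "phi2 (a, b, \<mu>, \<nu>) = (let D = Dphi1 (a, b, \<mu>, \<nu>) in
     if D \<in> {axis 1 1, axis 1 (- 1)} then min \<bar>b\<bar> \<bar>\<nu>\<bar>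
     else if D \<in> {axis 2 1, axis 2 (- 1)} then min \<bar>a\<bar> \<bar>\<mu>\<bar>
     else if D \<in> {axis 3 1, axis 3 (- 1)} then \<bar>b\<bar>
     else \<bar>a\<bar>)"

fun Dphi2 :: "real \<times> real \<times> real \<times> real \<Rightarrow> real^4" where
  "Dphi2 (a, b, \<mu>, \<nu>) = (let D = Dphi1 (a, b, \<mu>, \<nu>) in
     if D \<in> {axis 1 1, axis 1 (- 1)} then
       (if \<bar>b\<bar> \<le> \<bar>\<nu>\<bar> then axis 2 (sg b) else axis 4 (sg \<nu>))
     else if D \<in> {axis 2 1, axis 2 (- 1)} then
       (if \<bar>a\<bar> \<le> \<bar>\<mu>\<bar> then axis 1 (sg a) else axis 3 (sg \<mu>))
     else if D \<in> {axis 3 1, axis 3 (- 1)} then axis 2 (sg b)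
     else axis 1 (sg a))"

definition phi :: "real \<times> real \<times> real \<times> real \<Rightarrow> real^2" where
  "phi w = vector [phi1 w, phi2 w]"

definition Dphi :: "real \<times> real \<times> real \<times> real \<Rightarrow> real^4^2" where
  "Dphi w = vector [Dphi1 w, Dphi2 w]"

definition pi_min :: "real \<Rightarrow> real \<Rightarrow> real" where
  "pi_min a b = min a b"

definition Dpi_min :: "real \<Rightarrow> real \<Rightarrow> real \<times> real" where
  "Dpi_min a b = (if a \<le> b then (1, 0) else (0, 1))"


section \<open>The map \<open>F\<close> and its Newton derivative\<close>

definition compl_arg :: "('n::finite, 'l::finite, 'm::finite, 'p::finite) mpcc \<Rightarrow> ('n, 'l, 'm, 'p) primal_dual \<Rightarrow> 'p \<Rightarrow> real \<times> real \<times> real \<times> real" where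
  "compl_arg P z i = (case z of (x, lam, \<eta>, \<mu>, \<nu>) \<Rightarrow> (cG P x $ i, cH P x $ i, \<mu> $ i, \<nu> $ i))"

fun F :: "('n::finite, 'l::finite, 'm::finite, 'p::finite) mpcc \<Rightarrow> ('n, 'l, 'm, 'p) primal_dual
    \<Rightarrow> (real^'n) \<times> (real^'l) \<times> (real^'m) \<times> (real^2^'p)" where
  "F P (x, lam, \<eta>, \<mu>, \<nu>) =
     (grad (lagrangian P (lam, \<eta>, \<mu>, \<nu>)) x,
      \<chi> i. pi_min (- (ineq P x $ i)) (lam $ i),
      eqn P x,
      \<chi> i. phi (compl_arg P (x, lam, \<eta>, \<mu>, \<nu>) i))"

text \<open>
  The block matrix \<open>DF(z)\<close> is given by its action on \<open>(dx, dlam, d\<eta>, d\<mu>, d\<nu>)\<close>, one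
  component per block row.
\<close>

fun DF :: "('n::finite, 'l::finite, 'm::finite, 'p::finite) mpcc \<Rightarrow> ('n, 'l, 'm, 'p) primal_dual \<Rightarrow> ('n, 'l, 'm, 'p) primal_dual
    \<Rightarrow> (real^'n) \<times> (real^'l) \<times> (real^'m) \<times> (real^2^'p)" where
  "DF P (x, lam, \<eta>, \<mu>, \<nu>) (dx, dlam, d\<eta>, d\<mu>, d\<nu>) =
     (hessian (lagrangian P (lam, \<eta>, \<mu>, \<nu>)) x *v dx
        + transpose (jacobian (ineq P) (at x)) *v dlam
        + transpose (jacobian (eqn P) (at x)) *v d\<eta>
        + transpose (jacobian (cG P) (at x)) *v d\<mu>
        + transpose (jacobian (cH P) (at x)) *v d\<nu>,
      \<chi> i. (let D = Dpi_min (- (ineq P x $ i)) (lam $ i) in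
              - fst D * (jacobian (ineq P) (at x) $ i \<bullet> dx) + snd D * dlam $ i),
      jacobian (eqn P) (at x) *v dx,
      \<chi> i. (let D = Dphi (compl_arg P (x, lam, \<eta>, \<mu>, \<nu>) i) in
              (jacobian (cG P) (at x) $ i \<bullet> dx) *\<^sub>R column 1 D
            + (jacobian (cH P) (at x) $ i \<bullet> dx) *\<^sub>R column 2 D
            + (d\<mu> $ i) *\<^sub>R column 3 D
            + (d\<nu> $ i) *\<^sub>R column 4 D))"


section \<open>The merit function\<close>

definition pi_FB :: "real \<Rightarrow> real \<Rightarrow> real" where
  "pi_FB a b = sqrt (a\<^sup>2 + b\<^sup>2) - a - b"

fun theta_FB :: "real \<times> real \<times> real \<times> real \<Rightarrow> real^4" where
  "theta_FB (a, b, \<mu>, \<nu>) = vector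
     [\<bar>pi_FB a b\<bar>,
      pi_FB \<bar>a\<bar> \<bar>\<mu>\<bar>,
      pi_FB \<bar>b\<bar> \<bar>\<nu>\<bar>,
      if \<mu> \<le> 0 \<and> \<nu> \<le> 0 then 0 else pi_FB \<bar>\<mu>\<bar> \<bar>\<nu>\<bar>]"

fun F_FB :: "('n::finite, 'l::finite, 'm::finite, 'p::finite) mpcc \<Rightarrow> ('n, 'l, 'm, 'p) primal_dual
    \<Rightarrow> (real^'n) \<times> (real^'l) \<times> (real^'m) \<times> (real^4^'p)" where
  "F_FB P (x, lam, \<eta>, \<mu>, \<nu>) =
     (grad (lagrangian P (lam, \<eta>, \<mu>, \<nu>)) x,
      \<chi> i. pi_FB (- (ineq P x $ i)) (lam $ i),
      eqn P x,
      \<chi> i. theta_FB (compl_arg P (x, lam, \<eta>, \<mu>, \<nu>) i))"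

definition Phi_FB :: "('n::finite, 'l::finite, 'm::finite, 'p::finite) mpcc \<Rightarrow> ('n, 'l, 'm, 'p) primal_dual \<Rightarrow> real" where
  "Phi_FB P z = (1 / 2) * (norm (F_FB P z))\<^sup>2"

definition stationary_point :: "('a::real_inner \<Rightarrow> real) \<Rightarrow> 'a \<Rightarrow> bool" where
  "stationary_point f z \<longleftrightarrow> GDERIV f z :> 0"


section \<open>The algorithm\<close>

text \<open>
  The outcome of the Newton system is \<open>None\<close> if it has no solution (the Newton step is
  not well defined), and \<open>Some d\<close> for a solution \<open>d\<close> otherwise; if there are several
  solutions, any of them may be taken.
\<close>

definition newton_step :: "('n::finite, 'l::finite, 'm::finite, 'p::finite) mpcc \<Rightarrow> ('n, 'l, 'm, 'p) primal_dual
    \<Rightarrow> ('n, 'l, 'm, 'p) primal_dual option \<Rightarrow> bool" where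
  "newton_step P z N = (case N of
       None \<Rightarrow> \<not> (\<exists>d. DF P z d = - F P z)
     | Some d \<Rightarrow> DF P z d = - F P z)"

definition ratio_test :: "('n::finite, 'l::finite, 'm::finite, 'p::finite) mpcc \<Rightarrow> real \<Rightarrow> ('n, 'l, 'm, 'p) primal_dual
    \<Rightarrow> ('n, 'l, 'm, 'p) primal_dual option \<Rightarrow> bool" where
  "ratio_test P q z N = (case N of
       None \<Rightarrow> False
     | Some d \<Rightarrow> Phi_FB P (z + d) / Phi_FB P z \<le> q)"

definition search_direction :: "('n::finite, 'l::finite, 'm::finite, 'p::finite) mpcc \<Rightarrow> real \<Rightarrow> ('n, 'l, 'm, 'p) primal_dual
    \<Rightarrow> ('n, 'l, 'm, 'p) primal_dual option \<Rightarrow> ('n, 'l, 'm, 'p) primal_dual" where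
  "search_direction P \<rho> z N = (case N of
       None \<Rightarrow> - grad (Phi_FB P) z
     | Some d \<Rightarrow>
         if grad (Phi_FB P) z \<bullet> d > - \<rho> * norm d * norm (grad (Phi_FB P) z)
         then - grad (Phi_FB P) z else d)"

definition armijo :: "('a::real_inner \<Rightarrow> real) \<Rightarrow> real \<Rightarrow> 'a \<Rightarrow> 'a \<Rightarrow> real \<Rightarrow> bool" where
  "armijo f \<sigma> z d t \<longleftrightarrow> f (z + t *\<^sub>R d) \<le> f z + \<sigma> * t * (grad f z \<bullet> d)"

definition line_search_step :: "('a::real_inner \<Rightarrow> real) \<Rightarrow> real \<Rightarrow> real \<Rightarrow> 'a \<Rightarrow> 'a \<Rightarrow> 'a \<Rightarrow> bool" where
  "line_search_step f \<sigma> \<beta> z d z' \<longleftrightarrow>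
     (\<exists>i::nat. armijo f \<sigma> z d (\<beta> ^ i) \<and> (\<forall>j<i. \<not> armijo f \<sigma> z d (\<beta> ^ j)) \<and>
               z' = z + \<beta> ^ i *\<^sub>R d)"

text \<open>
  An infinite run of the algorithm with iterates \<open>z k\<close> and Newton steps \<open>N k\<close>: the
  loop condition \<open>\<parallel>F(z k)\<parallel> > \<tau>\<close> holds at every iterate. The tolerance \<open>\<tau> = 0\<close>, for
  which the run stops only at exact zeros of \<open>F\<close>, is meant to be allowed: convergence
  to a zero of \<open>F\<close> is possible only for it.
\<close>

definition newton_run :: "('n::finite, 'l::finite, 'm::finite, 'p::finite) mpcc
    \<Rightarrow> real \<Rightarrow> real \<Rightarrow> real \<Rightarrow> real \<Rightarrow> real
    \<Rightarrow> (nat \<Rightarrow> ('n, 'l, 'm, 'p) primal_dual) \<Rightarrow> (nat \<Rightarrow> ('n, 'l, 'm, 'p) primal_dual option) \<Rightarrow> bool" where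
  "newton_run P q \<tau> \<rho> \<sigma> \<beta> z N \<longleftrightarrow> (\<forall>k.
      norm (F P (z k)) > \<tau> \<and>
      newton_step P (z k) (N k) \<and>
      (if ratio_test P q (z k) (N k)
       then z (Suc k) = z k + the (N k)
       else line_search_step (Phi_FB P) \<sigma> \<beta> (z k) (search_direction P \<rho> (z k) (N k)) (z (Suc k))))"


section \<open>Convergence notions\<close>

definition accumulation_point :: "(nat \<Rightarrow> 'a::topological_space) \<Rightarrow> 'a \<Rightarrow> bool" where
  "accumulation_point z l \<longleftrightarrow> (\<exists>r. strict_mono r \<and> (z \<circ> r) \<longlonglongrightarrow> l)"

definition converges_superlinearly :: "(nat \<Rightarrow> 'a::real_normed_vector) \<Rightarrow> 'a \<Rightarrow> bool" where
  "converges_superlinearly z l \<longleftrightarrow>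
     z \<longlonglongrightarrow> l \<and> (\<lambda>k. norm (z (Suc k) - l)) \<in> o(\<lambda>k. norm (z k - l))"

definition converges_quadratically :: "(nat \<Rightarrow> 'a::real_normed_vector) \<Rightarrow> 'a \<Rightarrow> bool" where
  "converges_quadratically z l \<longleftrightarrow>
     z \<longlonglongrightarrow> l \<and> (\<lambda>k. norm (z (Suc k) - l)) \<in> O(\<lambda>k. (norm (z k - l))\<^sup>2)"

end

theory Submission
  imports Defs
begin

text \<open>
  The argument rests on two properties of \<open>\<phi>\<close>. First, \<open>\<phi>\<^sub>1(w)\<close> is the distance, in the maximum norm,
  of \<open>w\<close> to the set of quadruples that satisfy the complementarity part of M-stationarity, and
  \<open>0 \<le> \<phi>\<^sub>2 \<le> \<phi>\<^sub>1\<close> (\<open>phi_selection\<close>, \<open>phi1_eq_0_iff\<close>). So the zeros of \<open>F\<close> are the primal-dual M-stationary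
  tuples, and since the components of \<open>\<theta>\<^sub>F\<^sub>B\<close> measure the same distance up to constants, \<open>\<parallel>F\<parallel>\<close> and
  \<open>\<parallel>F\<^sub>F\<^sub>B\<parallel>\<close> are equivalent everywhere (\<open>norm_F_le\<close>, \<open>norm_F_FB_le\<close>). Second, each row of \<open>D\<phi>(w)\<close> picks
  out one signed coordinate of \<open>w\<close>, and for \<open>w\<close> near a zero \<open>w\<^sub>0\<close> this coordinate vanishes at \<open>w\<^sub>0\<close>. Hence
  \<open>\<phi>(w) = D\<phi>(w) (w - w\<^sub>0)\<close> holds exactly (\<open>phi_newton_exact\<close>), and the linearization error of \<open>F\<close> at a
  solution comes from the smooth data alone: it is \<open>o(\<parallel>z - zb\<parallel>)\<close>, and \<open>O(\<parallel>z - zb\<parallel>\<^sup>2)\<close> if the second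
  derivatives are locally Lipschitz continuous (\<open>F_remainder\<close>).

  For the local part, the pairs of coordinates picked out by the two rows are \<open>{a, b}\<close>, \<open>{a, \<nu>}\<close> or
  \<open>{b, \<mu>}\<close>. In the kernel of any limiting Newton matrix this makes all products of multiplier steps and
  constraint derivatives vanish, so that MPCC-SSOC annihilates the primal part and then MPCC-LICQ the
  multipliers (\<open>kernel_trivial\<close>). By compactness \<open>DF(z)\<close> is uniformly injective near the solution
  (\<open>DF_lower_bound\<close>). The distance to the solution after a Newton step is therefore bounded by the
  linearization error. As \<open>\<Phi>\<^sub>F\<^sub>B\<close> grows like the squared distance, the ratio test accepts every Newton
  step near the solution (\<open>newton_step_accepted\<close>), and a single iterate close to it makes the whole
  sequence converge with the asserted rate.

  For the global part, \<open>\<Phi>\<^sub>F\<^sub>B\<close> is continuously differentiable because its nonsmooth terms are Lipschitz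
  functions that are squared and smooth off their zeros (\<open>cont_diff_square\<close>). It decreases in every
  step, and by the factor \<open>q\<close> whenever the ratio test succeeds; this gives the first claim. If the test
  succeeds only finitely often, the usual argument for Armijo line searches shows that at an
  accumulation point with nonzero gradient the search directions would tend to \<open>0\<close>
  (\<open>line_search_accumulation\<close>); being Newton directions they would force \<open>F\<close>, and with it \<open>\<Phi>\<^sub>F\<^sub>B\<close>, to \<open>0\<close>.
\<close>

section \<open>The selection structure of the function phi\<close>

text \<open>
  The row vectors \<open>Dphi1 w\<close> and \<open>Dphi2 w\<close> act on \<open>\<real>\<^sup>4\<close>; \<open>coord\<close> moves the argument of \<open>phi1\<close> and \<open>phi2\<close> there.
\<close>

fun coord :: "real \<times> real \<times> real \<times> real \<Rightarrow> real^4" where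
  "coord (a, b, \<mu>, \<nu>) = vector [a, b, \<mu>, \<nu>]"

lemma vector_4 [simp]:
  "(vector [a, b, c, d] :: 'a::zero^4) $ 1 = a" "(vector [a, b, c, d] :: 'a::zero^4) $ 2 = b"
  "(vector [a, b, c, d] :: 'a::zero^4) $ 3 = c" "(vector [a, b, c, d] :: 'a::zero^4) $ 4 = d"
  unfolding vector_def by simp_all

lemma coord_nth [simp]:
  "coord (a, b, \<mu>, \<nu>) $ 1 = a" "coord (a, b, \<mu>, \<nu>) $ 2 = b"
  "coord (a, b, \<mu>, \<nu>) $ 3 = \<mu>" "coord (a, b, \<mu>, \<nu>) $ 4 = \<nu>"
  by simp_all

declare coord.simps [simp del]

lemma index4_distinct [simp]:
  "(1::4) \<noteq> 2" "(1::4) \<noteq> 3" "(1::4) \<noteq> 4" "(2::4) \<noteq> 1" "(2::4) \<noteq> 3" "(2::4) \<noteq> 4"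
  "(3::4) \<noteq> 1" "(3::4) \<noteq> 2" "(3::4) \<noteq> 4" "(4::4) \<noteq> 1" "(4::4) \<noteq> 2" "(4::4) \<noteq> 3"
  by simp_all

lemma abs_sg [simp]: "\<bar>sg t\<bar> = 1" and sg_mult_self [simp]: "sg t * t = \<bar>t\<bar>"
  by (auto simp: sg_def)

declare psi1.simps [simp del] psi2.simps [simp del] psi3.simps [simp del]

lemma phi1_nonneg: "0 \<le> phi1 w"
  by (cases w) (simp add: phi1_def psi1.simps psi2.simps psi3.simps le_max_iff_disj)

text \<open>
  The selected row reproduces \<open>phi1 w\<close> because the maxima and minima only choose among
  signed coordinates. The last condition in each case bounds the term that enters \<open>phi2\<close>: it is
  another argument of the maximum that attains \<open>phi1 w\<close>.
\<close>

lemma Dphi1_cases: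
  fixes a b \<mu> \<nu> :: real
  defines "w \<equiv> (a, b, \<mu>, \<nu>)"
  obtains (a) s where "Dphi1 w = axis 1 s" "\<bar>s\<bar> = 1" "s * a = phi1 w" "\<bar>b\<bar> \<le> phi1 w \<or> \<bar>\<nu>\<bar> \<le> phi1 w"
  | (b) s where "Dphi1 w = axis 2 s" "\<bar>s\<bar> = 1" "s * b = phi1 w" "\<bar>a\<bar> \<le> phi1 w \<or> \<bar>\<mu>\<bar> \<le> phi1 w"
  | (\<mu>) s where "Dphi1 w = axis 3 s" "\<bar>s\<bar> = 1" "s * \<mu> = phi1 w" "\<bar>b\<bar> \<le> phi1 w"
  | (\<nu>) s where "Dphi1 w = axis 4 s" "\<bar>s\<bar> = 1" "s * \<nu> = phi1 w" "\<bar>a\<bar> \<le> phi1 w"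
proof -
  consider "psi1 w = phi1 w" | "psi1 w \<noteq> phi1 w" "psi2 w = phi1 w"
    | "psi1 w \<noteq> phi1 w" "psi2 w \<noteq> phi1 w" "psi3 w = phi1 w"
    unfolding phi1_def min_def by metis
  then show ?thesis
  proof cases
    case 1
    have max: "psi1 w = - a \<or> psi1 w = \<bar>b\<bar> \<or> psi1 w = \<bar>\<mu>\<bar>"
      and ge: "\<bar>b\<bar> \<le> psi1 w" "\<bar>\<mu>\<bar> \<le> psi1 w"
      unfolding w_def psi1.simps by linarith+
    have D: "Dphi1 w = (if - a = psi1 w then axis 1 (- 1)
        else if \<bar>b\<bar> = psi1 w then axis 2 (sg b) else axis 3 (sg \<mu>))"
      using 1 unfolding w_def Dphi1.simps Let_def by (simp only: if_True if_False simp_thms)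
    consider "- a = psi1 w" | "- a \<noteq> psi1 w" "\<bar>b\<bar> = psi1 w"
      | "- a \<noteq> psi1 w" "\<bar>b\<bar> \<noteq> psi1 w" "\<bar>\<mu>\<bar> = psi1 w" using max by force
    then show ?thesis
    proof cases
      case 1 show ?thesis by (rule a[of "-1"]) (use 1 D ge \<open>psi1 w = phi1 w\<close> in auto)
    next
      case 2 show ?thesis by (rule b[of "sg b"]) (use 2 D ge \<open>psi1 w = phi1 w\<close> in auto)
    next
      case 3 show ?thesis by (rule \<mu>[of "sg \<mu>"]) (use 3 D ge \<open>psi1 w = phi1 w\<close> in auto)
    qed
  next
    case 2
    have max: "psi2 w = - b \<or> psi2 w = \<bar>a\<bar> \<or> psi2 w = \<bar>\<nu>\<bar>"
      and ge: "\<bar>a\<bar> \<le> psi2 w" "\<bar>\<nu>\<bar> \<le> psi2 w"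
      unfolding w_def psi2.simps by linarith+
    have D: "Dphi1 w = (if - b = psi2 w then axis 2 (- 1)
        else if \<bar>a\<bar> = psi2 w then axis 1 (sg a) else axis 4 (sg \<nu>))"
      using 2 unfolding w_def Dphi1.simps Let_def by (simp only: if_True if_False simp_thms)
    consider "- b = psi2 w" | "- b \<noteq> psi2 w" "\<bar>a\<bar> = psi2 w"
      | "- b \<noteq> psi2 w" "\<bar>a\<bar> \<noteq> psi2 w" "\<bar>\<nu>\<bar> = psi2 w" using max by force
    then show ?thesis
    proof cases
      case 1 show ?thesis by (rule b[of "-1"]) (use 1 D ge \<open>psi2 w = phi1 w\<close> in auto)
    next
      case 2 show ?thesis by (rule a[of "sg a"]) (use 2 D ge \<open>psi2 w = phi1 w\<close> in auto)
    next
      case 3 show ?thesis by (rule \<nu>[of "sg \<nu>"]) (use 3 D ge \<open>psi2 w = phi1 w\<close> in auto)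
    qed
  next
    case 3
    have max: "psi3 w = \<bar>a\<bar> \<or> psi3 w = \<bar>b\<bar> \<or> psi3 w = \<mu> \<or> psi3 w = \<nu>"
      and ge: "\<bar>a\<bar> \<le> psi3 w" "\<bar>b\<bar> \<le> psi3 w"
      unfolding w_def psi3.simps by linarith+
    have D: "Dphi1 w = (if \<bar>a\<bar> = psi3 w then axis 1 (sg a)
        else if \<bar>b\<bar> = psi3 w then axis 2 (sg b)
        else if \<mu> = psi3 w then axis 3 1 else axis 4 1)"
      using 3 unfolding w_def Dphi1.simps Let_def by (simp only: if_True if_False simp_thms)
    consider "\<bar>a\<bar> = psi3 w" | "\<bar>a\<bar> \<noteq> psi3 w" "\<bar>b\<bar> = psi3 w"
      | "\<bar>a\<bar> \<noteq> psi3 w" "\<bar>b\<bar> \<noteq> psi3 w" "\<mu> = psi3 w"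
      | "\<bar>a\<bar> \<noteq> psi3 w" "\<bar>b\<bar> \<noteq> psi3 w" "\<mu> \<noteq> psi3 w" "\<nu> = psi3 w" using max by force
    then show ?thesis
    proof cases
      case 1 show ?thesis by (rule a[of "sg a"]) (use 1 D ge \<open>psi3 w = phi1 w\<close> in auto)
    next
      case 2 show ?thesis by (rule b[of "sg b"]) (use 2 D ge \<open>psi3 w = phi1 w\<close> in auto)
    next
      case 3 show ?thesis by (rule \<mu>[of 1]) (use 3 D ge \<open>psi3 w = phi1 w\<close> in auto)
    next
      case 4 show ?thesis by (rule \<nu>[of 1]) (use 4 D ge \<open>psi3 w = phi1 w\<close> in auto)
    qed
  qed
qed

text \<open>
  The positions of the nonzero entries of the two rows of \<open>D\<phi>\<close>. As unordered pairs they are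
  \<open>{a, b}\<close>, \<open>{a, \<nu>}\<close> and \<open>{b, \<mu>}\<close>, which are the coordinates that vanish on the three
  pieces of the set \<open>M_compl\<close>.
\<close>

definition newton_pairs :: "(4 \<times> 4) set" where
  "newton_pairs = {(1, 2), (1, 4), (2, 1), (2, 3), (3, 2), (4, 1)}"

text \<open>
  The second component never exceeds the first one, so \<open>phi1\<close> alone controls the size of \<open>\<phi>\<close>
  although \<open>phi2\<close> jumps where the selection changes.
\<close>

lemma phi_selection:
  obtains i j s t where "(i, j) \<in> newton_pairs" "\<bar>s\<bar> = 1" "\<bar>t\<bar> = 1"
    "Dphi1 w = axis i s" "Dphi2 w = axis j t"
    "s * coord w $ i = phi1 w" "t * coord w $ j = phi2 w" "0 \<le> phi2 w" "phi2 w \<le> phi1 w"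
proof -
  obtain a b \<mu> \<nu> where w: "w = (a, b, \<mu>, \<nu>)" by (cases w)
  have pm: "s = 1 \<or> s = -1" if "\<bar>s\<bar> = 1" for s :: real using that by auto
  show ?thesis
  proof (cases rule: Dphi1_cases[of a b \<mu> \<nu>])
    case (a s)
    have [simp]: "Dphi1 w \<in> {axis 1 1, axis 1 (- 1)}" using a(1) pm[OF a(2)] by (auto simp: w)
    then have E: "Dphi2 w = (if \<bar>b\<bar> \<le> \<bar>\<nu>\<bar> then axis 2 (sg b) else axis 4 (sg \<nu>))"
      "phi2 w = min \<bar>b\<bar> \<bar>\<nu>\<bar>" by (simp_all add: w Let_def del: Dphi1.simps)
    show ?thesis
    proof (cases "\<bar>b\<bar> \<le> \<bar>\<nu>\<bar>")
      case True
      show ?thesis by (rule that[of 1 2 s "sg b"])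
        (use a True E in \<open>auto simp: newton_pairs_def w simp del: Dphi1.simps Dphi2.simps phi2.simps\<close>)
    next
      case False
      show ?thesis by (rule that[of 1 4 s "sg \<nu>"])
        (use a False E in \<open>auto simp: newton_pairs_def w simp del: Dphi1.simps Dphi2.simps phi2.simps\<close>)
    qed
  next
    case (b s)
    have [simp]: "Dphi1 w \<in> {axis 2 1, axis 2 (- 1)}" "Dphi1 w \<notin> {axis 1 1, axis 1 (- 1)}"
      using b(1) pm[OF b(2)] by (auto simp: w axis_eq_axis)
    then have E: "Dphi2 w = (if \<bar>a\<bar> \<le> \<bar>\<mu>\<bar> then axis 1 (sg a) else axis 3 (sg \<mu>))"
      "phi2 w = min \<bar>a\<bar> \<bar>\<mu>\<bar>" by (simp_all add: w Let_def del: Dphi1.simps)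
    show ?thesis
    proof (cases "\<bar>a\<bar> \<le> \<bar>\<mu>\<bar>")
      case True
      show ?thesis by (rule that[of 2 1 s "sg a"])
        (use b True E in \<open>auto simp: newton_pairs_def w simp del: Dphi1.simps Dphi2.simps phi2.simps\<close>)
    next
      case False
      show ?thesis by (rule that[of 2 3 s "sg \<mu>"])
        (use b False E in \<open>auto simp: newton_pairs_def w simp del: Dphi1.simps Dphi2.simps phi2.simps\<close>)
    qed
  next
    case (\<mu> s)
    have [simp]: "Dphi1 w \<in> {axis 3 1, axis 3 (- 1)}" "Dphi1 w \<notin> {axis 1 1, axis 1 (- 1)}"
      "Dphi1 w \<notin> {axis 2 1, axis 2 (- 1)}"
      using \<mu>(1) pm[OF \<mu>(2)] by (auto simp: w axis_eq_axis)
    then have E: "Dphi2 w = axis 2 (sg b)" "phi2 w = \<bar>b\<bar>" by (simp_all add: w Let_def del: Dphi1.simps)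
    show ?thesis by (rule that[of 3 2 s "sg b"])
      (use \<mu> E in \<open>auto simp: newton_pairs_def w simp del: Dphi1.simps Dphi2.simps phi2.simps\<close>)
  next
    case (\<nu> s)
    have [simp]: "Dphi1 w \<notin> {axis 3 1, axis 3 (- 1)}" "Dphi1 w \<notin> {axis 1 1, axis 1 (- 1)}"
      "Dphi1 w \<notin> {axis 2 1, axis 2 (- 1)}"
      using \<nu>(1) pm[OF \<nu>(2)] by (auto simp: w axis_eq_axis)
    then have E: "Dphi2 w = axis 1 (sg a)" "phi2 w = \<bar>a\<bar>" by (simp_all add: w Let_def del: Dphi1.simps)
    show ?thesis by (rule that[of 4 1 s "sg a"])
      (use \<nu> E in \<open>auto simp: newton_pairs_def w simp del: Dphi1.simps Dphi2.simps phi2.simps\<close>)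
  qed
qed

declare Dphi1.simps [simp del] Dphi2.simps [simp del] phi2.simps [simp del]

text \<open>
  The conditions of feasibility and M-stationarity on one index of the complementarity constraint.
\<close>

fun M_compl :: "real \<times> real \<times> real \<times> real \<Rightarrow> bool" where
  "M_compl (a, b, \<mu>, \<nu>) \<longleftrightarrow> 0 \<le> a \<and> 0 \<le> b \<and> a * b = 0 \<and> a * \<mu> = 0 \<and> b * \<nu> = 0 \<and>
     (\<mu> * \<nu> = 0 \<or> (\<mu> < 0 \<and> \<nu> < 0))"

text \<open>
  Each \<open>\<psi>\<^sub>i\<close> is the distance in the maximum norm to one of the convex sets
  \<open>{a \<ge> 0, b = \<mu> = 0}\<close>, \<open>{b \<ge> 0, a = \<nu> = 0}\<close> and \<open>{a = b = 0, \<mu> \<le> 0, \<nu> \<le> 0}\<close>, and the union of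
  these sets is \<open>M_compl\<close>.
\<close>

lemma phi1_eq_0_iff: "phi1 w = 0 \<longleftrightarrow> M_compl w"
proof -
  obtain a b \<mu> \<nu> where w: "w = (a, b, \<mu>, \<nu>)" by (cases w)
  have "psi1 w \<ge> 0" "psi2 w \<ge> 0" "psi3 w \<ge> 0" by (simp_all add: w psi1.simps psi2.simps psi3.simps le_max_iff_disj)
  then have "phi1 w = 0 \<longleftrightarrow> psi1 w = 0 \<or> psi2 w = 0 \<or> psi3 w = 0"
    unfolding phi1_def by (smt (verit))
  moreover have "psi1 w = 0 \<longleftrightarrow> 0 \<le> a \<and> b = 0 \<and> \<mu> = 0" unfolding w psi1.simps by (smt (verit))
  moreover have "psi2 w = 0 \<longleftrightarrow> 0 \<le> b \<and> a = 0 \<and> \<nu> = 0" unfolding w psi2.simps by (smt (verit))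
  moreover have "psi3 w = 0 \<longleftrightarrow> a = 0 \<and> b = 0 \<and> \<mu> \<le> 0 \<and> \<nu> \<le> 0" unfolding w psi3.simps by (smt (verit))
  ultimately show ?thesis unfolding w M_compl.simps by (smt (verit) mult_eq_0_iff)
qed

lemma phi1_lipschitz: "\<bar>phi1 w - phi1 w'\<bar> \<le> norm (coord w - coord w')"
proof -
  obtain a b \<mu> \<nu> where w: "w = (a, b, \<mu>, \<nu>)" by (cases w)
  obtain a' b' \<mu>' \<nu>' where w': "w' = (a', b', \<mu>', \<nu>')" by (cases w')
  define n where "n = norm (coord w - coord w')"
  have c: "\<bar>(coord w - coord w') $ i\<bar> \<le> n" for i
    unfolding n_def by (rule component_le_norm_cart)
  have 0: "\<bar>a - a'\<bar> \<le> n" "\<bar>b - b'\<bar> \<le> n" "\<bar>\<mu> - \<mu>'\<bar> \<le> n" "\<bar>\<nu> - \<nu>'\<bar> \<le> n"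
    using c[of 1] c[of 2] c[of 3] c[of 4] by (simp_all add: w w' del: coord.simps)
  have mx: "\<bar>max s t - max s' t'\<bar> \<le> n" if "\<bar>s - s'\<bar> \<le> n" "\<bar>t - t'\<bar> \<le> n" for s t s' t' :: real
    using that by linarith
  have mn: "\<bar>min s t - min s' t'\<bar> \<le> n" if "\<bar>s - s'\<bar> \<le> n" "\<bar>t - t'\<bar> \<le> n" for s t s' t' :: real
    using that by linarith
  have ab: "\<bar>\<bar>s\<bar> - \<bar>s'\<bar>\<bar> \<le> n" if "\<bar>s - s'\<bar> \<le> n" for s s' :: real
    using that by linarith
  have ng: "\<bar>- s - - s'\<bar> \<le> n" if "\<bar>s - s'\<bar> \<le> n" for s s' :: real
    using that by linarith
  show ?thesis unfolding phi1_def w w' psi1.simps psi2.simps psi3.simps n_def[symmetric, unfolded w w']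
    by (intro mx mn ab ng 0)
qed

section \<open>Comparison with the Fischer-Burmeister residual\<close>

text \<open>
  The two residuals of complementarity are equivalent; by symmetry only \<open>a \<le> b\<close> has to be
  considered, and then \<open>\<surd>(a\<^sup>2 + b\<^sup>2)\<close> differs from \<open>\<bar>b\<bar>\<close> by at most \<open>\<bar>a\<bar>\<close>.
\<close>

lemma min_le_pi_FB: "\<bar>min a b\<bar> \<le> 2 * \<bar>pi_FB a b\<bar>"
  and pi_FB_le_min: "\<bar>pi_FB a b\<bar> \<le> 4 * \<bar>min a b\<bar>"
proof -
  have *: "\<bar>a\<bar> \<le> 2 * \<bar>pi_FB a b\<bar> \<and> \<bar>pi_FB a b\<bar> \<le> 4 * \<bar>a\<bar>" if ab: "a \<le> b" for a b :: real
  proof -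
    define r where "r = sqrt (a\<^sup>2 + b\<^sup>2)"
    have r: "\<bar>b\<bar> \<le> r" "r \<le> \<bar>a\<bar> + \<bar>b\<bar>" 
      unfolding r_def using sqrt_sum_squares_le_sum_abs[of a b] real_sqrt_sum_squares_ge2[of "\<bar>b\<bar>" "\<bar>a\<bar>"] by auto
    have p: "pi_FB a b = r - a - b" by (simp add: pi_FB_def r_def)
    show ?thesis
    proof (cases "0 \<le> a")
      case True
      have sq: "a * a \<le> a * b + a * a / 4"
        using mult_left_mono[OF ab True] zero_le_square[of a] by linarith
      have "r \<le> b + a / 2" unfolding r_def
        by (rule real_le_lsqrt) (use sq True ab in \<open>simp_all add: power2_eq_square algebra_simps\<close>)
      then show ?thesis using r True ab by (auto simp: p)
    next
      case False
      then show ?thesis using r ab by (auto simp: p)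
    qed
  qed
  have sym: "pi_FB a b = pi_FB b a" by (simp add: pi_FB_def add.commute)
  show "\<bar>min a b\<bar> \<le> 2 * \<bar>pi_FB a b\<bar>" "\<bar>pi_FB a b\<bar> \<le> 4 * \<bar>min a b\<bar>"
    using *[of a b] *[of b a] sym by (auto simp: min_def)
qed

text \<open>
  The fourth component of \<open>\<theta>\<^sub>F\<^sub>B\<close> as a function of the two multipliers.
\<close>

definition theta4 :: "real \<times> real \<Rightarrow> real" where
  "theta4 = (\<lambda>(\<mu>, \<nu>). if \<mu> \<le> 0 \<and> \<nu> \<le> 0 then 0 else pi_FB \<bar>\<mu>\<bar> \<bar>\<nu>\<bar>)"

lemma norm_theta_FB_sq:
  "(norm (theta_FB (a, b, \<mu>, \<nu>)))\<^sup>2 =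
     (pi_FB a b)\<^sup>2 + (pi_FB \<bar>a\<bar> \<bar>\<mu>\<bar>)\<^sup>2 + (pi_FB \<bar>b\<bar> \<bar>\<nu>\<bar>)\<^sup>2 + (theta4 (\<mu>, \<nu>))\<^sup>2"
  by (simp add: power2_norm_eq_inner) (simp add: inner_vec_def sum_4 theta4_def power2_eq_square)

text \<open>
  If the four minima behind the components of \<open>\<theta>\<^sub>F\<^sub>B\<close> are at most \<open>e\<close>, then \<open>w\<close> is within \<open>e\<close> of one
  of the three pieces of \<open>M_compl\<close>. Indeed \<open>a\<close> and \<open>b\<close> are at least \<open>- e\<close>, and one of \<open>\<bar>a\<bar>\<close>, \<open>\<bar>b\<bar>\<close> is at
  most \<open>e\<close>, say \<open>\<bar>b\<bar>\<close>; either
  \<open>\<bar>\<mu>\<bar> \<le> e\<close>, which bounds \<open>\<psi>\<^sub>1\<close>, or also \<open>\<bar>a\<bar> \<le> e\<close>, and then the fourth component decides between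
  \<open>\<psi>\<^sub>3\<close> and one of \<open>\<psi>\<^sub>1\<close>, \<open>\<psi>\<^sub>2\<close>.
\<close>

lemma phi1_le_theta_FB: "phi1 w \<le> 2 * norm (theta_FB w)"
proof -
  obtain a b \<mu> \<nu> where w: "w = (a, b, \<mu>, \<nu>)" by (cases w)
  have t: "theta_FB w $ 1 = \<bar>pi_FB a b\<bar>" "theta_FB w $ 2 = pi_FB \<bar>a\<bar> \<bar>\<mu>\<bar>"
    "theta_FB w $ 3 = pi_FB \<bar>b\<bar> \<bar>\<nu>\<bar>"
    "theta_FB w $ 4 = (if \<mu> \<le> 0 \<and> \<nu> \<le> 0 then 0 else pi_FB \<bar>\<mu>\<bar> \<bar>\<nu>\<bar>)"
    by (simp_all add: w)
  define e where "e = 2 * norm (theta_FB w)"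
  have c: "2 * \<bar>theta_FB w $ i\<bar> \<le> e" for i
    unfolding e_def using component_le_norm_cart[of "theta_FB w" i] by auto
  have 1: "\<bar>min a b\<bar> \<le> e" "\<bar>min \<bar>a\<bar> \<bar>\<mu>\<bar>\<bar> \<le> e" "\<bar>min \<bar>b\<bar> \<bar>\<nu>\<bar>\<bar> \<le> e"
    "\<not> (\<mu> \<le> 0 \<and> \<nu> \<le> 0) \<Longrightarrow> \<bar>min \<bar>\<mu>\<bar> \<bar>\<nu>\<bar>\<bar> \<le> e"
    using c[of 1, unfolded t] c[of 2, unfolded t] c[of 3, unfolded t] c[of 4, unfolded t]
      min_le_pi_FB[of a b] min_le_pi_FB[of "\<bar>a\<bar>" "\<bar>\<mu>\<bar>"] min_le_pi_FB[of "\<bar>b\<bar>" "\<bar>\<nu>\<bar>"] min_le_pi_FB[of "\<bar>\<mu>\<bar>" "\<bar>\<nu>\<bar>"]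
    by (simp_all only: abs_idempotent if_False)
  have "psi1 w \<le> e \<or> psi2 w \<le> e \<or> psi3 w \<le> e"
    using 1 unfolding w psi1.simps psi2.simps psi3.simps by (smt (verit))
  then show ?thesis by (auto simp: phi1_def e_def)
qed

lemma theta_FB_le_phi1: "norm (theta_FB w) \<le> 16 * phi1 w"
proof -
  obtain a b \<mu> \<nu> where w: "w = (a, b, \<mu>, \<nu>)" by (cases w)
  have t: "theta_FB w $ 1 = \<bar>pi_FB a b\<bar>" "theta_FB w $ 2 = pi_FB \<bar>a\<bar> \<bar>\<mu>\<bar>"
    "theta_FB w $ 3 = pi_FB \<bar>b\<bar> \<bar>\<nu>\<bar>"
    "theta_FB w $ 4 = (if \<mu> \<le> 0 \<and> \<nu> \<le> 0 then 0 else pi_FB \<bar>\<mu>\<bar> \<bar>\<nu>\<bar>)"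
    by (simp_all add: w)
  define e where "e = phi1 w"
  have e: "psi1 w = e \<or> psi2 w = e \<or> psi3 w = e" unfolding e_def phi1_def by (smt (verit))
  have 1: "\<bar>min a b\<bar> \<le> e" "\<bar>min \<bar>a\<bar> \<bar>\<mu>\<bar>\<bar> \<le> e" "\<bar>min \<bar>b\<bar> \<bar>\<nu>\<bar>\<bar> \<le> e"
    "\<not> (\<mu> \<le> 0 \<and> \<nu> \<le> 0) \<Longrightarrow> \<bar>min \<bar>\<mu>\<bar> \<bar>\<nu>\<bar>\<bar> \<le> e"
    using e unfolding w psi1.simps psi2.simps psi3.simps by (smt (verit))+
  have 2: "\<bar>theta_FB w $ 1\<bar> \<le> 4 * e" "\<bar>theta_FB w $ 2\<bar> \<le> 4 * e" "\<bar>theta_FB w $ 3\<bar> \<le> 4 * e" "\<bar>theta_FB w $ 4\<bar> \<le> 4 * e"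
    using 1 pi_FB_le_min[of a b] pi_FB_le_min[of "\<bar>a\<bar>" "\<bar>\<mu>\<bar>"] pi_FB_le_min[of "\<bar>b\<bar>" "\<bar>\<nu>\<bar>"] pi_FB_le_min[of "\<bar>\<mu>\<bar>" "\<bar>\<nu>\<bar>"]
      phi1_nonneg[of w, folded e_def]
    unfolding t by (smt (verit))+
  have "norm (theta_FB w) \<le> (\<Sum>i\<in>UNIV. \<bar>theta_FB w $ i\<bar>)" by (rule norm_le_l1_cart)
  also have "\<dots> \<le> 16 * e" using 2 by (simp add: sum_4)
  finally show ?thesis by (simp add: e_def)
qed

lemma norm_phi_le: "norm (phi w) \<le> 2 * phi1 w" and phi1_le_norm_phi: "phi1 w \<le> norm (phi w)"
proof -
  have "0 \<le> phi2 w" "phi2 w \<le> phi1 w" by (metis phi_selection)+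
  then show "norm (phi w) \<le> 2 * phi1 w"
    using norm_le_l1_cart[of "phi w"] by (simp add: sum_2 phi_def phi1_nonneg vector_2)
  show "phi1 w \<le> norm (phi w)"
    using component_le_norm_cart[of "phi w" 1] by (simp add: phi_def vector_2)
qed

section \<open>Exactness of the linearization of phi near a zero\<close>

text \<open>
  The situation at points \<open>w\<close> near a zero \<open>w\<^sub>0\<close> of \<open>\<phi>\<close>: the linearization with the derivative
  taken at \<open>w\<close> has no error at all, and its rows select coordinates that vanish at \<open>w\<^sub>0\<close>.
\<close>

definition exact_selection :: "real \<times> real \<times> real \<times> real \<Rightarrow> real \<times> real \<times> real \<times> real \<Rightarrow> bool" where
  "exact_selection w\<^sub>0 w \<longleftrightarrow>
    (\<exists>i j s t. (i, j) \<in> newton_pairs \<and> coord w\<^sub>0 $ i = 0 \<and> coord w\<^sub>0 $ j = 0 \<and> \<bar>s\<bar> = 1 \<and> \<bar>t\<bar> = 1 \<and>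
      Dphi1 w = axis i s \<and> Dphi2 w = axis j t \<and>
      phi1 w = Dphi1 w \<bullet> (coord w - coord w\<^sub>0) \<and> phi2 w = Dphi2 w \<bullet> (coord w - coord w\<^sub>0))"

text \<open>
  A selected coordinate of \<open>w\<close> has absolute value at most \<open>phi1 w\<close>, hence at most the distance of
  \<open>w\<close> to \<open>w\<^sub>0\<close>. For \<open>w\<close> close to \<open>w\<^sub>0\<close> this forces the same coordinate of \<open>w\<^sub>0\<close> to be zero, so that the
  row which gives \<open>\<phi>(w)\<close> gives \<open>0\<close> on \<open>w\<^sub>0\<close>.
\<close>

lemma phi_newton_exact:
  assumes "M_compl w\<^sub>0"
  shows "\<exists>\<epsilon>>0. \<forall>w. norm (coord w - coord w\<^sub>0) < \<epsilon> \<longrightarrow> exact_selection w\<^sub>0 w"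
proof -
  \<comment> \<open>Half of the smallest nonzero coordinate of \<open>w\<^sub>0\<close> in absolute value, or \<open>1\<close> if that is smaller or if
      all of them are zero.\<close>
  define \<epsilon> where "\<epsilon> = Min (insert 1 ((\<lambda>i. \<bar>coord w\<^sub>0 $ i\<bar> / 2) ` {i. coord w\<^sub>0 $ i \<noteq> 0}))"
  have "\<epsilon> > 0" by (auto simp: \<epsilon>_def)
  moreover have small: "coord w\<^sub>0 $ i = 0 \<or> 2 * \<epsilon> \<le> \<bar>coord w\<^sub>0 $ i\<bar>" for i
  proof -
    have "\<epsilon> \<le> \<bar>coord w\<^sub>0 $ i\<bar> / 2" if "coord w\<^sub>0 $ i \<noteq> 0"
      unfolding \<epsilon>_def by (rule Min_le) (use that in auto)
    then show ?thesis by (cases "coord w\<^sub>0 $ i = 0") (simp_all add: field_simps)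
  qed
  moreover have "exact_selection w\<^sub>0 w"
    if near: "norm (coord w - coord w\<^sub>0) < \<epsilon>" for w
  proof -
    obtain i j s t where ij: "(i, j) \<in> newton_pairs" "\<bar>s\<bar> = 1" "\<bar>t\<bar> = 1"
      "Dphi1 w = axis i s" "Dphi2 w = axis j t"
      "s * coord w $ i = phi1 w" "t * coord w $ j = phi2 w" "0 \<le> phi2 w" "phi2 w \<le> phi1 w"
      by (rule phi_selection)
    have "phi1 w < \<epsilon>"
      using phi1_lipschitz[of w w\<^sub>0] near phi1_eq_0_iff[of w\<^sub>0] assms by simp
    moreover have "\<bar>coord w $ i\<bar> = \<bar>phi1 w\<bar>" "\<bar>coord w $ j\<bar> = \<bar>phi2 w\<bar>"
      using ij(2,3) ij(6,7)[symmetric] by (simp_all add: abs_mult)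
    moreover have "\<bar>coord w $ k - coord w\<^sub>0 $ k\<bar> < \<epsilon>" for k
      using component_le_norm_cart[of "coord w - coord w\<^sub>0" k] near by simp
    ultimately have z: "coord w\<^sub>0 $ i = 0" "coord w\<^sub>0 $ j = 0"
      using small[of i] small[of j] ij(8,9) by (smt (verit))+
    then show ?thesis unfolding exact_selection_def
      using ij by (intro exI[of _ i] exI[of _ j] exI[of _ s] exI[of _ t])
        (simp add: inner_axis' )
  qed
  ultimately show ?thesis by blast
qed

section \<open>Continuously differentiable maps\<close>

text \<open>
  The derivative is a map into the normed space of bounded linear operators, so that its
  continuity is the usual one and compositions and products need no coordinates.
\<close>

definition cont_diff :: "('a::real_normed_vector \<Rightarrow> 'b::real_normed_vector) \<Rightarrow> bool" where
  "cont_diff f \<longleftrightarrow> (\<exists>f'. (\<forall>x. (f has_derivative blinfun_apply (f' x)) (at x)) \<and> continuous_on UNIV f')"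

lemma cont_diffI:
  assumes "\<And>x. (f has_derivative blinfun_apply (f' x)) (at x)" "continuous_on UNIV f'"
  shows "cont_diff f"
  using assms by (auto simp: cont_diff_def)

lemma cont_diff_imp_continuous: "cont_diff f \<Longrightarrow> continuous_on UNIV f"
  by (meson cont_diff_def continuous_at_imp_continuous_on has_derivative_continuous)

lemma cont_diff_bounded_linear:
  assumes "bounded_linear f" shows "cont_diff f"
proof (rule cont_diffI[where f' = "\<lambda>_. Blinfun f"])
  show "(f has_derivative blinfun_apply (Blinfun f)) (at x)" for x
    using bounded_linear_imp_has_derivative[OF assms] by (simp add: bounded_linear_Blinfun_apply[OF assms])
qed auto

lemma cont_diff_const [simp]: "cont_diff (\<lambda>_. c)"
  by (rule cont_diffI[where f' = "\<lambda>_. 0"]) (auto intro!: derivative_eq_intros continuous_intros)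

lemma cont_diff_compose:
  assumes "cont_diff f" "cont_diff g" shows "cont_diff (\<lambda>x. f (g x))"
proof -
  obtain f' where f': "\<And>x. (f has_derivative blinfun_apply (f' x)) (at x)" "continuous_on UNIV f'"
    using assms(1) unfolding cont_diff_def by blast
  obtain g' where g': "\<And>x. (g has_derivative blinfun_apply (g' x)) (at x)" "continuous_on UNIV g'"
    using assms(2) unfolding cont_diff_def by blast
  show ?thesis
  proof (rule cont_diffI[where f' = "\<lambda>x. f' (g x) o\<^sub>L g' x"])
    show "((\<lambda>x. f (g x)) has_derivative blinfun_apply (f' (g x) o\<^sub>L g' x)) (at x)" for x
      using has_derivative_compose[OF g'(1) f'(1), of x]
      by (simp add: blinfun_compose.rep_eq o_def)
    have "continuous_on UNIV (\<lambda>x. f' (g x))"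
      by (rule continuous_on_compose2[OF f'(2) cont_diff_imp_continuous[OF assms(2)]]) auto
    then show "continuous_on UNIV (\<lambda>x. f' (g x) o\<^sub>L g' x)"
      using g'(2) by (intro continuous_intros)
  qed
qed

lemma cont_diff_bilinear:
  assumes "bounded_bilinear B" "cont_diff f" "cont_diff g"
  shows "cont_diff (\<lambda>x. B (f x) (g x))"
proof -
  interpret bounded_bilinear B by fact
  obtain f' where f': "\<And>x. (f has_derivative blinfun_apply (f' x)) (at x)" "continuous_on UNIV f'"
    using assms(2) unfolding cont_diff_def by blast
  obtain g' where g': "\<And>x. (g has_derivative blinfun_apply (g' x)) (at x)" "continuous_on UNIV g'"
    using assms(3) unfolding cont_diff_def by blast
  show ?thesis
  proof (rule cont_diffI[where f' = "\<lambda>x. (prod_right (f x) o\<^sub>L g' x) + (prod_left (g x) o\<^sub>L f' x)"])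
    show "((\<lambda>x. B (f x) (g x)) has_derivative blinfun_apply ((prod_right (f x) o\<^sub>L g' x) + (prod_left (g x) o\<^sub>L f' x))) (at x)" for x
      using FDERIV[OF f'(1) g'(1), of x]
      by (simp add: blinfun.bilinear_simps prod_right.rep_eq prod_left.rep_eq plus_blinfun.rep_eq)
    have "continuous_on UNIV (\<lambda>x. prod_right (f x))" "continuous_on UNIV (\<lambda>x. prod_left (g x))"
      using assms(2,3)[THEN cont_diff_imp_continuous]
      by (auto intro: bounded_linear.continuous_on bounded_linear_prod_right bounded_linear_prod_left)
    then show "continuous_on UNIV (\<lambda>x. (prod_right (f x) o\<^sub>L g' x) + (prod_left (g x) o\<^sub>L f' x))"
      using f'(2) g'(2)
      by (intro continuous_on_add bounded_bilinear.continuous_on[OF bounded_bilinear_blinfun_compose])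
  qed
qed

lemma cont_diff_add:
  assumes "cont_diff f" "cont_diff g" shows "cont_diff (\<lambda>x. f x + g x)"
proof -
  obtain f' where f': "\<And>x. (f has_derivative blinfun_apply (f' x)) (at x)" "continuous_on UNIV f'"
    using assms(1) unfolding cont_diff_def by blast
  obtain g' where g': "\<And>x. (g has_derivative blinfun_apply (g' x)) (at x)" "continuous_on UNIV g'"
    using assms(2) unfolding cont_diff_def by blast
  show ?thesis
  proof (rule cont_diffI[where f' = "\<lambda>x. f' x + g' x"])
    show "((\<lambda>x. f x + g x) has_derivative blinfun_apply (f' x + g' x)) (at x)" for x
      using has_derivative_add[OF f'(1) g'(1)] by (simp add: plus_blinfun.rep_eq)
    show "continuous_on UNIV (\<lambda>x. f' x + g' x)" using f'(2) g'(2) by (intro continuous_intros)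
  qed
qed

lemma cont_diff_sum:
  assumes "\<And>i. i \<in> I \<Longrightarrow> cont_diff (f i)" shows "cont_diff (\<lambda>x. \<Sum>i\<in>I. f i x)"
  using assms by (induction I rule: infinite_finite_induct) (auto intro: cont_diff_add)

lemma cont_diff_linear_compose:
  "bounded_linear L \<Longrightarrow> cont_diff f \<Longrightarrow> cont_diff (\<lambda>x. L (f x))"
  by (rule cont_diff_compose[OF cont_diff_bounded_linear])

text \<open>
  The pair is the sum of the linear images \<open>(f x, 0)\<close> and \<open>(0, g x)\<close>.
\<close>

lemma cont_diff_Pair:
  assumes "cont_diff f" "cont_diff g" shows "cont_diff (\<lambda>x. (f x, g x))"
proof -
  have "cont_diff (\<lambda>x. (f x, 0) + (0, g x))"
    by (intro cont_diff_add cont_diff_linear_compose[OF _ assms(1)] cont_diff_linear_compose[OF _ assms(2)]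
      bounded_linear_Pair bounded_linear_ident bounded_linear_zero)
  then show ?thesis by simp
qed

lemma cont_diff_grad:
  fixes f :: "'a::euclidean_space \<Rightarrow> real"
  assumes "cont_diff f"
  shows GDERIV_grad: "GDERIV f x :> grad f x" and continuous_on_grad: "continuous_on UNIV (grad f)"
proof -
  obtain f' where f': "\<And>x. (f has_derivative blinfun_apply (f' x)) (at x)" "continuous_on UNIV f'"
    using assms unfolding cont_diff_def by blast
  define D where "D x = (\<Sum>e\<in>Basis. f' x e *\<^sub>R e)" for x
  have D: "GDERIV f x :> D x" for x
  proof -
    have "blinfun_apply (f' x) = (\<lambda>h. h \<bullet> D x)"
    proof
      fix h
      have "f' x h = f' x (\<Sum>e\<in>Basis. (h \<bullet> e) *\<^sub>R e)" by (simp add: euclidean_representation)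
      also have "\<dots> = h \<bullet> D x"
        by (simp add: blinfun.bilinear_simps blinfun.sum_right D_def inner_sum_right mult.commute)
      finally show "f' x h = h \<bullet> D x" .
    qed
    then show ?thesis using f'(1)[of x] by (simp add: gderiv_def)
  qed
  have grad: "grad f = D"
  proof
    fix x
    show "grad f x = D x"
      unfolding grad_def proof (rule the_equality)
      show "GDERIV f x :> D x" by (rule D)
    next
      fix E assume "GDERIV f x :> E"
      then have "(\<lambda>h. h \<bullet> E) = (\<lambda>h. h \<bullet> D x)"
        using D[of x] has_derivative_unique unfolding gderiv_def by blast
      then show "E = D x" by (metis vector_eq_ldot)
    qed
  qed
  show "GDERIV f x :> grad f x" using D grad by simp
  show "continuous_on UNIV (grad f)"
    unfolding grad D_def by (intro continuous_intros f'(2))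
qed

lemma cont_diff_partials:
  fixes f :: "real \<times> real \<Rightarrow> real"
  assumes "\<And>w. (f has_derivative (\<lambda>d. fa w * fst d + fb w * snd d)) (at w)"
    and "continuous_on UNIV fa" "continuous_on UNIV fb"
  shows "cont_diff f"
proof (rule cont_diffI[where f' = "\<lambda>w. fa w *\<^sub>R fst_blinfun + fb w *\<^sub>R snd_blinfun"])
  show "(f has_derivative blinfun_apply (fa w *\<^sub>R fst_blinfun + fb w *\<^sub>R snd_blinfun)) (at w)" for w
    using assms(1)[of w] by (simp add: plus_blinfun.rep_eq scaleR_blinfun.rep_eq)
qed (intro continuous_intros assms)

section \<open>Smoothness of the squared Fischer-Burmeister terms\<close>

text \<open>
  Squaring repairs a kink on the zero set: where \<open>u\<close> vanishes, \<open>u\<^sup>2\<close> is dominated by the squared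
  distance, so it has derivative \<open>0\<close> there, and the formula \<open>2 u Du\<close> tends to \<open>0\<close> because \<open>Du\<close> is
  bounded.
\<close>

lemma cont_diff_square:
  fixes u Da Db :: "real \<times> real \<Rightarrow> real"
  assumes der: "\<And>w. u w \<noteq> 0 \<Longrightarrow> (u has_derivative (\<lambda>d. Da w * fst d + Db w * snd d)) (at w)"
    and cont: "\<And>w. u w \<noteq> 0 \<Longrightarrow> isCont Da w" "\<And>w. u w \<noteq> 0 \<Longrightarrow> isCont Db w"
    and bound: "\<And>w. \<bar>Da w\<bar> \<le> K" "\<And>w. \<bar>Db w\<bar> \<le> K"
    and zero: "\<And>w w\<^sub>0. u w\<^sub>0 = 0 \<Longrightarrow> \<bar>u w\<bar> \<le> K * norm (w - w\<^sub>0)"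
  shows "cont_diff (\<lambda>w. (u w)\<^sup>2)"
proof (rule cont_diff_partials[where fa = "\<lambda>w. 2 * u w * Da w" and fb = "\<lambda>w. 2 * u w * Db w"])
  have ucont: "isCont u w" for w
  proof (cases "u w = 0")
    case True
    have "((\<lambda>w'. K * norm (w' - w)) \<longlongrightarrow> K * norm (w - w)) (at w)"
      by (intro tendsto_intros)
    then have "((\<lambda>w'. u w') \<longlongrightarrow> 0) (at w)"
      by (intro Lim_null_comparison[of u "\<lambda>w'. K * norm (w' - w)"]) (use zero[OF True] in auto)
    then show ?thesis using True by (simp add: isCont_def)
  next
    case False then show ?thesis using der has_derivative_continuous by blast
  qed
  have prod: "isCont (\<lambda>w. 2 * u w * D w) w"
    if D: "\<And>w. u w \<noteq> 0 \<Longrightarrow> isCont D w" "\<And>w. \<bar>D w\<bar> \<le> K" for D w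
  proof (cases "u w = 0")
    case True
    have "((\<lambda>w'. 2 * \<bar>u w'\<bar> * K) \<longlongrightarrow> 2 * \<bar>u w\<bar> * K) (at w)"
      using ucont[of w] by (intro tendsto_intros) (simp add: isCont_def)
    then have lim: "((\<lambda>w'. 2 * \<bar>u w'\<bar> * K) \<longlongrightarrow> 0) (at w)" using True by simp
    have ev: "\<forall>\<^sub>F w' in at w. norm (2 * u w' * D w') \<le> 2 * \<bar>u w'\<bar> * K"
    proof (intro always_eventually allI)
      fix w'
      show "norm (2 * u w' * D w') \<le> 2 * \<bar>u w'\<bar> * K"
        unfolding real_norm_def abs_mult by (rule order_trans[OF mult_left_mono[OF D(2)]]) simp_all
    qed
    have "((\<lambda>w'. 2 * u w' * D w') \<longlongrightarrow> 0) (at w)"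
      by (rule Lim_null_comparison[OF ev lim])
    then show ?thesis using True by (simp add: isCont_def)
  next
    case False then show ?thesis by (intro continuous_intros ucont D(1))
  qed
  show "continuous_on UNIV (\<lambda>w. 2 * u w * Da w)" "continuous_on UNIV (\<lambda>w. 2 * u w * Db w)"
    using prod cont bound by (auto intro!: continuous_at_imp_continuous_on)
  show "((\<lambda>w. (u w)\<^sup>2) has_derivative (\<lambda>d. 2 * u w * Da w * fst d + 2 * u w * Db w * snd d)) (at w)" for w
  proof (cases "u w = 0")
    case True
    have "((\<lambda>w'. K\<^sup>2 * norm (w' - w)) \<longlongrightarrow> K\<^sup>2 * norm (w - w)) (at w)"
      by (intro tendsto_intros)
    then have lim: "((\<lambda>w'. K\<^sup>2 * norm (w' - w)) \<longlongrightarrow> 0) (at w)" by simp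
    have "norm (norm ((u w')\<^sup>2 - (u w)\<^sup>2 - 0) / norm (w' - w)) \<le> K\<^sup>2 * norm (w' - w)" for w'
    proof (cases "w' = w")
      case False
      have "(u w')\<^sup>2 \<le> (K * norm (w' - w))\<^sup>2"
        using power_mono[OF zero[OF True, of w'] abs_ge_zero, of 2] by simp
      then show ?thesis using True False by (simp add: field_simps power2_eq_square)
    qed simp
    then have ev: "\<forall>\<^sub>F w' in at w. norm (norm ((u w')\<^sup>2 - (u w)\<^sup>2 - 0) / norm (w' - w)) \<le> K\<^sup>2 * norm (w' - w)"
      by (rule always_eventually[OF allI])
    have "((\<lambda>w'. norm ((u w')\<^sup>2 - (u w)\<^sup>2 - 0) / norm (w' - w)) \<longlongrightarrow> 0) (at w)"
      by (rule Lim_null_comparison[OF ev lim])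
    then have "((\<lambda>w. (u w)\<^sup>2) has_derivative (\<lambda>d. 0)) (at w)"
      by (simp add: has_derivative_iff_norm)
    then show ?thesis using True by simp
  next
    case False
    show ?thesis
      by (rule derivative_eq_intros refl der False)+ (auto simp: fun_eq_iff algebra_simps)
  qed
qed

lemma abs_div_sqrt_le_1: "\<bar>a / sqrt (a\<^sup>2 + b\<^sup>2)\<bar> \<le> 1"
proof (cases "sqrt (a\<^sup>2 + b\<^sup>2) = 0")
  case False
  then have "0 < sqrt (a\<^sup>2 + b\<^sup>2)" by (smt (verit) real_sqrt_ge_zero sum_power2_ge_zero)
  then show ?thesis using real_sqrt_ge_abs1[of a b] by (simp only: abs_divide abs_of_pos divide_le_eq_1_pos)
qed simp

lemma abs_fst_le_norm: "\<bar>fst w\<bar> \<le> norm (w :: real \<times> real)" "\<bar>snd w\<bar> \<le> norm w"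
  using norm_fst_le[of "fst w" "snd w"] norm_snd_le[of "snd w" "fst w"] by auto

lemma radius_has_derivative:
  assumes "(w :: real \<times> real) \<noteq> 0"
  shows "((\<lambda>w. sqrt ((fst w)\<^sup>2 + (snd w)\<^sup>2)) has_derivative
     (\<lambda>d. fst w / sqrt ((fst w)\<^sup>2 + (snd w)\<^sup>2) * fst d + snd w / sqrt ((fst w)\<^sup>2 + (snd w)\<^sup>2) * snd d)) (at w)"
proof -
  have n: "norm = (\<lambda>w::real \<times> real. sqrt ((fst w)\<^sup>2 + (snd w)\<^sup>2))"
    by (simp add: fun_eq_iff norm_Pair)
  have "(\<lambda>d. d \<bullet> sgn w) = (\<lambda>d. fst w / norm w * fst d + snd w / norm w * snd d)"
    by (simp add: fun_eq_iff sgn_div_norm inner_prod_def divide_inverse algebra_simps)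
  with has_derivative_norm[OF assms] show ?thesis by (simp only: n)
qed

lemma pi_FB_has_derivative:
  assumes "w \<noteq> 0"
  shows "((\<lambda>(a, b). pi_FB a b) has_derivative
     (\<lambda>d. (fst w / sqrt ((fst w)\<^sup>2 + (snd w)\<^sup>2) - 1) * fst d + (snd w / sqrt ((fst w)\<^sup>2 + (snd w)\<^sup>2) - 1) * snd d)) (at w)"
  using has_derivative_diff[OF has_derivative_diff[OF radius_has_derivative[OF assms]
      bounded_linear_imp_has_derivative[OF bounded_linear_fst]] bounded_linear_imp_has_derivative[OF bounded_linear_snd]]
  by (simp add: pi_FB_def case_prod_beta' left_diff_distrib algebra_simps)

text \<open>
  The only kink of \<open>\<pi>\<^sub>F\<^sub>B\<close> is the origin, where it vanishes.
\<close>

lemma cont_diff_pi_FB_square: "cont_diff (\<lambda>(a, b). (pi_FB a b)\<^sup>2)"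
proof -
  let ?r = "\<lambda>w::real \<times> real. sqrt ((fst w)\<^sup>2 + (snd w)\<^sup>2)"
  have nz: "w \<noteq> 0" "0 < ?r w" if "(\<lambda>(a, b). pi_FB a b) w \<noteq> 0" for w
    using that by (cases w; auto simp: pi_FB_def zero_prod_def sum_power2_gt_zero_iff)+
  have "cont_diff (\<lambda>w. ((\<lambda>(a, b). pi_FB a b) w)\<^sup>2)"
  proof (rule cont_diff_square[where Da = "\<lambda>w. fst w / ?r w - 1" and Db = "\<lambda>w. snd w / ?r w - 1" and K = 4])
    fix w :: "real \<times> real"
    show "\<bar>fst w / ?r w - 1\<bar> \<le> 4" using abs_div_sqrt_le_1[of "fst w" "snd w"] by linarith
    show "\<bar>snd w / ?r w - 1\<bar> \<le> 4"
      using abs_div_sqrt_le_1[of "snd w" "fst w"] unfolding add.commute[of "(snd w)\<^sup>2"] by linarith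
    assume *: "(\<lambda>(a, b). pi_FB a b) w \<noteq> 0"
    show "isCont (\<lambda>w. fst w / ?r w - 1) w" "isCont (\<lambda>w. snd w / ?r w - 1) w"
      using nz(2)[OF *] by (auto intro!: continuous_intros simp: sum_power2_gt_zero_iff)
    show "((\<lambda>(a, b). pi_FB a b) has_derivative
      (\<lambda>d. (fst w / ?r w - 1) * fst d + (snd w / ?r w - 1) * snd d)) (at w)"
      by (rule pi_FB_has_derivative[OF nz(1)[OF *]])
  next
    fix w w\<^sub>0 :: "real \<times> real"
    assume "(\<lambda>(a, b). pi_FB a b) w\<^sub>0 = 0"
    then have "min (fst w\<^sub>0) (snd w\<^sub>0) = 0"
      using min_le_pi_FB[of "fst w\<^sub>0" "snd w\<^sub>0"] by (simp add: case_prod_beta)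
    then have "\<bar>min (fst w) (snd w)\<bar> \<le> norm (w - w\<^sub>0)"
      using abs_fst_le_norm[of "w - w\<^sub>0"] unfolding fst_diff snd_diff by linarith
    then show "\<bar>(\<lambda>(a, b). pi_FB a b) w\<bar> \<le> 4 * norm (w - w\<^sub>0)"
      using pi_FB_le_min[of "fst w" "snd w"] by (simp add: case_prod_beta)
  qed
  then show ?thesis by (simp add: case_prod_beta')
qed

lemma abs_has_derivative:
  fixes f :: "'a::real_normed_vector \<Rightarrow> real"
  assumes "f w \<noteq> 0" "(f has_derivative f') (at w)"
  shows "((\<lambda>x. \<bar>f x\<bar>) has_derivative (\<lambda>h. f' h * sgn (f w))) (at w)"
  using has_derivative_compose[OF assms(2) has_derivative_norm[OF assms(1)]] by simp

lemma pi_FB_abs_has_derivative: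
  assumes "fst w \<noteq> 0" "snd w \<noteq> 0"
  shows "((\<lambda>(a, b). pi_FB \<bar>a\<bar> \<bar>b\<bar>) has_derivative
     (\<lambda>d. (fst w / sqrt ((fst w)\<^sup>2 + (snd w)\<^sup>2) - sgn (fst w)) * fst d
        + (snd w / sqrt ((fst w)\<^sup>2 + (snd w)\<^sup>2) - sgn (snd w)) * snd d)) (at w)"
proof -
  have "w \<noteq> 0" using assms by auto
  from has_derivative_diff[OF has_derivative_diff[OF radius_has_derivative[OF this]
      abs_has_derivative[OF assms(1) bounded_linear_imp_has_derivative[OF bounded_linear_fst]]]
      abs_has_derivative[OF assms(2) bounded_linear_imp_has_derivative[OF bounded_linear_snd]]]
  show ?thesis by (simp add: pi_FB_def case_prod_beta' left_diff_distrib algebra_simps)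
qed

lemma isCont_sgn_compose:
  "isCont f w \<Longrightarrow> f w \<noteq> 0 \<Longrightarrow> isCont (\<lambda>w. sgn (f w) :: real) w" for f :: "'a::t2_space \<Rightarrow> real"
  unfolding isCont_def by (rule tendsto_sgn)

lemma pi_FB_abs_eq_0: "pi_FB \<bar>a\<bar> \<bar>b\<bar> = 0 \<longleftrightarrow> a = 0 \<or> b = 0"
proof -
  have "pi_FB \<bar>a\<bar> \<bar>b\<bar> = 0 \<longleftrightarrow> min \<bar>a\<bar> \<bar>b\<bar> = 0"
    using min_le_pi_FB[of "\<bar>a\<bar>" "\<bar>b\<bar>"] pi_FB_le_min[of "\<bar>a\<bar>" "\<bar>b\<bar>"]
    by (metis abs_eq_0 abs_le_zero_iff mult_zero_right)
  then show ?thesis unfolding min_def by (auto split: if_splits)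
qed

lemma pi_FB_abs_le: "\<bar>pi_FB \<bar>a\<bar> \<bar>b\<bar>\<bar> \<le> 4 * \<bar>a\<bar>" "\<bar>pi_FB \<bar>a\<bar> \<bar>b\<bar>\<bar> \<le> 4 * \<bar>b\<bar>"
proof -
  have "\<bar>min \<bar>a\<bar> \<bar>b\<bar>\<bar> = min \<bar>a\<bar> \<bar>b\<bar>" by (rule abs_of_nonneg) simp
  then show "\<bar>pi_FB \<bar>a\<bar> \<bar>b\<bar>\<bar> \<le> 4 * \<bar>a\<bar>" "\<bar>pi_FB \<bar>a\<bar> \<bar>b\<bar>\<bar> \<le> 4 * \<bar>b\<bar>"
    by (auto intro!: order_trans[OF pi_FB_le_min])
qed

text \<open>
  The absolute values add kinks on the two axes, where \<open>\<pi>\<^sub>F\<^sub>B(\<bar>a\<bar>, \<bar>b\<bar>)\<close> vanishes as well.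
\<close>

lemma cont_diff_pi_FB_abs_square: "cont_diff (\<lambda>(a, b). (pi_FB \<bar>a\<bar> \<bar>b\<bar>)\<^sup>2)"
proof -
  let ?u = "\<lambda>(a, b). pi_FB \<bar>a\<bar> \<bar>b\<bar>"
  let ?r = "\<lambda>w::real \<times> real. sqrt ((fst w)\<^sup>2 + (snd w)\<^sup>2)"
  have nz: "fst w \<noteq> 0" "snd w \<noteq> 0" "0 < ?r w" if "?u w \<noteq> 0" for w
    using that pi_FB_abs_eq_0[of "fst w" "snd w"] by (auto simp: case_prod_beta sum_power2_gt_zero_iff)
  have "cont_diff (\<lambda>w. (?u w)\<^sup>2)"
  proof (rule cont_diff_square[where Da = "\<lambda>w. fst w / ?r w - sgn (fst w)"
        and Db = "\<lambda>w. snd w / ?r w - sgn (snd w)" and K = 4])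
    fix w :: "real \<times> real"
    show "\<bar>fst w / ?r w - sgn (fst w)\<bar> \<le> 4"
      using abs_div_sqrt_le_1[of "fst w" "snd w"] abs_sgn_eq[of "fst w"] by (smt (verit))
    show "\<bar>snd w / ?r w - sgn (snd w)\<bar> \<le> 4"
      using abs_div_sqrt_le_1[of "snd w" "fst w"] abs_sgn_eq[of "snd w"]
      unfolding add.commute[of "(snd w)\<^sup>2"] by (smt (verit))
    assume *: "?u w \<noteq> 0"
    show "isCont (\<lambda>w. fst w / ?r w - sgn (fst w)) w" "isCont (\<lambda>w. snd w / ?r w - sgn (snd w)) w"
      using nz[OF *] by (auto intro!: continuous_intros isCont_sgn_compose simp: sum_power2_gt_zero_iff)
    show "(?u has_derivative (\<lambda>d. (fst w / ?r w - sgn (fst w)) * fst d + (snd w / ?r w - sgn (snd w)) * snd d)) (at w)"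
      by (rule pi_FB_abs_has_derivative[OF nz(1,2)[OF *]])
  next
    fix w w\<^sub>0 :: "real \<times> real"
    assume "?u w\<^sub>0 = 0"
    then have "fst w\<^sub>0 = 0 \<or> snd w\<^sub>0 = 0"
      using pi_FB_abs_eq_0[of "fst w\<^sub>0" "snd w\<^sub>0"] by (simp add: case_prod_beta)
    then show "\<bar>?u w\<bar> \<le> 4 * norm (w - w\<^sub>0)"
      using abs_fst_le_norm[of "w - w\<^sub>0"] pi_FB_abs_le[of "fst w" "snd w"]
      unfolding fst_diff snd_diff case_prod_beta by linarith
  qed
  then show ?thesis by (simp add: case_prod_beta')
qed

text \<open>
  The nonpositive quadrant is bounded by half axes on which \<open>\<pi>\<^sub>F\<^sub>B(\<bar>\<mu>\<bar>, \<bar>\<nu>\<bar>)\<close> vanishes, so the two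
  definitions by cases fit together continuously, and away from the zeros only the smooth one is met.
\<close>

lemma cont_diff_theta4_square: "cont_diff (\<lambda>w. (theta4 w)\<^sup>2)"
proof -
  let ?r = "\<lambda>w::real \<times> real. sqrt ((fst w)\<^sup>2 + (snd w)\<^sup>2)"
  let ?U = "{w::real \<times> real. 0 < fst w} \<union> {w. 0 < snd w}"
  let ?Da = "\<lambda>w. fst w / ?r w - sgn (fst w)" and ?Db = "\<lambda>w. snd w / ?r w - sgn (snd w)"
  have U: "open ?U"
    by (intro open_Un open_Collect_less continuous_intros)
  have eq: "theta4 w = (if w \<in> ?U then pi_FB \<bar>fst w\<bar> \<bar>snd w\<bar> else 0)" for w
    by (auto simp: theta4_def case_prod_beta)
  have nz: "w \<in> ?U" "fst w \<noteq> 0" "snd w \<noteq> 0" "0 < ?r w" if "theta4 w \<noteq> 0" for w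
    using that pi_FB_abs_eq_0[of "fst w" "snd w"] unfolding eq
    by (auto simp: sum_power2_gt_zero_iff split: if_splits)
  show ?thesis
  proof (rule cont_diff_square[where Da = ?Da and Db = ?Db and K = 4])
    fix w :: "real \<times> real"
    show "\<bar>fst w / ?r w - sgn (fst w)\<bar> \<le> 4"
      using abs_div_sqrt_le_1[of "fst w" "snd w"] abs_sgn_eq[of "fst w"] by (smt (verit))
    show "\<bar>snd w / ?r w - sgn (snd w)\<bar> \<le> 4"
      using abs_div_sqrt_le_1[of "snd w" "fst w"] abs_sgn_eq[of "snd w"]
      unfolding add.commute[of "(snd w)\<^sup>2"] by (smt (verit))
    assume *: "theta4 w \<noteq> 0"
    show "isCont ?Da w" "isCont ?Db w"
      using nz[OF *] by (auto intro!: continuous_intros isCont_sgn_compose simp: sum_power2_gt_zero_iff)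
    show "(theta4 has_derivative (\<lambda>d. ?Da w * fst d + ?Db w * snd d)) (at w)"
      by (rule has_derivative_transform_within_open[OF pi_FB_abs_has_derivative[OF nz(2,3)[OF *]] U nz(1)[OF *]])
        (auto simp: eq case_prod_beta)
  next
    fix w w\<^sub>0 :: "real \<times> real"
    assume "theta4 w\<^sub>0 = 0"
    then have z: "fst w\<^sub>0 \<le> 0 \<and> snd w\<^sub>0 \<le> 0 \<or> fst w\<^sub>0 = 0 \<or> snd w\<^sub>0 = 0"
      using pi_FB_abs_eq_0[of "fst w\<^sub>0" "snd w\<^sub>0"] unfolding eq by (auto split: if_splits)
    show "\<bar>theta4 w\<bar> \<le> 4 * norm (w - w\<^sub>0)"
    proof (cases "w \<in> ?U")
      case True
      then have "0 < fst w \<or> 0 < snd w" by auto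
      then have "\<bar>pi_FB \<bar>fst w\<bar> \<bar>snd w\<bar>\<bar> \<le> 4 * norm (w - w\<^sub>0)"
        using z abs_fst_le_norm[of "w - w\<^sub>0"] pi_FB_abs_le[of "fst w" "snd w"]
        unfolding fst_diff snd_diff by linarith
      then show ?thesis using True by (simp add: eq)
    qed (simp add: eq)
  qed
qed

section \<open>Accumulation points of line search methods\<close>

text \<open>
  The decrease of \<open>f\<close> forces the lengths of the steps to zero along the subsequence. If step
  sizes below \<open>1\<close> were used again and again, the rejected previous trial points would also approach
  \<open>zb\<close>, and there the gradient would have to change by a fixed amount, against its continuity. So the
  full directions are taken eventually, and it is they that tend to \<open>0\<close>.
\<close>

lemma line_search_accumulation:
  fixes f :: "'a::euclidean_space \<Rightarrow> real"
  assumes f: "cont_diff f" and lower: "\<And>x. 0 \<le> f x"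
    and par: "0 < \<sigma>" "\<sigma> < 1" "0 < \<rho>" "0 < \<beta>" "\<beta> < 1"
    and step: "\<And>k. k \<ge> k\<^sub>0 \<Longrightarrow> line_search_step f \<sigma> \<beta> (z k) (d k) (z (Suc k))"
    and angle: "\<And>k. k \<ge> k\<^sub>0 \<Longrightarrow> grad f (z k) \<bullet> d k \<le> - \<rho> * norm (d k) * norm (grad f (z k))"
    and r: "strict_mono r" and lim: "(z \<circ> r) \<longlonglongrightarrow> zb" and nz: "grad f zb \<noteq> 0"
  shows "(\<lambda>k. d (r k)) \<longlonglongrightarrow> 0"
proof -
  have "\<exists>i. \<forall>k\<ge>k\<^sub>0. armijo f \<sigma> (z k) (d k) (\<beta> ^ i k) \<and> (\<forall>j<i k. \<not> armijo f \<sigma> (z k) (d k) (\<beta> ^ j)) \<and>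
      z (Suc k) = z k + \<beta> ^ i k *\<^sub>R d k"
    using step unfolding line_search_step_def by metis
  then obtain i where arm: "\<And>k. k \<ge> k\<^sub>0 \<Longrightarrow> armijo f \<sigma> (z k) (d k) (\<beta> ^ i k)"
    and fail: "\<And>k j. k \<ge> k\<^sub>0 \<Longrightarrow> j < i k \<Longrightarrow> \<not> armijo f \<sigma> (z k) (d k) (\<beta> ^ j)"
    and zs: "\<And>k. k \<ge> k\<^sub>0 \<Longrightarrow> z (Suc k) = z k + \<beta> ^ i k *\<^sub>R d k" by blast
  define g where "g k = norm (grad f (z k))" for k
  have dec: "f (z (Suc k)) \<le> f (z k) - \<sigma> * \<rho> * (\<beta> ^ i k * norm (d k)) * g k" if "k \<ge> k\<^sub>0" for k
  proof -
    have "f (z (Suc k)) \<le> f (z k) + \<sigma> * \<beta> ^ i k * (grad f (z k) \<bullet> d k)"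
      using arm[OF that] zs[OF that] by (simp add: armijo_def)
    also have "\<sigma> * \<beta> ^ i k * (grad f (z k) \<bullet> d k) \<le> \<sigma> * \<beta> ^ i k * (- \<rho> * norm (d k) * g k)"
      using angle[OF that] par by (intro mult_left_mono) (auto simp: g_def)
    finally show ?thesis by (simp add: algebra_simps)
  qed
  have mono: "f (z (Suc k)) \<le> f (z k)" if "k \<ge> k\<^sub>0" for k
    using dec[OF that] par by (smt (verit) g_def mult_nonneg_nonneg norm_ge_zero zero_le_power)
  have "decseq (\<lambda>k. f (z (k + k\<^sub>0)))" using mono by (intro decseq_SucI) simp
  then obtain l where "(\<lambda>k. f (z (k + k\<^sub>0))) \<longlonglongrightarrow> l"
    using decseq_convergent[of "\<lambda>k. f (z (k + k\<^sub>0))" 0] lower by blast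
  then have fz: "(\<lambda>k. f (z k)) \<longlonglongrightarrow> l" by (rule LIMSEQ_offset)
  have "(\<lambda>k. f (z k) - f (z (Suc k))) \<longlonglongrightarrow> l - l"
    by (intro tendsto_diff fz LIMSEQ_Suc[OF fz])
  then have diff0: "(\<lambda>k. f (z (r k)) - f (z (Suc (r k)))) \<longlonglongrightarrow> 0"
    using LIMSEQ_subseq_LIMSEQ[OF _ r] by (fastforce simp: o_def)
  have rk: "\<forall>\<^sub>F k in sequentially. r k \<ge> k\<^sub>0"
    using filterlim_subseq[OF r] by (simp add: filterlim_at_top)
  have gcont: "isCont (grad f) x" for x
    using continuous_on_grad[OF f] by (simp add: continuous_on_eq_continuous_at)
  have zr: "(\<lambda>k. z (r k)) \<longlonglongrightarrow> zb" using lim by (simp add: o_def)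
  have gr: "(\<lambda>k. grad f (z (r k))) \<longlonglongrightarrow> grad f zb" by (rule isCont_tendsto_compose[OF gcont zr])
  have glim: "(\<lambda>k. g (r k)) \<longlonglongrightarrow> norm (grad f zb)" unfolding g_def by (intro tendsto_norm gr)
  have gpos: "\<forall>\<^sub>F k in sequentially. norm (grad f zb) / 2 < g (r k)"
    using order_tendstoD(1)[OF glim, of "norm (grad f zb) / 2"] nz by simp
  have step0: "(\<lambda>k. \<beta> ^ i (r k) * norm (d (r k))) \<longlonglongrightarrow> 0"
  proof (rule Lim_null_comparison)
    let ?c = "\<sigma> * \<rho> * (norm (grad f zb) / 2)"
    have c: "0 < ?c" using par nz by simp
    show "\<forall>\<^sub>F k in sequentially. norm (\<beta> ^ i (r k) * norm (d (r k))) \<le> (f (z (r k)) - f (z (Suc (r k)))) / ?c"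
      using rk gpos
    proof eventually_elim
      case (elim k)
      have "(\<beta> ^ i (r k) * norm (d (r k))) * ?c \<le> (\<beta> ^ i (r k) * norm (d (r k))) * (\<sigma> * \<rho> * g (r k))"
        using elim par by (intro mult_left_mono) auto
      also have "\<dots> \<le> f (z (r k)) - f (z (Suc (r k)))"
        using dec[OF elim(1)] by (simp add: algebra_simps)
      finally show ?case using c par by (simp add: pos_le_divide_eq)
    qed
    show "(\<lambda>k. (f (z (r k)) - f (z (Suc (r k)))) / ?c) \<longlonglongrightarrow> 0"
      by (rule tendsto_divide_zero[OF diff0])
  qed
  have "\<forall>\<^sub>F k in sequentially. i (r k) = 0"
  proof (rule ccontr)
    assume neg: "\<not> (\<forall>\<^sub>F k in sequentially. i (r k) = 0)"
    \<comment> \<open>The rejected trial step \<open>\<beta>\<^sup>i\<^sup>-\<^sup>1 d\<close> yields, by the mean value theorem, a point at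
        which the gradient differs from that of the iterate by a fixed fraction.\<close>
    define \<kappa> where "\<kappa> = (1 - \<sigma>) * \<rho> * (norm (grad f zb) / 2)"
    have \<kappa>: "\<kappa> > 0" using par nz by (simp add: \<kappa>_def)
    obtain \<delta> where \<delta>: "\<delta> > 0" "\<And>y. dist y zb < \<delta> \<Longrightarrow> dist (grad f y) (grad f zb) < \<kappa> / 2"
      using gcont[of zb] \<kappa> unfolding continuous_at_eps_delta by (metis half_gt_zero)
    have e1: "\<forall>\<^sub>F k in sequentially. dist (z (r k)) zb < \<delta> / 2"
      using tendstoD[OF zr, of "\<delta> / 2"] \<delta>(1) by simp
    have e2: "\<forall>\<^sub>F k in sequentially. \<beta> ^ i (r k) * norm (d (r k)) < \<beta> * \<delta> / 2"
      using order_tendstoD(2)[OF step0, of "\<beta> * \<delta> / 2"] \<delta>(1) par by simp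
    have "\<exists>\<^sub>F k in sequentially. i (r k) \<noteq> 0"
      using neg by (simp add: frequently_def)
    then have "\<exists>\<^sub>F k in sequentially. i (r k) \<noteq> 0 \<and> r k \<ge> k\<^sub>0 \<and> norm (grad f zb) / 2 < g (r k) \<and>
        dist (z (r k)) zb < \<delta> / 2 \<and> \<beta> ^ i (r k) * norm (d (r k)) < \<beta> * \<delta> / 2"
      by (rule frequently_eventually_frequently[OF _ eventually_conj[OF rk eventually_conj[OF gpos eventually_conj[OF e1 e2]]]])
    then obtain k where k: "i (r k) \<noteq> 0" "r k \<ge> k\<^sub>0" "norm (grad f zb) / 2 < g (r k)"
        "dist (z (r k)) zb < \<delta> / 2" "\<beta> ^ i (r k) * norm (d (r k)) < \<beta> * \<delta> / 2"
      using frequently_ex by blast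
    define x v t where "x = z (r k)" and "v = d (r k)" and "t = \<beta> ^ (i (r k) - 1)"
    have t: "0 < t" "t * norm v < \<delta> / 2"
    proof -
      have "\<beta> ^ i (r k) = \<beta> * t" using k(1) by (simp add: t_def power_eq_if)
      then show "t * norm v < \<delta> / 2" using k(5) par by (simp add: v_def)
    qed (simp add: t_def par)
    have "\<not> armijo f \<sigma> x v t" using fail[OF k(2), of "i (r k) - 1"] k(1) by (simp add: x_def v_def t_def)
    then have big: "f x + \<sigma> * t * (grad f x \<bullet> v) < f (x + t *\<^sub>R v)" by (simp add: armijo_def)
    have "((\<lambda>s. f (x + s *\<^sub>R v)) has_real_derivative (v \<bullet> grad f (x + s *\<^sub>R v))) (at s)" for s
    proof -
      have "(f has_derivative (\<lambda>h. h \<bullet> grad f (x + s *\<^sub>R v))) (at (x + s *\<^sub>R v))"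
        using GDERIV_grad[OF f] by (simp add: gderiv_def)
      then have "((\<lambda>s. f (x + s *\<^sub>R v)) has_derivative (\<lambda>h. (h *\<^sub>R v) \<bullet> grad f (x + s *\<^sub>R v))) (at s)"
        by (rule has_derivative_compose[rotated]) (auto intro!: derivative_eq_intros)
      then show ?thesis by (simp add: has_field_derivative_def mult.commute[of _ "v \<bullet> _"] cong: if_cong)

    qed
    then obtain s where s: "0 < s" "s < t" "f (x + t *\<^sub>R v) - f (x + 0 *\<^sub>R v) = (t - 0) * (v \<bullet> grad f (x + s *\<^sub>R v))"
      using MVT2[OF t(1), of "\<lambda>s. f (x + s *\<^sub>R v)" "\<lambda>s. v \<bullet> grad f (x + s *\<^sub>R v)"] by blast
    define y where "y = x + s *\<^sub>R v"
    have "t * (\<sigma> * (v \<bullet> grad f x)) < t * (v \<bullet> grad f y)"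
      using big s(3) by (simp add: y_def inner_commute algebra_simps)
    then have "\<sigma> * (v \<bullet> grad f x) < v \<bullet> grad f y" using t(1) by simp
    then have "- (1 - \<sigma>) * (grad f x \<bullet> v) < v \<bullet> (grad f y - grad f x)"
      by (simp add: algebra_simps inner_commute)
    moreover have "(1 - \<sigma>) * (grad f x \<bullet> v) \<le> (1 - \<sigma>) * (- \<rho> * norm v * g (r k))"
      using angle[OF k(2)] par by (intro mult_left_mono) (auto simp: x_def v_def g_def)
    moreover have "v \<bullet> (grad f y - grad f x) \<le> norm v * norm (grad f y - grad f x)"
      by (rule norm_cauchy_schwarz)
    ultimately have "norm v * ((1 - \<sigma>) * \<rho> * g (r k)) < norm v * norm (grad f y - grad f x)"
      by (simp add: algebra_simps)
    then have "(1 - \<sigma>) * \<rho> * g (r k) < norm (grad f y - grad f x)"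
      by (simp add: mult_less_cancel_left_disj)
    moreover have "\<kappa> \<le> (1 - \<sigma>) * \<rho> * g (r k)" unfolding \<kappa>_def using k(3) par
      by (intro mult_left_mono) auto
    moreover have "norm (grad f y - grad f x) < \<kappa>"
    proof -
      have "dist y x = s * norm v" using s by (simp add: y_def dist_norm)
      also have "\<dots> \<le> t * norm v" using s by (intro mult_right_mono) auto
      finally have "dist y x < \<delta> / 2" using t(2) by simp
      then have "dist y zb < \<delta>" "dist x zb < \<delta>"
        using k(4) dist_triangle[of y zb x] \<delta>(1) by (auto simp: x_def)
      then have "dist (grad f y) (grad f zb) < \<kappa> / 2" "dist (grad f x) (grad f zb) < \<kappa> / 2" using \<delta>(2) by auto
      then show ?thesis using dist_triangle2[of "grad f y" "grad f x" "grad f zb"] by (simp add: dist_norm)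
    qed
    ultimately show False by linarith
  qed
  then have "\<forall>\<^sub>F k in sequentially. \<beta> ^ i (r k) * norm (d (r k)) = norm (d (r k))"
    by eventually_elim simp
  then have "(\<lambda>k. norm (d (r k))) \<longlonglongrightarrow> 0"
    using step0 by (rule Lim_transform_eventually[rotated])
  then show ?thesis by (rule tendsto_norm_zero_cancel)
qed

section \<open>First and second derivatives of the problem data\<close>

text \<open>
  The value of the adjoint of \<open>T\<close> at \<open>v\<close>, as a bounded bilinear map in \<open>(T, v)\<close>. It describes the terms
  \<open>g'(x)\<^sup>T \<lambda>\<close> of the gradient of the Lagrangian.
\<close>

definition adj :: "('a::euclidean_space \<Rightarrow>\<^sub>L 'b::real_inner) \<Rightarrow> 'b \<Rightarrow> 'a" where
  "adj T v = (\<Sum>e\<in>Basis. (T e \<bullet> v) *\<^sub>R e)"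

lemma adj_inner: "d \<bullet> adj T v = T d \<bullet> v"
proof -
  have "T d = T (\<Sum>e\<in>Basis. (d \<bullet> e) *\<^sub>R e)" by (simp add: euclidean_representation)
  then show ?thesis
    by (simp add: adj_def blinfun.sum_right blinfun.bilinear_simps inner_sum_left inner_sum_right mult.commute)
qed

lemma norm_adj_le: "norm (adj T v) \<le> norm T * norm v"
proof (cases "adj T v = 0")
  case False
  have "norm (adj T v) * norm (adj T v) = T (adj T v) \<bullet> v"
    by (simp add: adj_inner[symmetric] power2_norm_eq_inner[symmetric] power2_eq_square)
  also have "\<dots> \<le> norm (T (adj T v)) * norm v" by (rule norm_cauchy_schwarz)
  also have "\<dots> \<le> norm T * norm (adj T v) * norm v" by (intro mult_right_mono norm_blinfun) auto
  finally have "norm (adj T v) * norm (adj T v) \<le> norm (adj T v) * (norm T * norm v)" by (simp add: ac_simps)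
  then show ?thesis using False by simp
qed simp

lemma bounded_bilinear_adj: "bounded_bilinear adj"
proof
  show "\<exists>K. \<forall>T v. norm (adj T v) \<le> norm T * norm v * K"
    using norm_adj_le by (intro exI[of _ 1]) auto
qed (simp_all add: adj_def blinfun.bilinear_simps inner_add_left inner_add_right scaleR_left_distrib
    sum.distrib scaleR_sum_right)

lemma vector_matrix_blinfun:
  fixes T :: "(real^'n) \<Rightarrow>\<^sub>L (real^'k)"
  shows "v v* matrix (blinfun_apply T) = adj T v"
proof -
  have "(v v* matrix (blinfun_apply T)) \<bullet> d = adj T v \<bullet> d" for d
    by (simp add: dot_lmul_matrix matrix_works blinfun.bounded_linear_right bounded_linear.linear
        inner_commute[of "adj T v"] adj_inner inner_commute[of v])
  then show ?thesis by (metis vector_eq_rdot)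
qed

lemma jacobian_has_derivative:
  fixes f :: "real^'n \<Rightarrow> real^'k"
  assumes "(f has_derivative f') (at x)"
  shows "jacobian f (at x) = matrix f'"
  using frechet_derivative_at[OF assms] by (simp add: jacobian_def)

lemma jacobian_blinfun:
  fixes f :: "real^'n \<Rightarrow> real^'k"
  assumes "(f has_derivative blinfun_apply T) (at x)"
  shows "jacobian f (at x) *v d = T d" "jacobian f (at x) $ i \<bullet> d = T d $ i"
    "v v* jacobian f (at x) = adj T v"
proof -
  show 1: "jacobian f (at x) *v d = T d"
    by (simp add: jacobian_has_derivative[OF assms] matrix_works blinfun.bounded_linear_right bounded_linear.linear)
  show "jacobian f (at x) $ i \<bullet> d = T d $ i"
    by (simp add: 1[symmetric] matrix_vector_mul_component)
  show "v v* jacobian f (at x) = adj T v"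
    by (simp only: jacobian_has_derivative[OF assms] vector_matrix_blinfun)
qed

lemma grad_eqI: "GDERIV f x :> D \<Longrightarrow> grad f x = D"
  unfolding grad_def gderiv_def
  by (rule the_equality, assumption) (metis has_derivative_unique vector_eq_ldot)

abbreviation "pr_x z \<equiv> fst z"
abbreviation "pr_lam z \<equiv> fst (snd z)"
abbreviation "pr_eta z \<equiv> fst (snd (snd z))"
abbreviation "pr_mu z \<equiv> fst (snd (snd (snd z)))"
abbreviation "pr_nu z \<equiv> snd (snd (snd (snd z)))"

lemma bounded_linear_pr:
  "bounded_linear (\<lambda>z. pr_x z)" "bounded_linear (\<lambda>z. pr_lam z)" "bounded_linear (\<lambda>z. pr_eta z)"
  "bounded_linear (\<lambda>z. pr_mu z)" "bounded_linear (\<lambda>z. pr_nu z)"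
  by (intro bounded_linear_intros bounded_linear_fst_comp bounded_linear_snd_comp)+

text \<open>
  Names the first and second derivative that twice continuously differentiable functions
  only assert to exist.
\<close>

definition twice_diff ::
  "('a::real_normed_vector \<Rightarrow> 'b::real_normed_vector) \<Rightarrow> ('a \<Rightarrow> 'a \<Rightarrow>\<^sub>L 'b) \<Rightarrow> ('a \<Rightarrow> 'a \<Rightarrow>\<^sub>L 'a \<Rightarrow>\<^sub>L 'b) \<Rightarrow> bool"
  where "twice_diff f f' f'' \<longleftrightarrow> (\<forall>x. (f has_derivative blinfun_apply (f' x)) (at x)) \<and>
      (\<forall>x. (f' has_derivative blinfun_apply (f'' x)) (at x)) \<and> continuous_on UNIV f''"

lemma twice_diff_cont_diff:
  assumes "twice_diff f f' f''" shows "cont_diff f" "cont_diff f'"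
proof -
  note * = assms[unfolded twice_diff_def]
  show f': "cont_diff f'" using * by (intro cont_diffI[of f' f'']) auto
  show "cont_diff f" using * cont_diff_imp_continuous[OF f'] by (intro cont_diffI[of f f']) auto
qed

text \<open>
  All later estimates refer to one fixed choice of the derivatives of the five data functions.
\<close>

locale smooth_mpcc =
  fixes P :: "('n::finite, 'l::finite, 'm::finite, 'p::finite) mpcc"
    and f' f'' g' g'' h' h'' G' G'' H' H''
  assumes f: "twice_diff (obj P) f' f''" and g: "twice_diff (ineq P) g' g''"
    and h: "twice_diff (eqn P) h' h''" and G: "twice_diff (cG P) G' G''" and H: "twice_diff (cH P) H' H''"
begin

lemmas derivs = f[unfolded twice_diff_def, THEN conjunct1, rule_format]
  g[unfolded twice_diff_def, THEN conjunct1, rule_format]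
  h[unfolded twice_diff_def, THEN conjunct1, rule_format]
  G[unfolded twice_diff_def, THEN conjunct1, rule_format]
  H[unfolded twice_diff_def, THEN conjunct1, rule_format]

lemmas derivs' = f[unfolded twice_diff_def, THEN conjunct2, THEN conjunct1, rule_format]
  g[unfolded twice_diff_def, THEN conjunct2, THEN conjunct1, rule_format]
  h[unfolded twice_diff_def, THEN conjunct2, THEN conjunct1, rule_format]
  G[unfolded twice_diff_def, THEN conjunct2, THEN conjunct1, rule_format]
  H[unfolded twice_diff_def, THEN conjunct2, THEN conjunct1, rule_format]

lemmas continuous_data = 
  f[THEN twice_diff_cont_diff(1), THEN cont_diff_imp_continuous]
  g[THEN twice_diff_cont_diff(1), THEN cont_diff_imp_continuous]
  h[THEN twice_diff_cont_diff(1), THEN cont_diff_imp_continuous]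
  G[THEN twice_diff_cont_diff(1), THEN cont_diff_imp_continuous]
  H[THEN twice_diff_cont_diff(1), THEN cont_diff_imp_continuous]
  f[THEN twice_diff_cont_diff(2), THEN cont_diff_imp_continuous]
  g[THEN twice_diff_cont_diff(2), THEN cont_diff_imp_continuous]
  h[THEN twice_diff_cont_diff(2), THEN cont_diff_imp_continuous]
  G[THEN twice_diff_cont_diff(2), THEN cont_diff_imp_continuous]
  H[THEN twice_diff_cont_diff(2), THEN cont_diff_imp_continuous]
  f[unfolded twice_diff_def, THEN conjunct2, THEN conjunct2]
  g[unfolded twice_diff_def, THEN conjunct2, THEN conjunct2]
  h[unfolded twice_diff_def, THEN conjunct2, THEN conjunct2]
  G[unfolded twice_diff_def, THEN conjunct2, THEN conjunct2]
  H[unfolded twice_diff_def, THEN conjunct2, THEN conjunct2]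

definition gradL :: "('n, 'l, 'm, 'p) primal_dual \<Rightarrow> real^'n" where
  "gradL z = adj (f' (pr_x z)) 1 + adj (g' (pr_x z)) (pr_lam z) + adj (h' (pr_x z)) (pr_eta z)
     + adj (G' (pr_x z)) (pr_mu z) + adj (H' (pr_x z)) (pr_nu z)"

definition hessL :: "('n, 'l, 'm, 'p) primal_dual \<Rightarrow> real^'n \<Rightarrow> real^'n" where
  "hessL z d = adj (f'' (pr_x z) d) 1 + adj (g'' (pr_x z) d) (pr_lam z) + adj (h'' (pr_x z) d) (pr_eta z)
     + adj (G'' (pr_x z) d) (pr_mu z) + adj (H'' (pr_x z) d) (pr_nu z)"

definition D_gradL :: "('n, 'l, 'm, 'p) primal_dual \<Rightarrow> ('n, 'l, 'm, 'p) primal_dual \<Rightarrow> real^'n" where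
  "D_gradL z d = hessL z (pr_x d) + adj (g' (pr_x z)) (pr_lam d) + adj (h' (pr_x z)) (pr_eta d)
     + adj (G' (pr_x z)) (pr_mu d) + adj (H' (pr_x z)) (pr_nu d)"

text \<open>
  The derivative of \<open>compl_arg\<close> with respect to \<open>z\<close>, applied to \<open>d\<close>.
\<close>

definition compl_dir :: "('n, 'l, 'm, 'p) primal_dual \<Rightarrow> ('n, 'l, 'm, 'p) primal_dual \<Rightarrow> 'p \<Rightarrow> real \<times> real \<times> real \<times> real" where
  "compl_dir z d i = (G' (pr_x z) (pr_x d) $ i, H' (pr_x z) (pr_x d) $ i, pr_mu d $ i, pr_nu d $ i)"

lemma grad_lagrangian: "grad (lagrangian P (snd z)) x = gradL (x, snd z)"
proof (rule grad_eqI)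
  obtain lam \<eta> \<mu> \<nu> where u: "snd z = (lam, \<eta>, \<mu>, \<nu>)" by (cases "snd z")
  show "GDERIV (lagrangian P (snd z)) x :> gradL (x, snd z)"
    unfolding gderiv_def u lagrangian.simps
    by (rule derivs derivative_eq_intros refl)+
      (simp add: fun_eq_iff gradL_def inner_add_right adj_inner inner_commute)
qed

lemma hessian_lagrangian: "hessian (lagrangian P (snd z)) (pr_x z) *v d = hessL z d"
proof -
  have "(\<lambda>x. gradL (x, snd z)) = grad (lagrangian P (snd z))" by (simp add: fun_eq_iff grad_lagrangian)
  moreover have "((\<lambda>x. gradL (x, snd z)) has_derivative hessL z) (at (pr_x z))"
    unfolding gradL_def fst_conv snd_conv
    by (rule bounded_bilinear.FDERIV[OF bounded_bilinear_adj] derivs' derivative_eq_intros refl)+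
      (simp add: fun_eq_iff hessL_def bounded_bilinear.zero_right[OF bounded_bilinear_adj])
  ultimately have *: "(grad (lagrangian P (snd z)) has_derivative hessL z) (at (pr_x z))" by simp
  then show ?thesis unfolding hessian_def jacobian_has_derivative[OF *]
    by (simp add: matrix_works has_derivative_linear)
qed

lemma F_eq:
  "F P z = (gradL z, \<chi> i. pi_min (- (ineq P (pr_x z) $ i)) (pr_lam z $ i), eqn P (pr_x z),
     \<chi> i. phi (compl_arg P z i))"
proof (cases z)
  case (fields x lam \<eta> \<mu> \<nu>)
  then show ?thesis using grad_lagrangian[of z x] by (simp add: fields)
qed

lemma F_FB_eq:
  "F_FB P z = (gradL z, \<chi> i. pi_FB (- (ineq P (pr_x z) $ i)) (pr_lam z $ i), eqn P (pr_x z),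
     \<chi> i. theta_FB (compl_arg P z i))"
proof (cases z)
  case (fields x lam \<eta> \<mu> \<nu>)
  then show ?thesis using grad_lagrangian[of z x] by (simp add: fields)
qed

text \<open>
  The Newton matrix in terms of operators: up to the selection made by \<open>\<pi>\<^sub>m\<^sub>i\<^sub>n\<close> and \<open>\<phi>\<close> it is the
  derivative of smooth maps.
\<close>

lemma DF_eq:
  "DF P z d = (D_gradL z d,
     \<chi> i. if - (ineq P (pr_x z) $ i) \<le> pr_lam z $ i then - (g' (pr_x z) (pr_x d) $ i) else pr_lam d $ i,
     h' (pr_x z) (pr_x d),
     \<chi> i. vector [Dphi1 (compl_arg P z i) \<bullet> coord (compl_dir z d i), Dphi2 (compl_arg P z i) \<bullet> coord (compl_dir z d i)])"
proof -
  obtain x lam \<eta> \<mu> \<nu> where z: "z = (x, lam, \<eta>, \<mu>, \<nu>)" by (cases z)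
  obtain dx dlam d\<eta> d\<mu> d\<nu> where d: "d = (dx, dlam, d\<eta>, d\<mu>, d\<nu>)" by (cases d)
  have "a *\<^sub>R column 1 (Dphi w) + b *\<^sub>R column 2 (Dphi w) + u *\<^sub>R column 3 (Dphi w) + v *\<^sub>R column 4 (Dphi w)
      = vector [Dphi1 w \<bullet> coord (a, b, u, v), Dphi2 w \<bullet> coord (a, b, u, v)]" for a b u v w
    by (auto simp: vec_eq_iff forall_2 column_def Dphi_def inner_vec_def sum_4 vector_2 algebra_simps)
  then show ?thesis
    using hessian_lagrangian[of z dx]
    by (simp add: z d D_gradL_def compl_dir_def jacobian_blinfun[OF derivs(2)] jacobian_blinfun[OF derivs(3)]
        jacobian_blinfun[OF derivs(4)] jacobian_blinfun[OF derivs(5)] Dpi_min_def Let_def vec_eq_iff)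
qed

end

section \<open>The merit function and the zeros of the system\<close>

lemma norm_vec_le:
  fixes x :: "'a::real_normed_vector^'n" and y :: "'b::real_normed_vector^'n"
  assumes "\<And>i. norm (x $ i) \<le> C * norm (y $ i)" "0 \<le> C"
  shows "norm x \<le> C * norm y"
proof -
  have "L2_set (\<lambda>i. norm (x $ i)) UNIV \<le> L2_set (\<lambda>i. C * norm (y $ i)) UNIV"
    by (rule L2_set_mono) (use assms in auto)
  then show ?thesis using assms(2) by (simp add: norm_vec_def L2_set_right_distrib)
qed

lemma norm_vec_le_sum: "norm (x :: 'a::real_normed_vector^'n) \<le> (\<Sum>i\<in>UNIV. norm (x $ i))"
  by (simp add: norm_vec_def L2_set_le_sum)

lemma norm_tuple_bounds:
  "norm a \<le> norm (a, b, c, d)" "norm b \<le> norm (a, b, c, d)" "norm c \<le> norm (a, b, c, d)" "norm d \<le> norm (a, b, c, d)"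
  "norm (a, b, c, d) \<le> norm a + norm b + norm c + norm d"
proof -
  show "norm a \<le> norm (a, b, c, d)" by (rule norm_fst_le)
  have "norm (b, c, d) \<le> norm (a, b, c, d)" "norm (c, d) \<le> norm (b, c, d)" by (rule norm_snd_le)+
  then show "norm b \<le> norm (a, b, c, d)" "norm c \<le> norm (a, b, c, d)" "norm d \<le> norm (a, b, c, d)"
    using norm_fst_le[of b "(c, d)"] norm_fst_le[of c d] norm_snd_le[of d c] by linarith+
  show "norm (a, b, c, d) \<le> norm a + norm b + norm c + norm d"
    using norm_Pair_le[of a "(b, c, d)"] norm_Pair_le[of b "(c, d)"] norm_Pair_le[of c d] by linarith
qed

context smooth_mpcc
begin

lemma cont_diff_gradL: "cont_diff gradL"
  unfolding gradL_def[abs_def]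
  by (intro cont_diff_add cont_diff_bilinear[OF bounded_bilinear_adj] cont_diff_const
    cont_diff_bounded_linear bounded_linear_pr
    cont_diff_compose[OF twice_diff_cont_diff(2)[OF f]] cont_diff_compose[OF twice_diff_cont_diff(2)[OF g]]
    cont_diff_compose[OF twice_diff_cont_diff(2)[OF h]] cont_diff_compose[OF twice_diff_cont_diff(2)[OF G]]
    cont_diff_compose[OF twice_diff_cont_diff(2)[OF H]])

lemma compl_arg_eq: "compl_arg P z i = (cG P (pr_x z) $ i, cH P (pr_x z) $ i, pr_mu z $ i, pr_nu z $ i)"
  by (simp add: compl_arg_def case_prod_beta)

lemma Phi_FB_eq:
  "Phi_FB P z = (1 / 2) * (gradL z \<bullet> gradL z + (\<Sum>i\<in>UNIV. (pi_FB (- (ineq P (pr_x z) $ i)) (pr_lam z $ i))\<^sup>2)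
     + eqn P (pr_x z) \<bullet> eqn P (pr_x z)
     + (\<Sum>i\<in>UNIV. (pi_FB (cG P (pr_x z) $ i) (cH P (pr_x z) $ i))\<^sup>2
         + (pi_FB \<bar>cG P (pr_x z) $ i\<bar> \<bar>pr_mu z $ i\<bar>)\<^sup>2 + (pi_FB \<bar>cH P (pr_x z) $ i\<bar> \<bar>pr_nu z $ i\<bar>)\<^sup>2
         + (theta4 (pr_mu z $ i, pr_nu z $ i))\<^sup>2))"
proof -
  have "theta_FB (compl_arg P z i) \<bullet> theta_FB (compl_arg P z i)
     = (pi_FB (cG P (pr_x z) $ i) (cH P (pr_x z) $ i))\<^sup>2
         + (pi_FB \<bar>cG P (pr_x z) $ i\<bar> \<bar>pr_mu z $ i\<bar>)\<^sup>2 + (pi_FB \<bar>cH P (pr_x z) $ i\<bar> \<bar>pr_nu z $ i\<bar>)\<^sup>2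
         + (theta4 (pr_mu z $ i, pr_nu z $ i))\<^sup>2" for i
    unfolding compl_arg_eq norm_theta_FB_sq[symmetric] by (simp add: power2_norm_eq_inner)
  moreover have vi: "(\<chi> i. a i) \<bullet> (\<chi> i. a i) = (\<Sum>i\<in>UNIV. a i * a i)" for a :: "'l \<Rightarrow> real"
    by (simp add: inner_vec_def)
  moreover have wi: "(\<chi> i. a i) \<bullet> (\<chi> i. a i) = (\<Sum>i\<in>UNIV. a i \<bullet> a i)" for a :: "'p \<Rightarrow> real^4"
    by (simp add: inner_vec_def)
  ultimately show ?thesis
    unfolding Phi_FB_def F_FB_eq power2_norm_eq_inner inner_Pair
    by (simp add: vi wi power2_eq_square)
qed

text \<open>
  The Fischer-Burmeister terms enter only through their squares.
\<close>

lemma cont_diff_Phi_FB: "cont_diff (Phi_FB P)"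
proof -
  note comp = cont_diff_linear_compose[OF bounded_linear_vec_nth]
  have x: "cont_diff (\<lambda>z. u (pr_x z))" if "cont_diff u" for u :: "real^'n \<Rightarrow> 'x::real_normed_vector"
    by (rule cont_diff_compose[OF that]) (intro cont_diff_bounded_linear bounded_linear_pr)
  have data: "cont_diff (\<lambda>z. ineq P (pr_x z) $ i)" "cont_diff (\<lambda>z. eqn P (pr_x z))"
    "cont_diff (\<lambda>z. cG P (pr_x z) $ j)" "cont_diff (\<lambda>z. cH P (pr_x z) $ j)" for i j
    by (intro comp x twice_diff_cont_diff(1)[OF g] twice_diff_cont_diff(1)[OF h]
      twice_diff_cont_diff(1)[OF G] twice_diff_cont_diff(1)[OF H])+
  have mult: "cont_diff (\<lambda>z. pr_lam z $ i)" "cont_diff (\<lambda>z. pr_mu z $ j)" "cont_diff (\<lambda>z. pr_nu z $ j)" for i j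
    by (intro comp cont_diff_bounded_linear bounded_linear_pr)+
  have neg: "cont_diff (\<lambda>z. - (ineq P (pr_x z) $ i))" for i
    by (rule cont_diff_linear_compose[OF bounded_linear_minus[OF bounded_linear_ident] data(1)])
  have q: "cont_diff (\<lambda>z. (pi_FB (a z) (b z))\<^sup>2)" "cont_diff (\<lambda>z. (pi_FB \<bar>a z\<bar> \<bar>b z\<bar>)\<^sup>2)"
    "cont_diff (\<lambda>z. (theta4 (a z, b z))\<^sup>2)"
    if "cont_diff a" "cont_diff b" for a b :: "('n, 'l, 'm, 'p) primal_dual \<Rightarrow> real"
    using cont_diff_compose[OF cont_diff_pi_FB_square cont_diff_Pair[OF that]]
      cont_diff_compose[OF cont_diff_pi_FB_abs_square cont_diff_Pair[OF that]]
      cont_diff_compose[OF cont_diff_theta4_square cont_diff_Pair[OF that]] by simp_all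
  show ?thesis
    unfolding Phi_FB_eq[abs_def]
    by (intro cont_diff_linear_compose[OF bounded_linear_mult_right] cont_diff_add cont_diff_sum q neg data mult
      cont_diff_bilinear[OF bounded_bilinear_inner] cont_diff_gradL)
qed

text \<open>
  The constants come from the componentwise comparisons of the minimum and of \<open>\<phi>\<close> with the
  Fischer-Burmeister terms, together with the equal first and third blocks: \<open>8 = 1 + 2 + 1 + 4\<close>.
\<close>

lemma norm_F_le: "norm (F P z) \<le> 8 * norm (F_FB P z)"
proof -
  have "norm (\<chi> i. pi_min (- (ineq P (pr_x z) $ i)) (pr_lam z $ i))
      \<le> 2 * norm (\<chi> i. pi_FB (- (ineq P (pr_x z) $ i)) (pr_lam z $ i))"
    by (rule norm_vec_le) (use min_le_pi_FB in \<open>auto simp: pi_min_def\<close>)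
  moreover have "norm (\<chi> i. phi (compl_arg P z i)) \<le> 4 * norm (\<chi> i. theta_FB (compl_arg P z i))"
  proof (rule norm_vec_le)
    fix i
    show "norm ((\<chi> i. phi (compl_arg P z i)) $ i) \<le> 4 * norm ((\<chi> i. theta_FB (compl_arg P z i)) $ i)"
      using norm_phi_le[of "compl_arg P z i"] phi1_le_theta_FB[of "compl_arg P z i"] by simp
  qed simp
  ultimately show ?thesis
    using norm_tuple_bounds(1-4)[where a = "gradL z" and b = "\<chi> i. pi_FB (- (ineq P (pr_x z) $ i)) (pr_lam z $ i)"
        and c = "eqn P (pr_x z)" and d = "\<chi> i. theta_FB (compl_arg P z i)"]
      norm_tuple_bounds(5)[where a = "gradL z" and b = "\<chi> i. pi_min (- (ineq P (pr_x z) $ i)) (pr_lam z $ i)"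
        and c = "eqn P (pr_x z)" and d = "\<chi> i. phi (compl_arg P z i)"]
    unfolding F_eq[of z] F_FB_eq[of z] by linarith
qed

text \<open>
  Here \<open>22 = 1 + 4 + 1 + 16\<close>.
\<close>

lemma norm_F_FB_le: "norm (F_FB P z) \<le> 22 * norm (F P z)"
proof -
  have "norm (\<chi> i. pi_FB (- (ineq P (pr_x z) $ i)) (pr_lam z $ i))
      \<le> 4 * norm (\<chi> i. pi_min (- (ineq P (pr_x z) $ i)) (pr_lam z $ i))"
    by (rule norm_vec_le) (use pi_FB_le_min in \<open>auto simp: pi_min_def\<close>)
  moreover have "norm (\<chi> i. theta_FB (compl_arg P z i)) \<le> 16 * norm (\<chi> i. phi (compl_arg P z i))"
  proof (rule norm_vec_le)
    fix i
    show "norm ((\<chi> i. theta_FB (compl_arg P z i)) $ i) \<le> 16 * norm ((\<chi> i. phi (compl_arg P z i)) $ i)"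
      using theta_FB_le_phi1[of "compl_arg P z i"] phi1_le_norm_phi[of "compl_arg P z i"] by simp
  qed simp
  ultimately show ?thesis
    using norm_tuple_bounds(5)[where a = "gradL z" and b = "\<chi> i. pi_FB (- (ineq P (pr_x z) $ i)) (pr_lam z $ i)"
        and c = "eqn P (pr_x z)" and d = "\<chi> i. theta_FB (compl_arg P z i)"]
      norm_tuple_bounds(1-4)[where a = "gradL z" and b = "\<chi> i. pi_min (- (ineq P (pr_x z) $ i)) (pr_lam z $ i)"
        and c = "eqn P (pr_x z)" and d = "\<chi> i. phi (compl_arg P z i)"]
    unfolding F_eq[of z] F_FB_eq[of z] by linarith
qed

lemma F_eq_0_iff:
  "F P z = 0 \<longleftrightarrow> gradL z = 0 \<and> (\<forall>i. min (- (ineq P (pr_x z) $ i)) (pr_lam z $ i) = 0) \<and>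
     eqn P (pr_x z) = 0 \<and> (\<forall>i. M_compl (compl_arg P z i))"
proof -
  have "phi w = 0 \<longleftrightarrow> M_compl w" for w
    using norm_phi_le[of w] phi1_le_norm_phi[of w] phi1_eq_0_iff[of w] phi1_nonneg[of w]
    by (metis mult_zero_right norm_eq_zero norm_le_zero_iff order_antisym)
  then show ?thesis
    by (simp add: F_eq zero_prod_def vec_eq_iff[where 'a = real and 'b = 'l] vec_eq_iff[where 'a = "real^2"] pi_min_def)
qed

lemma primal_dual_M_stationary_iff: "primal_dual_M_stationary P z \<longleftrightarrow> F P z = 0"
proof -
  obtain x lam \<eta> \<mu> \<nu> where z: "z = (x, lam, \<eta>, \<mu>, \<nu>)" by (cases z)
  have grad: "grad (lagrangian P (lam, \<eta>, \<mu>, \<nu>)) x = gradL z"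
    using grad_lagrangian[of z x] by (simp add: z)
  have mn: "min (- a) b = 0 \<longleftrightarrow> a \<le> 0 \<and> (a = 0 \<longrightarrow> 0 \<le> b) \<and> (a \<noteq> 0 \<longrightarrow> b = 0)" for a b :: real
    unfolding min_def by auto
  have orth: "cG P x \<bullet> cH P x = 0 \<longleftrightarrow> (\<forall>i. cG P x $ i * cH P x $ i = 0)"
    if "\<And>i. 0 \<le> cG P x $ i" "\<And>i. 0 \<le> cH P x $ i"
    using that by (simp add: inner_vec_def sum_nonneg_eq_0_iff)
  show ?thesis
  proof
    assume *: "F P z = 0"
    then have "\<forall>i. M_compl (compl_arg P z i)" by (simp add: F_eq_0_iff)
    then have c: "0 \<le> cG P x $ i" "0 \<le> cH P x $ i" "cG P x $ i * cH P x $ i = 0"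
      "cG P x $ i * \<mu> $ i = 0" "cH P x $ i * \<nu> $ i = 0" 
      "\<mu> $ i * \<nu> $ i = 0 \<or> \<mu> $ i < 0 \<and> \<nu> $ i < 0" for i
      by (simp_all add: compl_arg_eq z)
    have "feasible P x"
      using * c orth unfolding F_eq_0_iff feasible_def by (auto simp: z mn)
    moreover have "(lam, \<eta>, \<mu>, \<nu>) \<in> M_multipliers P x"
      unfolding M_multipliers_def mem_Collect_eq case_prod_conv grad
    proof (intro conjI ballI)
      show "gradL z = 0" using * by (simp add: F_eq_0_iff)
      show "0 \<le> lam $ i" if "i \<in> Ig P x" for i
        using * that unfolding F_eq_0_iff mn by (simp add: Ig_def z)
      show "lam $ i = 0" if "i \<in> - Ig P x" for i
        using * that unfolding F_eq_0_iff mn by (simp add: Ig_def z)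
      show "\<mu> $ i = 0" if "i \<in> Ip0 P x" for i using c(4)[of i] that by (simp add: Ip0_def)
      show "\<nu> $ i = 0" if "i \<in> I0p P x" for i using c(5)[of i] that by (simp add: I0p_def)
      show "\<mu> $ i * \<nu> $ i = 0 \<or> \<mu> $ i < 0 \<and> \<nu> $ i < 0" for i using c(6) .
    qed
    ultimately show "primal_dual_M_stationary P z" by (simp add: z)
  next
    assume *: "primal_dual_M_stationary P z"
    then have feas: "\<And>i. ineq P x $ i \<le> 0" "eqn P x = 0" "\<And>i. 0 \<le> cG P x $ i" "\<And>i. 0 \<le> cH P x $ i"
        "cG P x \<bullet> cH P x = 0"
      and mul: "gradL z = 0" "\<forall>i\<in>Ig P x. lam $ i \<ge> 0" "\<forall>i\<in>- Ig P x. lam $ i = 0"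
        "\<forall>i\<in>Ip0 P x. \<mu> $ i = 0" "\<forall>i\<in>I0p P x. \<nu> $ i = 0"
        "\<forall>i\<in>I00 P x. \<mu> $ i * \<nu> $ i = 0 \<or> (\<mu> $ i < 0 \<and> \<nu> $ i < 0)"
      by (auto simp: z feasible_def M_multipliers_def grad[unfolded z])
    have GH: "cG P x $ i * cH P x $ i = 0" for i using feas orth by blast
    have "M_compl (compl_arg P z i)" for i
      using feas(3,4)[of i] GH[of i] mul(4-6)
      by (cases "cG P x $ i = 0"; cases "cH P x $ i = 0")
        (auto simp: compl_arg_eq z Ip0_def I0p_def I00_def)
    moreover have "\<forall>i. min (- (ineq P x $ i)) (lam $ i) = 0"
      unfolding mn using feas(1) mul(2,3) by (auto simp: Ig_def)
    ultimately show "F P z = 0" using feas(2) mul(1) by (simp add: F_eq_0_iff) (simp add: z)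
  qed
qed

lemma Phi_FB_eq_0_iff: "Phi_FB P z = 0 \<longleftrightarrow> primal_dual_M_stationary P z"
proof -
  have "F_FB P z = 0 \<longleftrightarrow> F P z = 0" using norm_F_FB_le[of z] norm_F_le[of z] by auto
  then show ?thesis by (simp add: primal_dual_M_stationary_iff Phi_FB_def)
qed

end

section \<open>The linearization error of the system\<close>

lemma has_derivative_bigo_lipschitz:
  assumes "(f has_derivative D) (at x\<^sub>0)"
  shows "(\<lambda>x. norm (f x - f x\<^sub>0)) \<in> O[nhds x\<^sub>0](\<lambda>x. norm (x - x\<^sub>0))"
proof -
  interpret D: bounded_linear D using assms by (rule has_derivative_bounded_linear)
  obtain K where K: "\<And>x. norm (D x) \<le> norm x * K" using D.bounded by blast
  obtain d where d: "d > 0" "\<And>y. norm (y - x\<^sub>0) < d \<Longrightarrow> norm (f y - f x\<^sub>0 - D (y - x\<^sub>0)) \<le> 1 * norm (y - x\<^sub>0)"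
    using assms unfolding has_derivative_at_alt by (metis zero_less_one)
  have "\<forall>\<^sub>F x in nhds x\<^sub>0. norm (norm (f x - f x\<^sub>0)) \<le> (K + 1) * norm (norm (x - x\<^sub>0))"
    unfolding eventually_nhds_metric
  proof (intro exI[of _ d] conjI allI impI d(1))
    fix x assume "dist x x\<^sub>0 < d"
    then have "norm (f x - f x\<^sub>0 - D (x - x\<^sub>0)) \<le> norm (x - x\<^sub>0)" using d(2)[of x] by (simp add: dist_norm)
    moreover have "norm (f x - f x\<^sub>0) \<le> norm (f x - f x\<^sub>0 - D (x - x\<^sub>0)) + norm (D (x - x\<^sub>0))"
      using norm_triangle_ineq[of "f x - f x\<^sub>0 - D (x - x\<^sub>0)" "D (x - x\<^sub>0)"] by simp
    ultimately show "norm (norm (f x - f x\<^sub>0)) \<le> (K + 1) * norm (norm (x - x\<^sub>0))"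
      using K[of "x - x\<^sub>0"] by (simp add: algebra_simps)
  qed
  then show ?thesis by (rule bigoI)
qed

text \<open>
  The error of the Newton linearization, in which the derivative is taken at the moving point
  \<open>x\<close> and not at \<open>x\<^sub>0\<close>.
\<close>

definition newton_rem ::
  "('a::real_normed_vector \<Rightarrow> 'b::real_normed_vector) \<Rightarrow> ('a \<Rightarrow> 'a \<Rightarrow>\<^sub>L 'b) \<Rightarrow> 'a \<Rightarrow> 'a \<Rightarrow> real" where
  "newton_rem f f' x\<^sub>0 x = norm (f x - f x\<^sub>0 - f' x (x - x\<^sub>0))"

text \<open>
  The mean value inequality gives the error for the derivative at \<open>x\<^sub>0\<close>, and replacing it by
  the derivative at \<open>x\<close> costs the same amount again.
\<close>

lemma newton_rem_bound:
  assumes der: "\<And>x. (f has_derivative blinfun_apply (f' x)) (at x)"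
    and near: "\<And>y. dist y x\<^sub>0 \<le> dist x x\<^sub>0 \<Longrightarrow> norm (f' y - f' x\<^sub>0) \<le> e"
  shows "newton_rem f f' x\<^sub>0 x \<le> 2 * e * norm (x - x\<^sub>0)"
proof -
  have "norm (f x - f x\<^sub>0 - f' x\<^sub>0 (x - x\<^sub>0)) \<le> norm (x - x\<^sub>0) * e"
  proof (rule differentiable_bound_linearization[where S = "cball x\<^sub>0 (dist x x\<^sub>0)" and f' = "\<lambda>x. blinfun_apply (f' x)"])
    show "x\<^sub>0 + t *\<^sub>R (x - x\<^sub>0) \<in> cball x\<^sub>0 (dist x x\<^sub>0)" if "t \<in> {0..1}" for t
      using that mult_right_mono[of t 1 "norm (x - x\<^sub>0)"] by (simp add: dist_norm)
    show "(f has_derivative blinfun_apply (f' y)) (at y within cball x\<^sub>0 (dist x x\<^sub>0))" for y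
      by (rule has_derivative_at_withinI[OF der])
    show "onorm (blinfun_apply (f' y) - blinfun_apply (f' x\<^sub>0)) \<le> e" if "y \<in> cball x\<^sub>0 (dist x x\<^sub>0)" for y
      using near[of y] that by (simp add: dist_commute norm_blinfun.rep_eq minus_blinfun.rep_eq fun_diff_def)
  qed simp
  moreover have "norm (f' x (x - x\<^sub>0) - f' x\<^sub>0 (x - x\<^sub>0)) \<le> norm (x - x\<^sub>0) * e"
    using norm_blinfun[of "f' x - f' x\<^sub>0" "x - x\<^sub>0"] mult_right_mono[OF near[of x], of "norm (x - x\<^sub>0)"]
    by (simp add: blinfun.diff_left mult.commute)
  ultimately show ?thesis
    using norm_triangle_ineq4[of "f x - f x\<^sub>0 - f' x\<^sub>0 (x - x\<^sub>0)" "f' x (x - x\<^sub>0) - f' x\<^sub>0 (x - x\<^sub>0)"]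
    by (simp add: newton_rem_def algebra_simps)
qed

lemma newton_rem_smallo:
  assumes der: "\<And>x. (f has_derivative blinfun_apply (f' x)) (at x)" and cont: "continuous_on UNIV f'"
  shows "newton_rem f f' x\<^sub>0 \<in> o[nhds x\<^sub>0](\<lambda>x. norm (x - x\<^sub>0))"
proof (rule landau_o.smallI)
  fix c :: real assume "c > 0"
  then obtain d where d: "d > 0" "\<And>y. dist y x\<^sub>0 < d \<Longrightarrow> dist (f' y) (f' x\<^sub>0) < c / 2"
    using cont[unfolded continuous_on_eq_continuous_at[OF open_UNIV], rule_format, of x\<^sub>0]
    unfolding continuous_at_eps_delta by (metis UNIV_I half_gt_zero)
  have "newton_rem f f' x\<^sub>0 x \<le> 2 * (c / 2) * norm (x - x\<^sub>0)" if "dist x x\<^sub>0 < d" for x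
  proof (rule newton_rem_bound[OF der])
    show "norm (f' y - f' x\<^sub>0) \<le> c / 2" if "dist y x\<^sub>0 \<le> dist x x\<^sub>0" for y
      using d(2)[of y] that \<open>dist x x\<^sub>0 < d\<close> by (simp add: dist_norm)
  qed
  then show "\<forall>\<^sub>F x in nhds x\<^sub>0. norm (newton_rem f f' x\<^sub>0 x) \<le> c * norm (norm (x - x\<^sub>0))"
    unfolding eventually_nhds_metric using d(1) by (auto simp: newton_rem_def)
qed

text \<open>
  The growth condition on \<open>f'\<close> at \<open>x\<^sub>0\<close> holds both for differentiable and for locally Lipschitz
  continuous \<open>f'\<close>; the former serves the constraint functions, the latter the second derivatives.
\<close>

lemma newton_rem_bigo:
  assumes der: "\<And>x. (f has_derivative blinfun_apply (f' x)) (at x)"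
    and lip: "(\<lambda>x. norm (f' x - f' x\<^sub>0)) \<in> O[nhds x\<^sub>0](\<lambda>x. norm (x - x\<^sub>0))"
  shows "newton_rem f f' x\<^sub>0 \<in> O[nhds x\<^sub>0](\<lambda>x. (norm (x - x\<^sub>0))\<^sup>2)"
proof -
  obtain L where "\<forall>\<^sub>F x in nhds x\<^sub>0. norm (f' x - f' x\<^sub>0) \<le> L * norm (x - x\<^sub>0)" "L > 0"
    using landau_o.bigE[OF lip] by (auto simp del: eventually_nhds)
  then obtain d where d: "d > 0" "\<And>y. dist y x\<^sub>0 < d \<Longrightarrow> norm (f' y - f' x\<^sub>0) \<le> L * norm (y - x\<^sub>0)"
    unfolding eventually_nhds_metric by blast
  have "newton_rem f f' x\<^sub>0 x \<le> 2 * (L * norm (x - x\<^sub>0)) * norm (x - x\<^sub>0)" if "dist x x\<^sub>0 < d" for x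
  proof (rule newton_rem_bound[OF der])
    fix y assume y: "dist y x\<^sub>0 \<le> dist x x\<^sub>0"
    then have "norm (f' y - f' x\<^sub>0) \<le> L * norm (y - x\<^sub>0)" using d(2) that by simp
    also have "\<dots> \<le> L * norm (x - x\<^sub>0)" using y \<open>L > 0\<close> by (intro mult_left_mono) (auto simp: dist_norm)
    finally show "norm (f' y - f' x\<^sub>0) \<le> L * norm (x - x\<^sub>0)" .
  qed
  then have "\<forall>\<^sub>F x in nhds x\<^sub>0. norm (newton_rem f f' x\<^sub>0 x) \<le> (2 * L) * norm ((norm (x - x\<^sub>0))\<^sup>2)"
    unfolding eventually_nhds_metric using d(1)
    by (intro exI[of _ d]) (auto simp: newton_rem_def power2_eq_square mult.assoc)
  then show ?thesis by (rule bigoI)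
qed

lemma locally_lipschitz_bigo:
  fixes f :: "'a::real_normed_vector \<Rightarrow> 'b::real_normed_vector"
  assumes "locally_lipschitz f"
  shows "(\<lambda>x. norm (f x - f x\<^sub>0)) \<in> O[nhds x\<^sub>0](\<lambda>x. norm (x - x\<^sub>0))"
proof -
  obtain r L where r: "r > 0" "L-lipschitz_on (ball x\<^sub>0 r) f" using assms unfolding locally_lipschitz_def by blast
  have "norm (f x - f x\<^sub>0) \<le> L * norm (x - x\<^sub>0)" if "dist x x\<^sub>0 < r" for x
    using lipschitz_onD[OF r(2), of x x\<^sub>0] that r(1) by (simp add: dist_norm dist_commute norm_minus_commute)
  then have "\<forall>\<^sub>F x in nhds x\<^sub>0. norm (norm (f x - f x\<^sub>0)) \<le> L * norm (norm (x - x\<^sub>0))"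
    unfolding eventually_nhds_metric using r(1) by auto
  then show ?thesis by (rule bigoI)
qed

lemma bigo_mono:
  fixes a b :: "'a \<Rightarrow> real"
  assumes "\<forall>\<^sub>F z in \<F>. \<bar>a z\<bar> \<le> b z" "b \<in> O[\<F>](c)" shows "a \<in> O[\<F>](c)"
proof (rule landau_o.big_trans[OF bigoI[where c = 1] assms(2)])
  show "\<forall>\<^sub>F z in \<F>. norm (a z) \<le> 1 * norm (b z)"
    using assms(1) by eventually_elim auto
qed

lemma norm_coord_le:
  "norm (coord w - coord w') \<le> \<bar>(coord w - coord w') $ 1\<bar> + \<bar>(coord w - coord w') $ 2\<bar>
     + \<bar>(coord w - coord w') $ 3\<bar> + \<bar>(coord w - coord w') $ 4\<bar>"
  using norm_le_l1_cart[of "coord w - coord w'"] by (simp add: sum_4)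

lemma norm_pr_le: "norm (pr_x z) \<le> norm z" "norm (pr_mu z) \<le> norm z" "norm (pr_nu z) \<le> norm z" "norm (pr_lam z) \<le> norm z"
proof -
  have *: "norm (fst p) \<le> norm p" "norm (snd p) \<le> norm p" for p :: "'x::real_normed_vector \<times> 'y::real_normed_vector"
    using norm_fst_le[of "fst p" "snd p"] norm_snd_le[of "snd p" "fst p"] by auto
  show "norm (pr_x z) \<le> norm z" "norm (pr_mu z) \<le> norm z" "norm (pr_nu z) \<le> norm z" "norm (pr_lam z) \<le> norm z"
    by (intro order_trans[OF *(1)] order_trans[OF *(2)] order_refl)+
qed

text \<open>
  The bound on infinitely many members suffices. The Newton matrix has finitely many selection
  patterns; one of them occurs infinitely often along a sequence, and this lemma then applies to it.
\<close>

lemma frequently_le_null_limit: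
  fixes X :: "nat \<Rightarrow> real"
  assumes "X \<longlonglongrightarrow> x" "e \<longlonglongrightarrow> 0" "\<exists>\<^sub>F n in sequentially. \<bar>X n\<bar> \<le> e n"
  shows "x = 0"
proof (rule ccontr)
  assume "x \<noteq> 0"
  have "(\<lambda>n. \<bar>X n\<bar> - e n) \<longlonglongrightarrow> \<bar>x\<bar> - 0" by (intro tendsto_intros assms)
  then have "\<forall>\<^sub>F n in sequentially. 0 < \<bar>X n\<bar> - e n"
    by (rule order_tendstoD) (use \<open>x \<noteq> 0\<close> in auto)
  then have "\<forall>\<^sub>F n in sequentially. \<not> \<bar>X n\<bar> \<le> e n" by eventually_elim simp
  then show False using assms(3) by (simp add: frequently_def)
qed

text \<open>
  The dimension equals the number of row indices, so no row is repeated and the set of rows is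
  linearly independent.
\<close>

lemma full_row_rank_on_coeff:
  fixes V :: "real^'n^'r::finite"
  assumes "full_row_rank_on I V" "(\<Sum>k\<in>I. c k *\<^sub>R row k V) = 0" "k \<in> I"
  shows "c k = 0"
proof -
  let ?R = "\<lambda>i. row i V"
  have fin: "finite I" by simp
  have dim: "dim (?R ` I) = card I" using assms(1) by (simp add: full_row_rank_on_def)
  have "card (?R ` I) \<le> card I" by (rule card_image_le[OF fin])
  moreover have "dim (?R ` I) \<le> card (?R ` I)" by (rule dim_le_card') simp
  ultimately have card: "card (?R ` I) = card I" using dim by simp
  then have inj: "inj_on ?R I" by (rule eq_card_imp_inj_on[OF fin])
  have ind: "independent (?R ` I)"
    by (rule card_le_dim_spanning[of _ "?R ` I"]) (use dim card in \<open>auto intro: span_base\<close>)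
  have inv: "inv_into I ?R (row i V) = i" if "i \<in> I" for i using inv_into_f_f[OF inj that] by simp
  have "(\<Sum>v\<in>?R ` I. c (inv_into I ?R v) *\<^sub>R v) = 0"
    using assms(2) by (simp add: sum.reindex[OF inj] inv)
  then have "c (inv_into I ?R (?R k)) = 0"
    using independentD[OF ind, of "?R ` I" "\<lambda>v. c (inv_into I ?R v)" "?R k"] assms(3) by simp
  then show ?thesis using assms(3) by (simp add: inv)
qed

context smooth_mpcc
begin

lemma primal_lipschitz_bigo:
  assumes "(u has_derivative D) (at (pr_x zb))"
  shows "(\<lambda>z::('n, 'l, 'm, 'p) primal_dual. norm (u (pr_x z) - u (pr_x zb))) \<in> O[nhds zb](\<lambda>z. norm (z - zb))"
proof (rule landau_o.big_trans[OF landau_o.big.compose[OF has_derivative_bigo_lipschitz[OF assms]]])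
  show "filterlim pr_x (nhds (pr_x zb)) (nhds zb)" by (intro tendsto_fst filterlim_ident)
  show "(\<lambda>z. norm (pr_x z - pr_x zb)) \<in> O[nhds zb](\<lambda>z. norm (z - zb))"
  proof (rule bigoI[where c = 1], intro always_eventually allI)
    fix z
    show "norm (norm (pr_x z - pr_x zb)) \<le> 1 * norm (norm (z - zb))"
      using norm_pr_le(1)[of "z - zb"] by simp
  qed
qed

lemma primal_bigo_square:
  assumes "u \<in> O[nhds (pr_x zb)](\<lambda>x. (norm (x - pr_x zb))\<^sup>2)"
  shows "(\<lambda>z::('n, 'l, 'm, 'p) primal_dual. u (pr_x z)) \<in> O[nhds zb](\<lambda>z. (norm (z - zb))\<^sup>2)"
proof (rule landau_o.big_trans[OF landau_o.big.compose[OF assms]])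
  show "filterlim pr_x (nhds (pr_x zb)) (nhds zb)" by (intro tendsto_fst filterlim_ident)
  show "(\<lambda>z. (norm (pr_x z - pr_x zb))\<^sup>2) \<in> O[nhds zb](\<lambda>z. (norm (z - zb))\<^sup>2)"
  proof (rule bigoI[where c = 1], intro always_eventually allI)
    fix z
    show "norm ((norm (pr_x z - pr_x zb))\<^sup>2) \<le> 1 * norm ((norm (z - zb))\<^sup>2)"
      using power_mono[OF norm_pr_le(1)[of "z - zb"] norm_ge_zero, of 2] by simp
  qed
qed

lemma primal_newton_rem_bigo:
  assumes "twice_diff u u' u''"
  shows "(\<lambda>z::('n, 'l, 'm, 'p) primal_dual. newton_rem u u' (pr_x zb) (pr_x z)) \<in> O[nhds zb](\<lambda>z. (norm (z - zb))\<^sup>2)"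
  by (rule primal_bigo_square, rule newton_rem_bigo[OF _ has_derivative_bigo_lipschitz])
    (use assms in \<open>auto simp: twice_diff_def\<close>)

lemma compl_arg_bigo:
  "(\<lambda>z. norm (coord (compl_arg P z i) - coord (compl_arg P zb i))) \<in> O[nhds zb](\<lambda>z. norm (z - zb))"
proof (rule bigo_mono)
  let ?b = "\<lambda>z. norm (cG P (pr_x z) - cG P (pr_x zb)) + norm (cH P (pr_x z) - cH P (pr_x zb)) + 2 * norm (z - zb)"
  have "\<bar>norm (coord (compl_arg P z i) - coord (compl_arg P zb i))\<bar> \<le> ?b z" for z
  proof -
    have "norm (pr_mu (z - zb)) \<le> norm (z - zb)" "norm (pr_nu (z - zb)) \<le> norm (z - zb)"
      by (rule norm_pr_le)+
    then show ?thesis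
      using norm_coord_le[of "compl_arg P z i" "compl_arg P zb i"]
        component_le_norm_cart[of "cG P (pr_x z) - cG P (pr_x zb)" i] component_le_norm_cart[of "cH P (pr_x z) - cH P (pr_x zb)" i]
        component_le_norm_cart[of "pr_mu (z - zb)" i] component_le_norm_cart[of "pr_nu (z - zb)" i]
      by (simp add: compl_arg_eq)
  qed
  then show "\<forall>\<^sub>F z in nhds zb. \<bar>norm (coord (compl_arg P z i) - coord (compl_arg P zb i))\<bar> \<le> ?b z" by simp
  show "?b \<in> O[nhds zb](\<lambda>z. norm (z - zb))"
    by (intro sum_in_bigo primal_lipschitz_bigo[OF derivs(4)] primal_lipschitz_bigo[OF derivs(5)]) simp
qed

text \<open>
  If the selected argument of the minimum stays selected at points arbitrarily close to \<open>zb\<close>, it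
  is minimal at \<open>zb\<close> too, where the minimum is \<open>0\<close>.
\<close>

lemma eventually_active_ineq:
  assumes "F P zb = 0"
  shows "\<forall>\<^sub>F z in nhds zb. \<forall>i. if - (ineq P (pr_x z) $ i) \<le> pr_lam z $ i then ineq P (pr_x zb) $ i = 0 else pr_lam zb $ i = 0"
proof (rule eventually_all_finite)
  fix i
  have m: "min (- (ineq P (pr_x zb) $ i)) (pr_lam zb $ i) = 0" using assms by (simp add: F_eq_0_iff)
  have "isCont (\<lambda>z. ineq P (pr_x z)) zb"
    by (rule isCont_o2[OF _ has_derivative_continuous[OF derivs(2)]]) (intro continuous_intros)
  then have "isCont (\<lambda>z. ineq P (pr_x z) $ i + pr_lam z $ i) zb" by (intro continuous_intros)
  then have lim: "((\<lambda>z. ineq P (pr_x z) $ i + pr_lam z $ i) \<longlongrightarrow> ineq P (pr_x zb) $ i + pr_lam zb $ i) (nhds zb)"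
    unfolding isCont_def by (rule tendsto_at_iff_tendsto_nhds[THEN iffD1])
  consider "ineq P (pr_x zb) $ i = 0" "pr_lam zb $ i = 0" | "ineq P (pr_x zb) $ i = 0" "0 < pr_lam zb $ i"
    | "ineq P (pr_x zb) $ i < 0" "pr_lam zb $ i = 0" using m by linarith
  then show "\<forall>\<^sub>F z in nhds zb. if - (ineq P (pr_x z) $ i) \<le> pr_lam z $ i then ineq P (pr_x zb) $ i = 0 else pr_lam zb $ i = 0"
  proof cases
    case 2
    then have "\<forall>\<^sub>F z in nhds zb. 0 < ineq P (pr_x z) $ i + pr_lam z $ i" using order_tendstoD(1)[OF lim] by simp
    then show ?thesis by eventually_elim (use 2 in auto)
  next
    case 3
    then have "\<forall>\<^sub>F z in nhds zb. ineq P (pr_x z) $ i + pr_lam z $ i < 0" using order_tendstoD(2)[OF lim] by simp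
    then show ?thesis by eventually_elim (use 3 in auto)
  qed simp
qed

lemma eventually_active_compl:
  assumes "F P zb = 0"
  shows "\<forall>\<^sub>F z in nhds zb. \<forall>k. exact_selection (compl_arg P zb k) (compl_arg P z k)"
proof (rule eventually_all_finite)
  fix k
  have "M_compl (compl_arg P zb k)" using assms by (simp add: F_eq_0_iff)
  from phi_newton_exact[OF this] obtain \<epsilon> where \<epsilon>: "\<epsilon> > 0" and
    ex: "\<And>w. norm (coord w - coord (compl_arg P zb k)) < \<epsilon> \<Longrightarrow> exact_selection (compl_arg P zb k) w"
    by blast
  obtain C where C: "C > 0" "\<forall>\<^sub>F z in nhds zb. norm (norm (coord (compl_arg P z k) - coord (compl_arg P zb k))) \<le> C * norm (norm (z - zb))"
    by (rule landau_o.bigE[OF compl_arg_bigo])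
  have "\<forall>\<^sub>F z in nhds zb. dist z zb < \<epsilon> / C"
    unfolding eventually_nhds_metric using \<epsilon> C(1) by (intro exI[of _ "\<epsilon> / C"]) simp
  with C(2) show "\<forall>\<^sub>F z in nhds zb. exact_selection (compl_arg P zb k) (compl_arg P z k)"
  proof eventually_elim
    case (elim z)
    show ?case by (rule ex) (use elim C(1) in \<open>simp add: dist_norm pos_less_divide_eq mult.commute\<close>)
  qed
qed

text \<open>
  In the product rule the error is \<open>R\<^sup>* l(z) - (u'(x) - u'(x\<^sub>0))\<^sup>* l(z - zb)\<close> with \<open>R\<close> the error of \<open>u'\<close>.
  The second part is quadratic, and \<open>\<omega>\<close> dominates both.
\<close>

lemma adj_newton_rem_bigo:
  fixes u' :: "real^'n \<Rightarrow> (real^'n) \<Rightarrow>\<^sub>L 'b::real_inner" and l :: "('n, 'l, 'm, 'p) primal_dual \<Rightarrow> 'b"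
  assumes u': "(u' has_derivative blinfun_apply (u'' (pr_x zb))) (at (pr_x zb))" and l: "bounded_linear l"
    and quad: "(\<lambda>z. (norm (z - zb))\<^sup>2) \<in> O[nhds zb](\<omega>)"
    and rem: "(\<lambda>z. newton_rem u' u'' (pr_x zb) (pr_x z)) \<in> O[nhds zb](\<omega>)"
  shows "(\<lambda>z. norm (adj (u' (pr_x z)) (l z) - adj (u' (pr_x zb)) (l zb)
       - (adj (u'' (pr_x z) (pr_x (z - zb))) (l z) + adj (u' (pr_x z)) (l (z - zb))))) \<in> O[nhds zb](\<omega>)"
proof (rule bigo_mono)
  interpret l: bounded_linear l by fact
  interpret adj: bounded_bilinear adj by (rule bounded_bilinear_adj)
  let ?R = "\<lambda>z. newton_rem u' u'' (pr_x zb) (pr_x z)"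
  let ?b = "\<lambda>z. ?R z * norm (l z) + norm (u' (pr_x z) - u' (pr_x zb)) * norm (l (z - zb))"
  have "norm (adj (u' (pr_x z)) (l z) - adj (u' (pr_x zb)) (l zb)
       - (adj (u'' (pr_x z) (pr_x (z - zb))) (l z) + adj (u' (pr_x z)) (l (z - zb)))) \<le> ?b z" for z
  proof -
    have "adj (u' (pr_x z)) (l z) - adj (u' (pr_x zb)) (l zb)
       - (adj (u'' (pr_x z) (pr_x (z - zb))) (l z) + adj (u' (pr_x z)) (l (z - zb)))
      = adj (u' (pr_x z) - u' (pr_x zb) - u'' (pr_x z) (pr_x z - pr_x zb)) (l z)
        - adj (u' (pr_x z) - u' (pr_x zb)) (l (z - zb))"
      by (simp add: adj.diff_left adj.diff_right l.diff)
    then show ?thesis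
      using norm_triangle_ineq4 norm_adj_le unfolding newton_rem_def by (smt (verit))
  qed
  then show "\<forall>\<^sub>F z in nhds zb. \<bar>norm (adj (u' (pr_x z)) (l z) - adj (u' (pr_x zb)) (l zb)
       - (adj (u'' (pr_x z) (pr_x (z - zb))) (l z) + adj (u' (pr_x z)) (l (z - zb))))\<bar> \<le> ?b z" by simp
  have "((\<lambda>z. norm (l z)) \<longlongrightarrow> norm (l zb)) (nhds zb)" by (intro tendsto_intros l.tendsto filterlim_ident)
  then have "\<forall>\<^sub>F z in nhds zb. norm (l z) < norm (l zb) + 1" by (rule order_tendstoD) simp
  then have l1: "(\<lambda>z. norm (l z)) \<in> O[nhds zb](\<lambda>_. 1)"
    by (intro bigoI[where c = "norm (l zb) + 1"]) (auto elim!: eventually_mono)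
  obtain K where "\<And>z. norm (l z) \<le> norm z * K" using l.bounded by blast
  then have l2: "(\<lambda>z. norm (l (z - zb))) \<in> O[nhds zb](\<lambda>z. norm (z - zb))"
    by (intro bigoI[where c = K]) (simp add: mult.commute)
  have "(\<lambda>z. norm (u' (pr_x z) - u' (pr_x zb)) * norm (l (z - zb))) \<in> O[nhds zb](\<lambda>z. norm (z - zb) * norm (z - zb))"
    by (intro landau_o.big.mult primal_lipschitz_bigo[OF u'] l2)
  then have "(\<lambda>z. norm (u' (pr_x z) - u' (pr_x zb)) * norm (l (z - zb))) \<in> O[nhds zb](\<omega>)"
    by (rule landau_o.big_trans[OF _ quad[unfolded power2_eq_square]])
  moreover have "(\<lambda>z. ?R z * norm (l z)) \<in> O[nhds zb](\<lambda>z. \<omega> z * 1)"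
    by (intro landau_o.big.mult rem l1)
  ultimately show "?b \<in> O[nhds zb](\<omega>)" by (intro sum_in_bigo) simp_all
qed

text \<open>
  Since \<open>\<pi>\<^sub>m\<^sub>i\<^sub>n\<close> and \<open>\<phi>\<close> are linearized without error, only smooth maps contribute. The constraint
  functions have quadratic errors; the gradient of the Lagrangian has those of the first derivatives
  of the data. The modulus \<open>\<omega>\<close> is a parameter because the superlinear and the quadratic rate come from
  the same estimate with different moduli.
\<close>

lemma F_remainder:
  assumes zero: "F P zb = 0"
    and quad: "(\<lambda>z. (norm (z - zb))\<^sup>2) \<in> O[nhds zb](\<omega>)"
    and rem: "(\<lambda>z. newton_rem f' f'' (pr_x zb) (pr_x z)) \<in> O[nhds zb](\<omega>)"
      "(\<lambda>z. newton_rem g' g'' (pr_x zb) (pr_x z)) \<in> O[nhds zb](\<omega>)"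
      "(\<lambda>z. newton_rem h' h'' (pr_x zb) (pr_x z)) \<in> O[nhds zb](\<omega>)"
      "(\<lambda>z. newton_rem G' G'' (pr_x zb) (pr_x z)) \<in> O[nhds zb](\<omega>)"
      "(\<lambda>z. newton_rem H' H'' (pr_x zb) (pr_x z)) \<in> O[nhds zb](\<omega>)"
  shows "(\<lambda>z. norm (F P z - DF P z (z - zb))) \<in> O[nhds zb](\<omega>)"
proof -
  interpret adj: bounded_bilinear adj by (rule bounded_bilinear_adj)
  note z0 = zero[unfolded F_eq_0_iff]
  have quadR: "(\<lambda>z. newton_rem u u' (pr_x zb) (pr_x z)) \<in> O[nhds zb](\<omega>)" if "twice_diff u u' u''" 
    for u :: "real^'n \<Rightarrow> 'x::real_normed_vector" and u' u''
    by (rule landau_o.big_trans[OF primal_newton_rem_bigo[OF that] quad])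
  let ?x = "pr_x zb"
  let ?Rf = "\<lambda>z. newton_rem f' f'' ?x (pr_x z)"
  have grad: "(\<lambda>z. norm (gradL z - D_gradL z (z - zb))) \<in> O[nhds zb](\<omega>)"
  proof (rule bigo_mono)
    \<comment> \<open>The linearization errors of the four multiplier terms of the gradient.\<close>
    define B :: "(('n, 'l, 'm, 'p) primal_dual \<Rightarrow> real^'n) \<Rightarrow> (('n, 'l, 'm, 'p) primal_dual \<Rightarrow> real^'n) \<Rightarrow> ('n, 'l, 'm, 'p) primal_dual \<Rightarrow> real^'n"
      where "B = (\<lambda>a b z. a z - a zb - b z)"
    define qg where "qg = B (\<lambda>z. adj (g' (pr_x z)) (pr_lam z))
        (\<lambda>z. adj (g'' (pr_x z) (pr_x (z - zb))) (pr_lam z) + adj (g' (pr_x z)) (pr_lam (z - zb)))"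
    define qh where "qh = B (\<lambda>z. adj (h' (pr_x z)) (pr_eta z))
        (\<lambda>z. adj (h'' (pr_x z) (pr_x (z - zb))) (pr_eta z) + adj (h' (pr_x z)) (pr_eta (z - zb)))"
    define qG where "qG = B (\<lambda>z. adj (G' (pr_x z)) (pr_mu z))
        (\<lambda>z. adj (G'' (pr_x z) (pr_x (z - zb))) (pr_mu z) + adj (G' (pr_x z)) (pr_mu (z - zb)))"
    define qH where "qH = B (\<lambda>z. adj (H' (pr_x z)) (pr_nu z))
        (\<lambda>z. adj (H'' (pr_x z) (pr_x (z - zb))) (pr_nu z) + adj (H' (pr_x z)) (pr_nu (z - zb)))"
    let ?b = "\<lambda>z. ?Rf z + norm (qg z) + norm (qh z) + norm (qG z) + norm (qH z)"
    have "norm (gradL z - D_gradL z (z - zb)) \<le> ?b z" for z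
    proof -
      have "gradL z - D_gradL z (z - zb) = adj (f' (pr_x z) - f' ?x - f'' (pr_x z) (pr_x z - ?x)) 1
         + qg z + qh z + qG z + qH z + gradL zb"
        by (simp add: gradL_def D_gradL_def hessL_def adj.diff_left qg_def qh_def qG_def qH_def B_def)
      then have eq: "gradL z - D_gradL z (z - zb) = adj (f' (pr_x z) - f' ?x - f'' (pr_x z) (pr_x z - ?x)) 1
         + qg z + qh z + qG z + qH z" using z0 by simp
      have "norm (adj (f' (pr_x z) - f' ?x - f'' (pr_x z) (pr_x z - ?x)) 1) \<le> ?Rf z"
        using norm_adj_le[of "f' (pr_x z) - f' ?x - f'' (pr_x z) (pr_x z - ?x)" 1] by (simp add: newton_rem_def)
      then show ?thesis unfolding eq by (intro norm_triangle_mono order_refl)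
    qed
    then show "\<forall>\<^sub>F z in nhds zb. \<bar>norm (gradL z - D_gradL z (z - zb))\<bar> \<le> ?b z" by simp
    show "?b \<in> O[nhds zb](\<omega>)"
      unfolding qg_def qh_def qG_def qH_def B_def
      by (intro sum_in_bigo rem adj_newton_rem_bigo derivs' bounded_linear_pr quad)
  qed
  have ineq: "(\<lambda>z. norm (\<chi> i. pi_min (- (ineq P (pr_x z) $ i)) (pr_lam z $ i)
       - (if - (ineq P (pr_x z) $ i) \<le> pr_lam z $ i then - (g' (pr_x z) (pr_x (z - zb)) $ i) else pr_lam (z - zb) $ i)))
       \<in> O[nhds zb](\<omega>)"
  proof (rule bigo_mono)
    show "\<forall>\<^sub>F z in nhds zb. \<bar>norm (\<chi> i. pi_min (- (ineq P (pr_x z) $ i)) (pr_lam z $ i)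
       - (if - (ineq P (pr_x z) $ i) \<le> pr_lam z $ i then - (g' (pr_x z) (pr_x (z - zb)) $ i) else pr_lam (z - zb) $ i))\<bar>
       \<le> (\<Sum>i\<in>(UNIV::'l set). newton_rem (ineq P) g' ?x (pr_x z))"
      using eventually_active_ineq[OF zero]
    proof eventually_elim
      case (elim z)
      show ?case unfolding abs_norm_cancel
      proof (rule order_trans[OF norm_vec_le_sum sum_mono])
        fix i
        have "\<bar>(ineq P (pr_x z) - ineq P ?x - g' (pr_x z) (pr_x z - ?x)) $ i\<bar> \<le> newton_rem (ineq P) g' ?x (pr_x z)"
          unfolding newton_rem_def by (rule component_le_norm_cart)
        moreover have "0 \<le> newton_rem (ineq P) g' ?x (pr_x z)" by (simp add: newton_rem_def)
        ultimately show "norm ((\<chi> i. pi_min (- (ineq P (pr_x z) $ i)) (pr_lam z $ i)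
           - (if - (ineq P (pr_x z) $ i) \<le> pr_lam z $ i then - (g' (pr_x z) (pr_x (z - zb)) $ i) else pr_lam (z - zb) $ i)) $ i)
           \<le> newton_rem (ineq P) g' ?x (pr_x z)"
          using elim[rule_format, of i] by (auto simp: pi_min_def min_def split: if_splits)
      qed
    qed
    show "(\<lambda>z. \<Sum>i\<in>(UNIV::'l set). newton_rem (ineq P) g' ?x (pr_x z)) \<in> O[nhds zb](\<omega>)"
      by (intro big_sum_in_bigo quadR[OF g])
  qed
  have eqn: "(\<lambda>z. norm (eqn P (pr_x z) - h' (pr_x z) (pr_x (z - zb)))) \<in> O[nhds zb](\<omega>)"
    using quadR[OF h] z0 by (simp add: newton_rem_def)
  have compl: "(\<lambda>z. norm (\<chi> i. phi (compl_arg P z i) - vector [Dphi1 (compl_arg P z i) \<bullet> coord (compl_dir z (z - zb) i),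
         Dphi2 (compl_arg P z i) \<bullet> coord (compl_dir z (z - zb) i)])) \<in> O[nhds zb](\<omega>)"
  proof (rule bigo_mono)
    let ?b = "\<lambda>z. newton_rem (cG P) G' ?x (pr_x z) + newton_rem (cH P) H' ?x (pr_x z)"
    show "(\<lambda>z. \<Sum>i\<in>(UNIV::'p set). 2 * ?b z) \<in> O[nhds zb](\<omega>)"
      by (intro big_sum_in_bigo landau_o.big.cmult_in_iff[THEN iffD2] sum_in_bigo quadR[OF G] quadR[OF H]) simp
    show "\<forall>\<^sub>F z in nhds zb. \<bar>norm (\<chi> i. phi (compl_arg P z i) - vector [Dphi1 (compl_arg P z i) \<bullet> coord (compl_dir z (z - zb) i),
         Dphi2 (compl_arg P z i) \<bullet> coord (compl_dir z (z - zb) i)])\<bar> \<le> (\<Sum>i\<in>(UNIV::'p set). 2 * ?b z)"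
      using eventually_active_compl[OF zero]
    proof eventually_elim
      case (elim z)
      show ?case unfolding abs_norm_cancel
      proof (rule order_trans[OF norm_vec_le_sum sum_mono])
        fix k
        let ?w = "compl_arg P z k" and ?v = "compl_arg P zb k" and ?d = "compl_dir z (z - zb) k"
        obtain i j s t where s: "\<bar>s\<bar> = 1" "\<bar>t\<bar> = 1" "Dphi1 ?w = axis i s" "Dphi2 ?w = axis j t"
          "phi1 ?w = Dphi1 ?w \<bullet> (coord ?w - coord ?v)" "phi2 ?w = Dphi2 ?w \<bullet> (coord ?w - coord ?v)"
          using elim unfolding exact_selection_def by blast
        have comp: "\<bar>(coord ?w - coord ?v - coord ?d) $ q\<bar> \<le> ?b z" for q
        proof -
          have r: "\<bar>(cG P (pr_x z) - cG P ?x - G' (pr_x z) (pr_x z - ?x)) $ k\<bar> \<le> newton_rem (cG P) G' ?x (pr_x z)"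
            "\<bar>(cH P (pr_x z) - cH P ?x - H' (pr_x z) (pr_x z - ?x)) $ k\<bar> \<le> newton_rem (cH P) H' ?x (pr_x z)"
            unfolding newton_rem_def by (rule component_le_norm_cart)+
          have p: "0 \<le> newton_rem (cG P) G' ?x (pr_x z)" "0 \<le> newton_rem (cH P) H' ?x (pr_x z)"
            by (simp_all add: newton_rem_def)
          have c: "(coord ?w - coord ?v - coord ?d) $ 1 = (cG P (pr_x z) - cG P ?x - G' (pr_x z) (pr_x z - ?x)) $ k"
            "(coord ?w - coord ?v - coord ?d) $ 2 = (cH P (pr_x z) - cH P ?x - H' (pr_x z) (pr_x z - ?x)) $ k"
            "(coord ?w - coord ?v - coord ?d) $ 3 = 0" "(coord ?w - coord ?v - coord ?d) $ 4 = 0"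
            by (simp_all add: compl_arg_eq compl_dir_def)
          consider "q = 1" | "q = 2" | "q = 3" | "q = 4" using exhaust_4 by blast
          then show ?thesis
          proof cases
            case 1 show ?thesis unfolding 1 c(1) using r(1) p(2) by linarith
          next
            case 2 show ?thesis unfolding 2 c(2) using r(2) p(1) by linarith
          next
            case 3 show ?thesis unfolding 3 c(3) using p by simp
          next
            case 4 show ?thesis unfolding 4 c(4) using p by simp
          qed
        qed
        have ax: "\<bar>axis q r \<bullet> (coord ?w - coord ?v) - axis q r \<bullet> coord ?d\<bar> \<le> ?b z" if "\<bar>r\<bar> = 1" for q r
        proof -
          have "axis q r \<bullet> (coord ?w - coord ?v) - axis q r \<bullet> coord ?d = r * (coord ?w - coord ?v - coord ?d) $ q"
            by (simp add: inner_axis' right_diff_distrib)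
          then show ?thesis using comp[of q] that by (simp only: abs_mult mult_1)
        qed
        have "norm ((phi ?w - vector [Dphi1 ?w \<bullet> coord ?d, Dphi2 ?w \<bullet> coord ?d]) :: real^2) \<le> ?b z + ?b z"
          using norm_le_l1_cart[of "phi ?w - vector [Dphi1 ?w \<bullet> coord ?d, Dphi2 ?w \<bullet> coord ?d]"]
            ax[OF s(1), of i] ax[OF s(2), of j]
          by (simp add: sum_2 phi_def s(5,6)) (simp add: s(3,4))
        then show "norm ((\<chi> i. phi (compl_arg P z i) - vector [Dphi1 (compl_arg P z i) \<bullet> coord (compl_dir z (z - zb) i),
         Dphi2 (compl_arg P z i) \<bullet> coord (compl_dir z (z - zb) i)]) $ k) \<le> 2 * ?b z" by simp
      qed
    qed
  qed
  show ?thesis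
  proof (rule bigo_mono[OF _ sum_in_bigo(1)[OF sum_in_bigo(1)[OF sum_in_bigo(1)[OF grad ineq] eqn] compl]])
    have vd: "(\<chi> i. a i) - (\<chi> i. b i) = (\<chi> i. a i - b i)" for a b :: "'y::finite \<Rightarrow> 'x::group_add"
      by (simp add: vec_eq_iff)
    show "\<forall>\<^sub>F z in nhds zb. \<bar>norm (F P z - DF P z (z - zb))\<bar> \<le> norm (gradL z - D_gradL z (z - zb)) + norm (\<chi> i. pi_min (- (ineq P (pr_x z) $ i)) (pr_lam z $ i)
       - (if - (ineq P (pr_x z) $ i) \<le> pr_lam z $ i then - (g' (pr_x z) (pr_x (z - zb)) $ i) else pr_lam (z - zb) $ i))
       + norm (eqn P (pr_x z) - h' (pr_x z) (pr_x (z - zb))) + norm (\<chi> i. phi (compl_arg P z i) - vector [Dphi1 (compl_arg P z i) \<bullet> coord (compl_dir z (z - zb) i),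
         Dphi2 (compl_arg P z i) \<bullet> coord (compl_dir z (z - zb) i)])"
      unfolding F_eq DF_eq diff_Pair vd abs_norm_cancel by (intro always_eventually allI norm_tuple_bounds(5))
  qed
qed

end

section \<open>Uniform invertibility of the Newton matrix\<close>

lemma coord_linear:
  "coord (a + a', b + b', c + c', d + d') = coord (a, b, c, d) + coord (a', b', c', d')"
  "coord (r * a, r * b, r * c, r * d) = r *\<^sub>R coord (a, b, c, d)"
  by (simp_all add: vec_eq_iff forall_4)

lemma abs_Dphi_inner_le: "\<bar>Dphi1 w \<bullet> v\<bar> \<le> norm v" "\<bar>Dphi2 w \<bullet> v\<bar> \<le> norm v"
proof -
  obtain i j s t where "\<bar>s\<bar> = 1" "\<bar>t\<bar> = 1" "Dphi1 w = axis i s" "Dphi2 w = axis j t"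
    by (rule phi_selection)
  then show "\<bar>Dphi1 w \<bullet> v\<bar> \<le> norm v" "\<bar>Dphi2 w \<bullet> v\<bar> \<le> norm v"
    by (simp_all add: inner_axis' abs_mult component_le_norm_cart)
qed

context smooth_mpcc
begin

lemma linear_DF: "linear (DF P z)"
proof -
  interpret adj: bounded_bilinear adj by (rule bounded_bilinear_adj)
  have v: "vector [a + b, c + d] = (vector [a, c] + vector [b, d] :: real^2)"
    "vector [r * a, r * c] = (r *\<^sub>R vector [a, c] :: real^2)" for a b c d r :: real
    by (simp_all add: vec_eq_iff forall_2)
  have c: "coord (compl_dir z (d + e) i) = coord (compl_dir z d i) + coord (compl_dir z e i)"
    "coord (compl_dir z (r *\<^sub>R d) i) = r *\<^sub>R coord (compl_dir z d i)" for d e i r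
    unfolding compl_dir_def coord_linear[symmetric] by (simp_all add: blinfun.bilinear_simps)
  show ?thesis
  proof (rule linearI)
    show "DF P z (d + e) = DF P z d + DF P z e" for d e
      unfolding DF_eq c by (simp add: D_gradL_def hessL_def adj.add_left adj.add_right blinfun.bilinear_simps
        inner_add_right v vec_eq_iff)
    show "DF P z (r *\<^sub>R d) = r *\<^sub>R DF P z d" for r d
      unfolding DF_eq c by (simp add: D_gradL_def hessL_def adj.scaleR_left adj.scaleR_right blinfun.bilinear_simps
        v vec_eq_iff scaleR_add_right)
  qed
qed

text \<open>
  All discontinuity of the Newton matrix lies in the selection of its rows; the blocks that are
  selected from involve only the continuous derivatives of the data.
\<close>

lemma tendsto_blocks:
  assumes z: "(zs \<longlongrightarrow> zb) \<F>" and d: "(ds \<longlongrightarrow> d) \<F>"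
  shows "((\<lambda>n. D_gradL (zs n) (ds n)) \<longlongrightarrow> D_gradL zb d) \<F>"
    and "((\<lambda>n. g' (pr_x (zs n)) (pr_x (ds n))) \<longlongrightarrow> g' (pr_x zb) (pr_x d)) \<F>"
    and "((\<lambda>n. h' (pr_x (zs n)) (pr_x (ds n))) \<longlongrightarrow> h' (pr_x zb) (pr_x d)) \<F>"
    and "((\<lambda>n. coord (compl_dir (zs n) (ds n) i) $ k) \<longlongrightarrow> coord (compl_dir zb d i) $ k) \<F>"
proof -
  interpret adj: bounded_bilinear adj by (rule bounded_bilinear_adj)
  have x: "((\<lambda>n. u (pr_x (zs n))) \<longlongrightarrow> u (pr_x zb)) \<F>" if "continuous_on UNIV u" for u :: "real^'n \<Rightarrow> 'x::topological_space"
    by (rule continuous_on_tendsto_compose[OF that]) (intro tendsto_intros z, auto)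
  note xs = continuous_data[THEN x]
  show "((\<lambda>n. D_gradL (zs n) (ds n)) \<longlongrightarrow> D_gradL zb d) \<F>"
    unfolding D_gradL_def hessL_def by (intro tendsto_intros adj.tendsto blinfun.tendsto xs z d)
  show "((\<lambda>n. g' (pr_x (zs n)) (pr_x (ds n))) \<longlongrightarrow> g' (pr_x zb) (pr_x d)) \<F>"
    "((\<lambda>n. h' (pr_x (zs n)) (pr_x (ds n))) \<longlongrightarrow> h' (pr_x zb) (pr_x d)) \<F>"
    by (intro tendsto_intros blinfun.tendsto xs z d)+
  have "((\<lambda>n. G' (pr_x (zs n)) (pr_x (ds n)) $ i) \<longlongrightarrow> G' (pr_x zb) (pr_x d) $ i) \<F>"
    "((\<lambda>n. H' (pr_x (zs n)) (pr_x (ds n)) $ i) \<longlongrightarrow> H' (pr_x zb) (pr_x d) $ i) \<F>"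
    "((\<lambda>n. pr_mu (ds n) $ i) \<longlongrightarrow> pr_mu d $ i) \<F>" "((\<lambda>n. pr_nu (ds n) $ i) \<longlongrightarrow> pr_nu d $ i) \<F>"
    by (intro tendsto_intros blinfun.tendsto xs z d)+
  moreover have "k = 1 \<or> k = 2 \<or> k = 3 \<or> k = 4" by (rule exhaust_4)
  ultimately show "((\<lambda>n. coord (compl_dir (zs n) (ds n) i) $ k) \<longlongrightarrow> coord (compl_dir zb d i) $ k) \<F>"
    by (auto simp: compl_dir_def)
qed

text \<open>
  The matrix itself may be discontinuous in \<open>z\<close>, but its entries are chosen from blocks that are
  locally bounded.
\<close>

lemma DF_tendsto_0:
  assumes z: "(zs \<longlongrightarrow> zb) \<F>" and d: "(ds \<longlongrightarrow> 0) \<F>"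
  shows "((\<lambda>n. DF P (zs n) (ds n)) \<longlongrightarrow> 0) \<F>"
proof -
  interpret adj: bounded_bilinear adj by (rule bounded_bilinear_adj)
  note lim = tendsto_blocks[OF z d]
  let ?c = "\<lambda>n i. coord (compl_dir (zs n) (ds n) i)"
  let ?b = "\<lambda>n. norm (D_gradL (zs n) (ds n)) + (\<Sum>i\<in>UNIV. \<bar>g' (pr_x (zs n)) (pr_x (ds n)) $ i\<bar> + \<bar>pr_lam (ds n) $ i\<bar>)
     + norm (h' (pr_x (zs n)) (pr_x (ds n))) + (\<Sum>i\<in>UNIV. 2 * (\<Sum>k\<in>UNIV. \<bar>?c n i $ k\<bar>))"
  have "norm (DF P (zs n) (ds n)) \<le> ?b n" for n
    unfolding DF_eq
  proof (intro order_trans[OF norm_tuple_bounds(5)] add_mono order_refl order_trans[OF norm_vec_le_sum sum_mono])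
    fix i
    show "norm ((\<chi> i. if - (ineq P (pr_x (zs n)) $ i) \<le> pr_lam (zs n) $ i then - (g' (pr_x (zs n)) (pr_x (ds n)) $ i)
       else pr_lam (ds n) $ i) $ i) \<le> \<bar>g' (pr_x (zs n)) (pr_x (ds n)) $ i\<bar> + \<bar>pr_lam (ds n) $ i\<bar>"
      by simp
  next
    fix i
    have 1: "norm (?c n i) \<le> (\<Sum>k\<in>UNIV. \<bar>?c n i $ k\<bar>)" by (rule norm_le_l1_cart)
    have 2: "norm (vector [a, b] :: real^2) \<le> \<bar>a\<bar> + \<bar>b\<bar>" for a b
      using norm_le_l1_cart[of "vector [a, b] :: real^2"] by (simp add: sum_2)
    have "norm (vector [Dphi1 (compl_arg P (zs n) i) \<bullet> ?c n i, Dphi2 (compl_arg P (zs n) i) \<bullet> ?c n i] :: real^2)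
        \<le> norm (?c n i) + norm (?c n i)"
      by (rule order_trans[OF 2 add_mono[OF abs_Dphi_inner_le]])
    also have "\<dots> \<le> 2 * (\<Sum>k\<in>UNIV. \<bar>?c n i $ k\<bar>)" using 1 by simp
    finally show "norm ((\<chi> i. vector [Dphi1 (compl_arg P (zs n) i) \<bullet> ?c n i, Dphi2 (compl_arg P (zs n) i) \<bullet> ?c n i] :: real^2^'p) $ i)
        \<le> 2 * (\<Sum>k\<in>UNIV. \<bar>?c n i $ k\<bar>)" by simp
  qed
  then have le: "\<forall>\<^sub>F n in \<F>. norm (DF P (zs n) (ds n)) \<le> ?b n"
    by (rule always_eventually[OF allI])
  have lim0: "(?b \<longlongrightarrow> 0) \<F>"
  proof (intro tendsto_add_zero tendsto_null_sum tendsto_mult_right_zero tendsto_rabs_zero tendsto_norm_zero)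
    show "((\<lambda>n. D_gradL (zs n) (ds n)) \<longlongrightarrow> 0) \<F>"
      using lim(1) by (simp add: D_gradL_def hessL_def adj.zero_left adj.zero_right blinfun.zero_right)
    show "((\<lambda>n. h' (pr_x (zs n)) (pr_x (ds n))) \<longlongrightarrow> 0) \<F>" using lim(3) by (simp add: blinfun.zero_right)
    fix i
    show "((\<lambda>n. g' (pr_x (zs n)) (pr_x (ds n)) $ i) \<longlongrightarrow> 0) \<F>"
      using tendsto_vec_nth[OF lim(2), of i] by (simp add: blinfun.zero_right)
    show "((\<lambda>n. pr_lam (ds n) $ i) \<longlongrightarrow> 0) \<F>"
      using tendsto_vec_nth[OF tendsto_fst[OF tendsto_snd[OF d]], of i] by simp
  next
    fix i k
    have "coord (compl_dir zb 0 i) $ k = 0"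
      using exhaust_4[of k] by (auto simp: compl_dir_def blinfun.zero_right)
    then show "((\<lambda>n. ?c n i $ k) \<longlongrightarrow> 0) \<F>" using lim(4)[of i k] by simp
  qed
  show ?thesis by (rule Lim_null_comparison[OF le lim0])
qed

text \<open>
  A substitute for the limit of the matrices \<open>DF (zs n)\<close>, which need not exist: the direction \<open>d\<close> is
  annihilated by a matrix whose rows follow, for every index, some selection that is used
  infinitely often, and this selection only involves terms that vanish at \<open>zb\<close>.
\<close>

lemma DF_limit_kernel:
  assumes zero: "F P zb = 0" and zs: "zs \<longlonglongrightarrow> zb" and ds: "ds \<longlonglongrightarrow> d"
    and lim: "(\<lambda>n. DF P (zs n) (ds n)) \<longlonglongrightarrow> 0"
  shows "D_gradL zb d = 0" and "h' (pr_x zb) (pr_x d) = 0"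
    and "(g' (pr_x zb) (pr_x d) $ j = 0 \<and> ineq P (pr_x zb) $ j = 0) \<or> (pr_lam d $ j = 0 \<and> pr_lam zb $ j = 0)"
    and "\<exists>(a, b)\<in>newton_pairs. coord (compl_arg P zb i) $ a = 0 \<and> coord (compl_arg P zb i) $ b = 0 \<and>
       coord (compl_dir zb d i) $ a = 0 \<and> coord (compl_dir zb d i) $ b = 0"
proof -
  note bl = tendsto_blocks[OF zs ds]
  let ?e = "\<lambda>n. norm (DF P (zs n) (ds n))"
  have e: "?e \<longlonglongrightarrow> 0" using lim by (rule tendsto_norm_zero)
  have comp: "norm (D_gradL (zs n) (ds n)) \<le> ?e n" "norm (h' (pr_x (zs n)) (pr_x (ds n))) \<le> ?e n"
    "\<bar>if - (ineq P (pr_x (zs n)) $ j) \<le> pr_lam (zs n) $ j then - (g' (pr_x (zs n)) (pr_x (ds n)) $ j) else pr_lam (ds n) $ j\<bar> \<le> ?e n"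
    "\<bar>Dphi1 (compl_arg P (zs n) i) \<bullet> coord (compl_dir (zs n) (ds n) i)\<bar> \<le> ?e n"
    "\<bar>Dphi2 (compl_arg P (zs n) i) \<bullet> coord (compl_dir (zs n) (ds n) i)\<bar> \<le> ?e n" for n
  proof -
    let ?A = "\<chi> i. if - (ineq P (pr_x (zs n)) $ i) \<le> pr_lam (zs n) $ i then - (g' (pr_x (zs n)) (pr_x (ds n)) $ i) else pr_lam (ds n) $ i"
    let ?B = "\<chi> i. vector [Dphi1 (compl_arg P (zs n) i) \<bullet> coord (compl_dir (zs n) (ds n) i),
      Dphi2 (compl_arg P (zs n) i) \<bullet> coord (compl_dir (zs n) (ds n) i)] :: real^2^'p"
    note t = norm_tuple_bounds(1-4)[where a = "D_gradL (zs n) (ds n)" and b = "?A" and c = "h' (pr_x (zs n)) (pr_x (ds n))" and d = "?B",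
        folded DF_eq]
    show "norm (D_gradL (zs n) (ds n)) \<le> ?e n" "norm (h' (pr_x (zs n)) (pr_x (ds n))) \<le> ?e n" by (rule t)+
    show "\<bar>if - (ineq P (pr_x (zs n)) $ j) \<le> pr_lam (zs n) $ j then - (g' (pr_x (zs n)) (pr_x (ds n)) $ j) else pr_lam (ds n) $ j\<bar> \<le> ?e n"
      using order_trans[OF component_le_norm_cart[of ?A j] t(2)] by simp
    have B: "norm (?B $ i) \<le> ?e n" by (rule order_trans[OF Finite_Cartesian_Product.norm_nth_le t(4)])
    show "\<bar>Dphi1 (compl_arg P (zs n) i) \<bullet> coord (compl_dir (zs n) (ds n) i)\<bar> \<le> ?e n"
      using order_trans[OF component_le_norm_cart[of "?B $ i" 1] B] by simp
    show "\<bar>Dphi2 (compl_arg P (zs n) i) \<bullet> coord (compl_dir (zs n) (ds n) i)\<bar> \<le> ?e n"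
      using order_trans[OF component_le_norm_cart[of "?B $ i" 2] B] by simp
  qed
  show "D_gradL zb d = 0"
    by (rule LIMSEQ_unique[OF bl(1)]) (rule Lim_null_comparison[OF _ e], use comp(1) in simp)
  show "h' (pr_x zb) (pr_x d) = 0"
    by (rule LIMSEQ_unique[OF bl(3)]) (rule Lim_null_comparison[OF _ e], use comp(2) in simp)
  have "\<forall>\<^sub>F n in sequentially. if - (ineq P (pr_x (zs n)) $ j) \<le> pr_lam (zs n) $ j then ineq P (pr_x zb) $ j = 0 else pr_lam zb $ j = 0"
    using eventually_compose_filterlim[OF eventually_active_ineq[OF zero] zs] by eventually_elim blast
  then have "\<forall>\<^sub>F n in sequentially. (\<bar>g' (pr_x (zs n)) (pr_x (ds n)) $ j\<bar> \<le> ?e n \<and> ineq P (pr_x zb) $ j = 0) \<or>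
      (\<bar>pr_lam (ds n) $ j\<bar> \<le> ?e n \<and> pr_lam zb $ j = 0)"
  proof eventually_elim
    case (elim n) then show ?case using comp(3)[of n] by (auto split: if_splits)
  qed
  then have "\<exists>\<^sub>F n in sequentially. (\<bar>g' (pr_x (zs n)) (pr_x (ds n)) $ j\<bar> \<le> ?e n \<and> ineq P (pr_x zb) $ j = 0) \<or>
      (\<bar>pr_lam (ds n) $ j\<bar> \<le> ?e n \<and> pr_lam zb $ j = 0)"
    by (rule eventually_frequently[rotated]) simp
  then have "((\<exists>\<^sub>F n in sequentially. \<bar>g' (pr_x (zs n)) (pr_x (ds n)) $ j\<bar> \<le> ?e n) \<and> ineq P (pr_x zb) $ j = 0) \<or>
      ((\<exists>\<^sub>F n in sequentially. \<bar>pr_lam (ds n) $ j\<bar> \<le> ?e n) \<and> pr_lam zb $ j = 0)"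
    by (simp add: frequently_disj_iff)
  then show "(g' (pr_x zb) (pr_x d) $ j = 0 \<and> ineq P (pr_x zb) $ j = 0) \<or> (pr_lam d $ j = 0 \<and> pr_lam zb $ j = 0)"
    using frequently_le_null_limit[OF tendsto_vec_nth[OF bl(2)] e]
      frequently_le_null_limit[OF tendsto_vec_nth[OF tendsto_fst[OF tendsto_snd[OF ds]]] e] by blast
  let ?Q = "\<lambda>n a b. coord (compl_arg P zb i) $ a = 0 \<and> coord (compl_arg P zb i) $ b = 0 \<and>
       \<bar>coord (compl_dir (zs n) (ds n) i) $ a\<bar> \<le> ?e n \<and> \<bar>coord (compl_dir (zs n) (ds n) i) $ b\<bar> \<le> ?e n"
  have "\<forall>\<^sub>F n in sequentially. \<exists>p\<in>newton_pairs. ?Q n (fst p) (snd p)"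
    using eventually_compose_filterlim[OF eventually_active_compl[OF zero] zs]
  proof eventually_elim
    case (elim n)
    then obtain a b s t where ab: "(a, b) \<in> newton_pairs" "coord (compl_arg P zb i) $ a = 0" "coord (compl_arg P zb i) $ b = 0"
      "\<bar>s\<bar> = 1" "\<bar>t\<bar> = 1" "Dphi1 (compl_arg P (zs n) i) = axis a s" "Dphi2 (compl_arg P (zs n) i) = axis b t"
      unfolding exact_selection_def by blast
    have "?Q n a b" using ab(2,3) comp(4,5)[of n] unfolding ab(6,7) using ab(4,5) by (simp add: inner_axis' abs_mult)
    then show ?case using ab(1) by force
  qed
  then have fr: "\<exists>\<^sub>F n in sequentially. \<exists>p\<in>newton_pairs. ?Q n (fst p) (snd p)"
    by (rule eventually_frequently[rotated]) simp
  have "finite newton_pairs" by (simp add: newton_pairs_def)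
  from frequently_bex_finite[OF this fr]
  obtain p where p: "p \<in> newton_pairs" "\<exists>\<^sub>F n in sequentially. ?Q n (fst p) (snd p)" by blast
  have Q: "coord (compl_arg P zb i) $ fst p = 0" "coord (compl_arg P zb i) $ snd p = 0"
    using frequently_ex[OF p(2)] by auto
  have "coord (compl_dir zb d i) $ fst p = 0" "coord (compl_dir zb d i) $ snd p = 0"
    by (rule frequently_le_null_limit[OF bl(4) e], rule frequently_elim1[OF p(2)], simp)+
  with Q p(1) show "\<exists>(a, b)\<in>newton_pairs. coord (compl_arg P zb i) $ a = 0 \<and> coord (compl_arg P zb i) $ b = 0 \<and>
       coord (compl_dir zb d i) $ a = 0 \<and> coord (compl_dir zb d i) $ b = 0"
    by (intro bexI[of _ p]) (auto simp: case_prod_beta)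
qed

text \<open>
  In each selection every product of a multiplier step with the directional derivative of its
  constraint is zero. Multiplying the first block by the primal part \<open>dx\<close> therefore leaves only the
  quadratic form of the Hessian; as \<open>dx\<close> lies in the set of directions of MPCC-SSOC, \<open>dx = 0\<close>. What remains
  of the first block is a linear combination of the rows in MPCC-LICQ, with the multiplier steps as
  coefficients, because the steps outside the active index sets vanish.
\<close>

lemma kernel_trivial:
  assumes M: "F P zb = 0" and licq: "MPCC_LICQ P (pr_x zb)" and ssoc: "MPCC_SSOC P (pr_x zb) (snd zb)"
    and grad: "D_gradL zb d = 0" and eqn: "h' (pr_x zb) (pr_x d) = 0"
    and ineq: "\<And>j. (g' (pr_x zb) (pr_x d) $ j = 0 \<and> ineq P (pr_x zb) $ j = 0) \<or> (pr_lam d $ j = 0 \<and> pr_lam zb $ j = 0)"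
    and compl: "\<And>i. \<exists>(a, b)\<in>newton_pairs. coord (compl_arg P zb i) $ a = 0 \<and> coord (compl_arg P zb i) $ b = 0 \<and>
       coord (compl_dir zb d i) $ a = 0 \<and> coord (compl_dir zb d i) $ b = 0"
  shows "d = 0"
proof -
  obtain x lam \<eta> \<mu> \<nu> where zb: "zb = (x, lam, \<eta>, \<mu>, \<nu>)" by (cases zb)
  obtain dx dlam d\<eta> d\<mu> d\<nu> where d: "d = (dx, dlam, d\<eta>, d\<mu>, d\<nu>)" by (cases d)
  have feas: "cG P x $ i \<ge> 0" "cH P x $ i \<ge> 0" for i
  proof -
    have "M_compl (compl_arg P zb i)" using M[unfolded F_eq_0_iff] by blast
    then show "cG P x $ i \<ge> 0" "cH P x $ i \<ge> 0" by (simp_all add: compl_arg_eq zb)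
  qed
  have ineq: "(g' x dx $ j = 0 \<and> ineq P x $ j = 0) \<or> (dlam $ j = 0 \<and> lam $ j = 0)" for j
    using ineq[of j] by (simp add: zb d)
  have compl: "(G' x dx $ i = 0 \<and> H' x dx $ i = 0 \<and> cG P x $ i = 0 \<and> cH P x $ i = 0) \<or>
      (G' x dx $ i = 0 \<and> d\<nu> $ i = 0 \<and> cG P x $ i = 0 \<and> \<nu> $ i = 0) \<or>
      (H' x dx $ i = 0 \<and> d\<mu> $ i = 0 \<and> cH P x $ i = 0 \<and> \<mu> $ i = 0)" for i
    using compl[of i] by (auto simp: newton_pairs_def compl_arg_eq compl_dir_def zb d)
  have dx: "dx = 0"
  proof (rule ccontr)
    assume nz: "dx \<noteq> 0"
    have "dx \<in> SSOC_directions P x lam \<mu> \<nu>"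
      unfolding SSOC_directions_def mem_Collect_eq jacobian_blinfun[OF derivs(2)] jacobian_blinfun[OF derivs(3)]
        jacobian_blinfun[OF derivs(4)] jacobian_blinfun[OF derivs(5)]
    proof (intro conjI ballI impI)
      show "h' x dx = 0" using eqn by (simp add: zb d)
      show "g' x dx $ i = 0" if "0 < lam $ i" for i using ineq[of i] that by auto
      show "G' x dx $ i = 0" if "i \<in> I0p P x \<union> I00_mu P x \<mu> \<nu>" for i
        using compl[of i] that by (auto simp: I0p_def I00_mu_def)
      show "H' x dx $ i = 0" if "i \<in> Ip0 P x \<union> I00_nu P x \<mu> \<nu>" for i
        using compl[of i] that by (auto simp: Ip0_def I00_nu_def)
      show "G' x dx $ i * H' x dx $ i = 0" for i using compl[of i] by auto
    qed
    then have "dx \<bullet> (hessian (lagrangian P (lam, \<eta>, \<mu>, \<nu>)) x *v dx) > 0"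
      using ssoc nz by (simp add: zb)
    then have pos: "dx \<bullet> hessL zb dx > 0"
      using hessian_lagrangian[of zb dx] by (simp add: zb)
    have "0 = dx \<bullet> D_gradL zb d" by (simp add: grad)
    also have "\<dots> = dx \<bullet> hessL zb dx + g' x dx \<bullet> dlam + h' x dx \<bullet> d\<eta> + G' x dx \<bullet> d\<mu> + H' x dx \<bullet> d\<nu>"
      by (simp add: D_gradL_def inner_add_right adj_inner zb d)
    also have "g' x dx \<bullet> dlam = 0"
      unfolding inner_vec_def by (rule sum.neutral) (use ineq in auto)
    also have "h' x dx \<bullet> d\<eta> = 0" using eqn by (simp add: zb d)
    also have "G' x dx \<bullet> d\<mu> = 0"
      unfolding inner_vec_def by (rule sum.neutral) (use compl in auto)
    also have "H' x dx \<bullet> d\<nu> = 0"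
      unfolding inner_vec_def by (rule sum.neutral) (use compl in auto)
    finally show False using pos by simp
  qed
  let ?V = "constraint_jacobian P x"
  let ?A = "Ig P x" and ?B = "I0p P x \<union> I00 P x" and ?C = "Ip0 P x \<union> I00 P x"
  let ?I = "?A <+> (UNIV :: 'm set) <+> ?B <+> ?C"
  \<comment> \<open>The multiplier steps as coefficients of the rows of the stacked Jacobian.\<close>
  define c where "c = (\<lambda>k. case k of Inl i \<Rightarrow> dlam $ i | Inr (Inl i) \<Rightarrow> d\<eta> $ i
     | Inr (Inr (Inl i)) \<Rightarrow> d\<mu> $ i | Inr (Inr (Inr i)) \<Rightarrow> d\<nu> $ i)"
  have row_inner: "row (Inl i) ?V \<bullet> v = g' x v $ i" "row (Inr (Inl j)) ?V \<bullet> v = h' x v $ j"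
    "row (Inr (Inr (Inl k))) ?V \<bullet> v = G' x v $ k" "row (Inr (Inr (Inr k))) ?V \<bullet> v = H' x v $ k" for i j k v
    by (simp_all add: row_def constraint_jacobian_def vec_lambda_eta jacobian_blinfun(2)[OF derivs(2)] jacobian_blinfun(2)[OF derivs(3)]
        jacobian_blinfun(2)[OF derivs(4)] jacobian_blinfun(2)[OF derivs(5)])
  have out: "dlam $ i = 0" if "i \<notin> ?A" for i using ineq[of i] that by (auto simp: Ig_def)
  have outB: "d\<mu> $ i = 0" if "i \<notin> ?B" for i
    using compl[of i] feas[of i] that by (auto simp: I0p_def I00_def order_le_less)
  have outC: "d\<nu> $ i = 0" if "i \<notin> ?C" for i
    using compl[of i] feas[of i] that by (auto simp: Ip0_def I00_def order_le_less)
  have "(\<Sum>k\<in>?I. c k *\<^sub>R row k ?V) \<bullet> v = 0" for v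
  proof -
    have "(\<Sum>k\<in>?I. c k *\<^sub>R row k ?V) \<bullet> v = (\<Sum>k\<in>?I. c k * (row k ?V \<bullet> v))"
      by (simp add: inner_sum_left)
    also have "\<dots> = (\<Sum>i\<in>?A. dlam $ i * g' x v $ i) + ((\<Sum>i\<in>UNIV. d\<eta> $ i * h' x v $ i)
        + ((\<Sum>i\<in>?B. d\<mu> $ i * G' x v $ i) + (\<Sum>i\<in>?C. d\<nu> $ i * H' x v $ i)))"
      by (simp add: sum.Plus row_inner c_def)
    also have "(\<Sum>i\<in>?A. dlam $ i * g' x v $ i) = (\<Sum>i\<in>UNIV. dlam $ i * g' x v $ i)"
      by (rule sum.mono_neutral_left) (use out in auto)
    also have "(\<Sum>i\<in>?B. d\<mu> $ i * G' x v $ i) = (\<Sum>i\<in>UNIV. d\<mu> $ i * G' x v $ i)"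
      by (rule sum.mono_neutral_left) (use outB in auto)
    also have "(\<Sum>i\<in>?C. d\<nu> $ i * H' x v $ i) = (\<Sum>i\<in>UNIV. d\<nu> $ i * H' x v $ i)"
      by (rule sum.mono_neutral_left) (use outC in auto)
    also have "(\<Sum>i\<in>UNIV. dlam $ i * g' x v $ i) + ((\<Sum>i\<in>UNIV. d\<eta> $ i * h' x v $ i)
        + ((\<Sum>i\<in>UNIV. d\<mu> $ i * G' x v $ i) + (\<Sum>i\<in>UNIV. d\<nu> $ i * H' x v $ i)))
      = v \<bullet> (hessL zb dx + adj (g' x) dlam + adj (h' x) d\<eta> + adj (G' x) d\<mu> + adj (H' x) d\<nu>)"
    proof -
      have "hessL zb dx = 0"
        by (simp add: dx hessL_def blinfun.zero_right bounded_bilinear.zero_left[OF bounded_bilinear_adj])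
      then show ?thesis
        by (simp only: inner_add_right adj_inner inner_zero_right) (simp add: inner_vec_def mult.commute)
    qed
    also have "\<dots> = v \<bullet> D_gradL zb d" by (simp add: D_gradL_def zb d)
    finally show ?thesis by (simp add: grad)
  qed
  from this[of "\<Sum>k\<in>?I. c k *\<^sub>R row k ?V"]
  have sum0: "(\<Sum>k\<in>?I. c k *\<^sub>R row k ?V) = 0" by (simp only: inner_eq_zero_iff)
  have rank: "full_row_rank_on ?I ?V" using licq by (simp add: MPCC_LICQ_def zb)
  have c0: "c k = 0" if "k \<in> ?I" for k
    by (rule full_row_rank_on_coeff[OF rank sum0 that])
  have "dlam $ i = 0" for i
    by (cases "i \<in> ?A") (use c0[of "Inl i"] out in \<open>auto simp: c_def\<close>)
  moreover have "d\<eta> $ i = 0" for i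
    using c0[of "Inr (Inl i)"] by (auto simp: c_def)
  moreover have "d\<mu> $ i = 0" for i
    by (cases "i \<in> ?B") (use c0[of "Inr (Inr (Inl i))"] outB in \<open>auto simp: c_def\<close>)
  moreover have "d\<nu> $ i = 0" for i
    by (cases "i \<in> ?C") (use c0[of "Inr (Inr (Inr i))"] outC in \<open>auto simp: c_def\<close>)
  ultimately show ?thesis using dx by (simp add: d zero_prod_def vec_eq_iff)
qed

text \<open>
  Unit directions on which the matrices near \<open>zb\<close> become arbitrarily small would accumulate, by
  compactness of the sphere, at a nonzero direction in the kernel just excluded.
\<close>

lemma DF_lower_bound:
  assumes M: "F P zb = 0" and licq: "MPCC_LICQ P (pr_x zb)" and ssoc: "MPCC_SSOC P (pr_x zb) (snd zb)"
  shows "\<exists>c>0. \<forall>\<^sub>F z in nhds zb. \<forall>d. c * norm d \<le> norm (DF P z d)"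
proof (rule ccontr)
  assume neg: "\<not> ?thesis"
  have "\<exists>z d. dist z zb < 1 / real (Suc n) \<and> norm d = 1 \<and> norm (DF P z d) \<le> 1 / real (Suc n)" for n
  proof -
    define c where "c = 1 / real (Suc n)"
    have c: "c > 0" by (simp add: c_def)
    with neg have "\<not> (\<forall>\<^sub>F z in nhds zb. \<forall>d. c * norm d \<le> norm (DF P z d))" by blast
    with c obtain z d where zd: "dist z zb < c" "norm (DF P z d) < c * norm d"
      unfolding eventually_nhds_metric by (meson not_le)
    have d: "norm d > 0" using zd(2) by (cases "d = 0") (auto simp: linear_0[OF linear_DF])
    have "DF P z ((1 / norm d) *\<^sub>R d) = (1 / norm d) *\<^sub>R DF P z d" by (rule linear_scale[OF linear_DF])
    then have "norm (DF P z ((1 / norm d) *\<^sub>R d)) \<le> c"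
      using zd(2) d by (simp add: divide_simps)
    then show ?thesis unfolding c_def[symmetric] using zd(1) d by (intro exI[of _ z] exI[of _ "(1 / norm d) *\<^sub>R d"]) simp
  qed
  then obtain zs ds where zds: "\<And>n. dist (zs n) zb < 1 / real (Suc n)" "\<And>n. norm (ds n) = 1"
    "\<And>n. norm (DF P (zs n) (ds n)) \<le> 1 / real (Suc n)" by metis
  have null: "(\<lambda>n. 1 / real (Suc n)) \<longlonglongrightarrow> 0" using LIMSEQ_inverse_real_of_nat by (simp add: inverse_eq_divide)
  have "compact (sphere (0::('n, 'l, 'm, 'p) primal_dual) 1)" by (rule compact_sphere)
  then obtain d r where dr: "d \<in> sphere 0 1" "strict_mono r" "(ds \<circ> r) \<longlonglongrightarrow> d"
    using zds(2) unfolding compact_def by (metis mem_sphere_0)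
  have nullr: "(\<lambda>n. 1 / real (Suc (r n))) \<longlonglongrightarrow> 0"
    using LIMSEQ_subseq_LIMSEQ[OF null dr(2)] by (simp add: o_def)
  have zr: "(\<lambda>n. zs (r n)) \<longlonglongrightarrow> zb"
  proof (rule tendstoI)
    fix e :: real assume "e > 0"
    then have "\<forall>\<^sub>F n in sequentially. 1 / real (Suc (r n)) < e" by (rule order_tendstoD(2)[OF nullr])
    then show "\<forall>\<^sub>F n in sequentially. dist (zs (r n)) zb < e"
      by eventually_elim (use zds(1) in \<open>meson order_less_trans\<close>)
  qed
  have dlim: "(\<lambda>n. ds (r n)) \<longlonglongrightarrow> d" using dr(3) by (simp add: o_def)
  have "\<forall>\<^sub>F n in sequentially. norm (DF P (zs (r n)) (ds (r n))) \<le> 1 / real (Suc (r n))"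
    using zds(3) by simp
  then have DFlim: "(\<lambda>n. DF P (zs (r n)) (ds (r n))) \<longlonglongrightarrow> 0"
    by (rule Lim_null_comparison[OF _ nullr])
  have "d = 0"
    using DF_limit_kernel[OF M zr dlim DFlim] by (intro kernel_trivial[OF M licq ssoc]) auto
  then show False using dr(1) by simp
qed

end

section \<open>The Newton step near a regular solution\<close>

text \<open>
  The Newton system is square, but its domain and codomain are different product types.
\<close>

lemma linear_inj_imp_surj_DIM:
  fixes L :: "'a::euclidean_space \<Rightarrow> 'b::euclidean_space"
  assumes "linear L" "inj L" "DIM('a) = DIM('b)"
  shows "surj L"
proof -
  have "independent (L ` Basis)"
    by (rule linear_independent_injective_image[OF assms(1) independent_Basis]) (use assms(2) in \<open>auto intro: inj_on_subset\<close>)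
  moreover have "card (L ` Basis) = DIM('b)"
    using assms(2,3) by (simp add: card_image inj_on_subset[OF assms(2)])
  ultimately have "UNIV \<subseteq> span (L ` Basis)"
    by (intro card_ge_dim_independent) (auto simp: dim_UNIV)
  also have "\<dots> = L ` span Basis" by (rule linear_span_image[OF assms(1)])
  finally show ?thesis by auto
qed

lemma cont_diff_minimum:
  fixes f :: "'a::euclidean_space \<Rightarrow> real"
  assumes "cont_diff f" "\<And>y. f x \<le> f y" shows "grad f x = 0"
proof -
  have "(\<lambda>h. h \<bullet> grad f x) = (\<lambda>h. 0)"
    by (rule has_derivative_local_min[of f _ x]) (use GDERIV_grad[OF assms(1), of x] assms(2) in \<open>auto simp: gderiv_def\<close>)
  then have "grad f x \<bullet> grad f x = 0" by meson
  then show ?thesis by simp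
qed

context smooth_mpcc
begin

lemma Phi_FB_nonneg: "0 \<le> Phi_FB P z"
  by (simp add: Phi_FB_def)

lemma continuous_Phi_FB: "isCont (Phi_FB P) z"
  using cont_diff_imp_continuous[OF cont_diff_Phi_FB]
  unfolding continuous_on_eq_continuous_at[OF open_UNIV] by blast

text \<open>
  The constants here and below are \<open>22\<^sup>2 / 2\<close> and \<open>2 * 8\<^sup>2\<close>.
\<close>

lemma Phi_FB_le_F: "Phi_FB P z \<le> 242 * (norm (F P z))\<^sup>2"
  using power_mono[OF norm_F_FB_le[of z] norm_ge_zero, of 2] by (simp add: Phi_FB_def power_mult_distrib)

lemma F_le_Phi_FB: "(norm (F P z))\<^sup>2 \<le> 128 * Phi_FB P z"
  using power_mono[OF norm_F_le[of z] norm_ge_zero, of 2] by (simp add: Phi_FB_def power_mult_distrib)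

text \<open>
  The lower bound makes the matrix injective, and both sides have dimension \<open>n + l + m + 2p\<close>.
\<close>

lemma DF_solvable:
  assumes "0 < c" "\<And>d. c * norm d \<le> norm (DF P z d)"
  shows "\<exists>d. DF P z d = y"
proof -
  have "inj (DF P z)"
    unfolding linear_injective_0[OF linear_DF]
  proof (intro allI impI)
    fix d assume "DF P z d = 0"
    then have "c * norm d \<le> 0" using assms(2)[of d] by simp
    then show "d = 0" using assms(1) by (simp add: mult_le_0_iff)
  qed
  then have "surj (DF P z)"
    by (rule linear_inj_imp_surj_DIM[OF linear_DF]) simp
  then show ?thesis by (metis surjD)
qed

lemma F_bigo:
  assumes zero: "F P zb = 0"
  shows "(\<lambda>z. norm (F P z)) \<in> O[nhds zb](\<lambda>z. norm (z - zb))"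
proof -
  note z0 = zero[unfolded F_eq_0_iff]
  obtain D where "(gradL has_derivative blinfun_apply D) (at zb)" using cont_diff_gradL unfolding cont_diff_def by blast
  from has_derivative_bigo_lipschitz[OF this] z0
  have grad: "(\<lambda>z. norm (gradL z)) \<in> O[nhds zb](\<lambda>z. norm (z - zb))" by simp
  have eqn: "(\<lambda>z. norm (eqn P (pr_x z))) \<in> O[nhds zb](\<lambda>z. norm (z - zb))"
    using primal_lipschitz_bigo[OF derivs(3), of zb] z0 by simp
  have ineq: "(\<lambda>z. norm (\<chi> i. pi_min (- (ineq P (pr_x z) $ i)) (pr_lam z $ i))) \<in> O[nhds zb](\<lambda>z. norm (z - zb))"
  proof (rule bigo_mono)
    let ?b = "\<lambda>z. \<Sum>i\<in>(UNIV::'l set). norm (ineq P (pr_x z) - ineq P (pr_x zb)) + norm (z - zb)"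
    show "?b \<in> O[nhds zb](\<lambda>z. norm (z - zb))"
      by (intro big_sum_in_bigo sum_in_bigo primal_lipschitz_bigo[OF derivs(2)]) simp
    have "norm (\<chi> i. pi_min (- (ineq P (pr_x z) $ i)) (pr_lam z $ i)) \<le> ?b z" for z
    proof (rule order_trans[OF norm_vec_le_sum sum_mono])
      fix i
      have m: "min (- (ineq P (pr_x zb) $ i)) (pr_lam zb $ i) = 0" using z0 by blast
      have g: "\<bar>ineq P (pr_x z) $ i - ineq P (pr_x zb) $ i\<bar> \<le> norm (ineq P (pr_x z) - ineq P (pr_x zb))"
        using component_le_norm_cart[of "ineq P (pr_x z) - ineq P (pr_x zb)" i] by simp
      have l: "\<bar>pr_lam z $ i - pr_lam zb $ i\<bar> \<le> norm (z - zb)"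
        using order_trans[OF component_le_norm_cart[of "pr_lam (z - zb)" i] norm_pr_le(4)] by simp
      show "norm ((\<chi> i. pi_min (- (ineq P (pr_x z) $ i)) (pr_lam z $ i)) $ i)
          \<le> norm (ineq P (pr_x z) - ineq P (pr_x zb)) + norm (z - zb)"
        using m g l unfolding pi_min_def vec_lambda_beta real_norm_def by linarith
    qed
    then show "\<forall>\<^sub>F z in nhds zb. \<bar>norm (\<chi> i. pi_min (- (ineq P (pr_x z) $ i)) (pr_lam z $ i))\<bar> \<le> ?b z" by simp
  qed
  have compl: "(\<lambda>z. norm (\<chi> i. phi (compl_arg P z i))) \<in> O[nhds zb](\<lambda>z. norm (z - zb))"
  proof (rule bigo_mono)
    let ?b = "\<lambda>z. \<Sum>i\<in>UNIV. 2 * norm (coord (compl_arg P z i) - coord (compl_arg P zb i))"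
    show "?b \<in> O[nhds zb](\<lambda>z. norm (z - zb))"
      by (intro big_sum_in_bigo landau_o.big.cmult_in_iff[THEN iffD2] compl_arg_bigo) simp
    have "norm (\<chi> i. phi (compl_arg P z i)) \<le> ?b z" for z
    proof (rule order_trans[OF norm_vec_le_sum sum_mono])
      fix i
      have "phi1 (compl_arg P zb i) = 0" using z0 by (simp add: phi1_eq_0_iff)
      then show "norm ((\<chi> i. phi (compl_arg P z i)) $ i) \<le> 2 * norm (coord (compl_arg P z i) - coord (compl_arg P zb i))"
        using norm_phi_le[of "compl_arg P z i"] phi1_lipschitz[of "compl_arg P z i" "compl_arg P zb i"] by simp
    qed
    then show "\<forall>\<^sub>F z in nhds zb. \<bar>norm (\<chi> i. phi (compl_arg P z i))\<bar> \<le> ?b z" by simp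
  qed
  show ?thesis
  proof (rule bigo_mono[OF _ sum_in_bigo(1)[OF sum_in_bigo(1)[OF sum_in_bigo(1)[OF grad ineq] eqn] compl]])
    show "\<forall>\<^sub>F z in nhds zb. \<bar>norm (F P z)\<bar> \<le> norm (gradL z) + norm (\<chi> i. pi_min (- (ineq P (pr_x z) $ i)) (pr_lam z $ i))
       + norm (eqn P (pr_x z)) + norm (\<chi> i. phi (compl_arg P z i))"
      unfolding F_eq abs_norm_cancel by (intro always_eventually allI norm_tuple_bounds(5))
  qed
qed

text \<open>
  The new error satisfies \<open>DF(z)(z + d - zb) = DF(z)(z - zb) - F(z)\<close>, which is the linearization
  error up to sign; the uniform lower bound inverts the matrix.
\<close>

lemma newton_estimate:
  assumes zero: "F P zb = 0" and licq: "MPCC_LICQ P (pr_x zb)" and ssoc: "MPCC_SSOC P (pr_x zb) (snd zb)"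
    and quad: "(\<lambda>z. (norm (z - zb))\<^sup>2) \<in> O[nhds zb](\<omega>)"
    and rem: "(\<lambda>z. newton_rem f' f'' (pr_x zb) (pr_x z)) \<in> O[nhds zb](\<omega>)"
      "(\<lambda>z. newton_rem g' g'' (pr_x zb) (pr_x z)) \<in> O[nhds zb](\<omega>)"
      "(\<lambda>z. newton_rem h' h'' (pr_x zb) (pr_x z)) \<in> O[nhds zb](\<omega>)"
      "(\<lambda>z. newton_rem G' G'' (pr_x zb) (pr_x z)) \<in> O[nhds zb](\<omega>)"
      "(\<lambda>z. newton_rem H' H'' (pr_x zb) (pr_x z)) \<in> O[nhds zb](\<omega>)"
  shows "\<exists>C>0. \<forall>\<^sub>F z in nhds zb. \<forall>d. DF P z d = - F P z \<longrightarrow> norm (z + d - zb) \<le> C * \<bar>\<omega> z\<bar>"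
proof -
  obtain c where c: "c > 0" "\<forall>\<^sub>F z in nhds zb. \<forall>d. c * norm d \<le> norm (DF P z d)"
    using DF_lower_bound[OF zero licq ssoc] by blast
  obtain C where C: "C > 0" "\<forall>\<^sub>F z in nhds zb. norm (norm (F P z - DF P z (z - zb))) \<le> C * norm (\<omega> z)"
    by (rule landau_o.bigE[OF F_remainder[OF zero quad rem]])
  have "\<forall>\<^sub>F z in nhds zb. \<forall>d. DF P z d = - F P z \<longrightarrow> norm (z + d - zb) \<le> (C / c) * \<bar>\<omega> z\<bar>"
    using c(2) C(2)
  proof eventually_elim
    case (elim z)
    show ?case
    proof (intro allI impI)
      fix d assume d: "DF P z d = - F P z"
      have "DF P z (z + d - zb) = DF P z (z - zb) + DF P z d"
        using linear_add[OF linear_DF, of z "z - zb" d] by (simp add: algebra_simps)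
      then have "norm (DF P z (z + d - zb)) = norm (F P z - DF P z (z - zb))"
        by (simp add: d norm_minus_commute)
      then have "c * norm (z + d - zb) \<le> C * \<bar>\<omega> z\<bar>" using elim(1)[rule_format, of "z + d - zb"] elim(2) by simp
      then show "norm (z + d - zb) \<le> (C / c) * \<bar>\<omega> z\<bar>" using c(1) by (simp add: field_simps)
    qed
  qed
  then show ?thesis using c(1) C(1) by (intro exI[of _ "C / c"]) simp
qed

lemma primal_newton_rem_smallo:
  assumes "\<And>x. (u has_derivative blinfun_apply (u' x)) (at x)" "continuous_on UNIV u'"
  shows "(\<lambda>z::('n, 'l, 'm, 'p) primal_dual. newton_rem u u' (pr_x zb) (pr_x z)) \<in> o[nhds zb](\<lambda>z. norm (z - zb))"
proof (rule landau_o.small_big_trans[OF landau_o.small.compose[OF newton_rem_smallo[OF assms]]])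
  show "filterlim pr_x (nhds (pr_x zb)) (nhds zb)" by (intro tendsto_fst filterlim_ident)
  show "(\<lambda>z. norm (pr_x z - pr_x zb)) \<in> O[nhds zb](\<lambda>z. norm (z - zb))"
  proof (rule bigoI[where c = 1], intro always_eventually allI)
    fix z
    show "norm (norm (pr_x z - pr_x zb)) \<le> 1 * norm (norm (z - zb))"
      using norm_pr_le(1)[of "z - zb"] by simp
  qed
qed

text \<open>
  The modulus is the sum of all errors of the first derivatives and of the squared distance, each
  of which is \<open>o(\<parallel>z - zb\<parallel>)\<close>.
\<close>

lemma newton_superlinear:
  assumes zero: "F P zb = 0" and licq: "MPCC_LICQ P (pr_x zb)" and ssoc: "MPCC_SSOC P (pr_x zb) (snd zb)" and "\<epsilon> > 0"
  shows "\<forall>\<^sub>F z in nhds zb. \<forall>d. DF P z d = - F P z \<longrightarrow> norm (z + d - zb) \<le> \<epsilon> * norm (z - zb)"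
proof -
  let ?x = "pr_x zb"
  define \<omega> where "\<omega> z = (norm (z - zb))\<^sup>2 + newton_rem f' f'' ?x (pr_x z) + newton_rem g' g'' ?x (pr_x z)
    + newton_rem h' h'' ?x (pr_x z) + newton_rem G' G'' ?x (pr_x z) + newton_rem H' H'' ?x (pr_x z)" for z
  have nn: "0 \<le> newton_rem u u' x y" for u :: "real^'n \<Rightarrow> 'x::real_normed_vector" and u' x y
    by (simp add: newton_rem_def)
  have dom: "a \<in> O[nhds zb](\<omega>)" if "\<And>z. 0 \<le> a z" "\<And>z. a z \<le> \<omega> z" for a
    by (rule bigoI[where c = 1], intro always_eventually allI) (use that in \<open>smt (verit) real_norm_def\<close>)
  have "\<exists>C>0. \<forall>\<^sub>F z in nhds zb. \<forall>d. DF P z d = - F P z \<longrightarrow> norm (z + d - zb) \<le> C * \<bar>\<omega> z\<bar>"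
    by (intro newton_estimate[OF zero licq ssoc] dom) (simp_all add: \<omega>_def nn add_nonneg_nonneg)
  then obtain C where C: "C > 0" "\<forall>\<^sub>F z in nhds zb. \<forall>d. DF P z d = - F P z \<longrightarrow> norm (z + d - zb) \<le> C * \<bar>\<omega> z\<bar>"
    by blast
  have "(\<lambda>z. (norm (z - zb))\<^sup>2) \<in> o[nhds zb](\<lambda>z. norm (z - zb))"
  proof (rule landau_o.smallI)
    fix c :: real assume "c > 0"
    then show "\<forall>\<^sub>F z in nhds zb. norm ((norm (z - zb))\<^sup>2) \<le> c * norm (norm (z - zb))"
      unfolding eventually_nhds_metric
      by (intro exI[of _ c]) (auto simp: dist_norm power2_eq_square intro: mult_right_mono)
  qed
  then have "\<omega> \<in> o[nhds zb](\<lambda>z. norm (z - zb))"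
    unfolding \<omega>_def[abs_def] by (intro sum_in_smallo primal_newton_rem_smallo derivs' continuous_data)
  from landau_o.smallD[OF this, of "\<epsilon> / C"] \<open>\<epsilon> > 0\<close> C(1)
  have "\<forall>\<^sub>F z in nhds zb. \<bar>\<omega> z\<bar> \<le> \<epsilon> / C * norm (z - zb)" by simp
  with C(2) show ?thesis
  proof eventually_elim
    case (elim z)
    have "C * \<bar>\<omega> z\<bar> \<le> \<epsilon> * norm (z - zb)"
      using mult_left_mono[OF elim(2), of C] C(1) by simp
    then show ?case using elim(1) by force
  qed
qed

text \<open>
  For the lower bound: the Newton step halves the distance to \<open>zb\<close>, so
  its length is at least half of that distance, and it is at most \<open>\<parallel>F(z)\<parallel> / c\<close>.
\<close>

lemma Phi_FB_quadratic_growth: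
  assumes zero: "F P zb = 0" and licq: "MPCC_LICQ P (pr_x zb)" and ssoc: "MPCC_SSOC P (pr_x zb) (snd zb)"
  obtains A B where "A > 0" "B > 0"
    "\<forall>\<^sub>F z in nhds zb. B * (norm (z - zb))\<^sup>2 \<le> Phi_FB P z \<and> Phi_FB P z \<le> A * (norm (z - zb))\<^sup>2"
proof -
  obtain A where A: "A > 0" "\<forall>\<^sub>F z in nhds zb. norm (norm (F P z)) \<le> A * norm (norm (z - zb))"
    by (rule landau_o.bigE[OF F_bigo[OF zero]])
  obtain c where c: "c > 0" "\<forall>\<^sub>F z in nhds zb. \<forall>d. c * norm d \<le> norm (DF P z d)"
    using DF_lower_bound[OF zero licq ssoc] by blast
  have half: "\<forall>\<^sub>F z in nhds zb. \<forall>d. DF P z d = - F P z \<longrightarrow> norm (z + d - zb) \<le> (1 / 2) * norm (z - zb)"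
    by (rule newton_superlinear[OF zero licq ssoc]) simp
  let ?B = "(c / 2)\<^sup>2 / 128"
  have "\<forall>\<^sub>F z in nhds zb. ?B * (norm (z - zb))\<^sup>2 \<le> Phi_FB P z \<and> Phi_FB P z \<le> (242 * A\<^sup>2) * (norm (z - zb))\<^sup>2"
    using A(2) c(2) half
  proof eventually_elim
    case (elim z)
    obtain d where d: "DF P z d = - F P z" using DF_solvable[OF c(1)] elim(2) by metis
    have "norm (z - zb) \<le> norm (z + d - zb) + norm d"
      using norm_triangle_ineq4[of "z + d - zb" d] by simp
    then have "norm (z - zb) \<le> 2 * norm d" using elim(3)[rule_format, OF d] by linarith
    then have "(c / 2) * norm (z - zb) \<le> c * norm d" using c(1) by simp
    also have "\<dots> \<le> norm (F P z)" using elim(2)[rule_format, of d] d by simp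
    finally have "((c / 2) * norm (z - zb))\<^sup>2 \<le> (norm (F P z))\<^sup>2"
      using c(1) by (intro power_mono) auto
    then have 1: "?B * (norm (z - zb))\<^sup>2 \<le> Phi_FB P z"
      using F_le_Phi_FB[of z] by (simp add: power_mult_distrib power_divide)
    have "(norm (F P z))\<^sup>2 \<le> (A * norm (z - zb))\<^sup>2" using elim(1) by (intro power_mono) auto
    then have "Phi_FB P z \<le> (242 * A\<^sup>2) * (norm (z - zb))\<^sup>2"
      using Phi_FB_le_F[of z] by (simp add: power_mult_distrib)
    with 1 show ?case by simp
  qed
  then show thesis using that[of "242 * A\<^sup>2" ?B] A(1) c(1) by simp
qed

text \<open>
  By the quadratic growth, multiplying the distance by at most \<open>\<epsilon>\<close> multiplies \<open>Phi_FB\<close> by at most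
  \<open>A \<epsilon>\<^sup>2 / B\<close>, which is at most \<open>q\<close> for small \<open>\<epsilon>\<close>. The system is uniquely solvable, so this applies to every outcome \<open>N\<close>.
\<close>

lemma newton_step_accepted:
  assumes zero: "F P zb = 0" and licq: "MPCC_LICQ P (pr_x zb)" and ssoc: "MPCC_SSOC P (pr_x zb) (snd zb)" and q: "q > 0"
  shows "\<forall>\<^sub>F z in nhds zb. \<forall>N. z \<noteq> zb \<longrightarrow> newton_step P z N \<longrightarrow>
     ratio_test P q z N \<and> norm (z + the N - zb) \<le> (1 / 2) * norm (z - zb)"
proof -
  obtain c where c: "c > 0" "\<forall>\<^sub>F z in nhds zb. \<forall>d. c * norm d \<le> norm (DF P z d)"
    using DF_lower_bound[OF zero licq ssoc] by blast
  obtain A B where AB: "A > 0" "B > 0"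
    "\<forall>\<^sub>F z in nhds zb. B * (norm (z - zb))\<^sup>2 \<le> Phi_FB P z \<and> Phi_FB P z \<le> A * (norm (z - zb))\<^sup>2"
    by (rule Phi_FB_quadratic_growth[OF zero licq ssoc])
  then obtain \<delta> where \<delta>: "\<delta> > 0" "\<And>z. dist z zb < \<delta> \<Longrightarrow> B * (norm (z - zb))\<^sup>2 \<le> Phi_FB P z"
    "\<And>z. dist z zb < \<delta> \<Longrightarrow> Phi_FB P z \<le> A * (norm (z - zb))\<^sup>2"
    unfolding eventually_nhds_metric by blast
  have near: "\<forall>\<^sub>F z in nhds zb. dist z zb < \<delta>" unfolding eventually_nhds_metric using \<delta>(1) by blast
  define \<epsilon> where "\<epsilon> = min (1 / 2) (sqrt (q * B / A))"
  have \<epsilon>: "0 < \<epsilon>" "\<epsilon> \<le> 1 / 2" "A * \<epsilon>\<^sup>2 \<le> q * B"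
  proof -
    have pos: "0 < q * B / A" using q AB by simp
    then show "0 < \<epsilon>" "\<epsilon> \<le> 1 / 2" by (simp_all add: \<epsilon>_def)
    have "\<epsilon>\<^sup>2 \<le> (sqrt (q * B / A))\<^sup>2" using pos by (intro power_mono) (simp_all add: \<epsilon>_def)
    then have "\<epsilon>\<^sup>2 \<le> q * B / A" using pos by simp
    then show "A * \<epsilon>\<^sup>2 \<le> q * B" using AB by (simp add: field_simps)
  qed
  show ?thesis using near c(2) newton_superlinear[OF zero licq ssoc \<epsilon>(1)]
  proof eventually_elim
    case (elim z)
    show ?case
    proof (intro allI impI)
      fix N assume z: "z \<noteq> zb" and N: "newton_step P z N"
      have "\<exists>d. DF P z d = - F P z" by (rule DF_solvable[OF c(1) elim(2)[rule_format]])
      then obtain d where Nd: "N = Some d" and d: "DF P z d = - F P z"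
        using N unfolding newton_step_def by (cases N) (auto simp del: split_paired_All split_paired_Ex)
      have le: "norm (z + d - zb) \<le> \<epsilon> * norm (z - zb)" using elim(3) d by blast
      also have "\<dots> \<le> (1 / 2) * norm (z - zb)" using \<epsilon>(2) by (intro mult_right_mono) auto
      finally have half: "norm (z + d - zb) \<le> (1 / 2) * norm (z - zb)" .
      have zpos: "0 < norm (z - zb)" using z by simp
      have "dist (z + d) zb < \<delta>" unfolding dist_norm using half elim(1)[unfolded dist_norm] zpos by linarith
      then have "Phi_FB P (z + d) \<le> A * (norm (z + d - zb))\<^sup>2" by (rule \<delta>(3))
      also have "\<dots> \<le> A * (\<epsilon> * norm (z - zb))\<^sup>2" using le AB(1) by (intro mult_left_mono power_mono) auto
      also have "\<dots> = A * \<epsilon>\<^sup>2 * (norm (z - zb))\<^sup>2" by (simp add: power_mult_distrib)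
      also have "\<dots> \<le> q * B * (norm (z - zb))\<^sup>2" using \<epsilon>(3) by (intro mult_right_mono) auto
      also have "\<dots> \<le> q * Phi_FB P z" using \<delta>(2)[OF elim(1)] q by (simp add: mult.assoc)
      finally have "Phi_FB P (z + d) \<le> q * Phi_FB P z" .
      moreover have "0 < Phi_FB P z"
        using \<delta>(2)[OF elim(1)] zpos AB(2) by (smt (verit) mult_pos_pos zero_less_power)
      ultimately show "ratio_test P q z N \<and> norm (z + the N - zb) \<le> (1 / 2) * norm (z - zb)"
        using half by (simp add: ratio_test_def Nd pos_divide_le_eq)
    qed
  qed
qed

section \<open>The globalized method\<close>

lemma search_direction_angle:
  assumes "0 < \<rho>" "\<rho> < 1"
  shows "grad (Phi_FB P) z \<bullet> search_direction P \<rho> z N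
    \<le> - \<rho> * norm (search_direction P \<rho> z N) * norm (grad (Phi_FB P) z)"
proof -
  let ?g = "grad (Phi_FB P) z"
  have "\<rho> * (norm ?g * norm ?g) \<le> 1 * (norm ?g * norm ?g)" using assms by (intro mult_right_mono) auto
  then have "?g \<bullet> (- ?g) \<le> - \<rho> * norm (- ?g) * norm ?g"
    by (simp add: power2_norm_eq_inner[symmetric] power2_eq_square)
  then show ?thesis by (auto simp: search_direction_def split: option.split)
qed

text \<open>
  A run never meets a zero of \<open>F\<close>, since its tolerance is nonnegative. Hence \<open>Phi_FB\<close> is positive at
  all iterates and the quotient in the ratio test has its ordinary meaning.
\<close>

lemma run_properties:
  assumes run: "newton_run P q \<tau> \<rho> \<sigma> \<beta> z N"
    and par: "0 < q" "q < 1" "0 \<le> \<tau>" "0 < \<rho>" "\<rho> < 1" "0 < \<sigma>" "0 < \<beta>"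
  shows run_positive: "0 < Phi_FB P (z k)" and run_F_nonzero: "F P (z k) \<noteq> 0"
    and run_ratio: "ratio_test P q (z k) (N k) \<Longrightarrow> Phi_FB P (z (Suc k)) \<le> q * Phi_FB P (z k)"
    and run_decreasing: "Phi_FB P (z (Suc k)) \<le> Phi_FB P (z k)"
proof -
  have norm: "norm (F P (z k)) > \<tau>" using run by (simp add: newton_run_def)
  then show F: "F P (z k) \<noteq> 0" using par(3) by auto
  then have "0 < (norm (F P (z k)))\<^sup>2" by simp
  then show pos: "0 < Phi_FB P (z k)" using F_le_Phi_FB[of "z k"] by linarith
  show ratio: "Phi_FB P (z (Suc k)) \<le> q * Phi_FB P (z k)" if "ratio_test P q (z k) (N k)"
  proof -
    have "z (Suc k) = z k + the (N k)" using run that by (simp add: newton_run_def)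
    then show ?thesis using that pos by (auto simp: ratio_test_def pos_divide_le_eq split: option.splits)
  qed
  show "Phi_FB P (z (Suc k)) \<le> Phi_FB P (z k)"
  proof (cases "ratio_test P q (z k) (N k)")
    case True
    then have "Phi_FB P (z (Suc k)) \<le> q * Phi_FB P (z k)" by (rule ratio)
    also have "\<dots> \<le> 1 * Phi_FB P (z k)" using pos par(2) by (intro mult_right_mono) auto
    finally show ?thesis by simp
  next
    case False
    let ?d = "search_direction P \<rho> (z k) (N k)"
    obtain i where i: "armijo (Phi_FB P) \<sigma> (z k) ?d (\<beta> ^ i)" "z (Suc k) = z k + \<beta> ^ i *\<^sub>R ?d"
      using run False unfolding newton_run_def line_search_step_def by metis
    have "grad (Phi_FB P) (z k) \<bullet> ?d \<le> 0"
      using search_direction_angle[OF par(4,5), of "z k" "N k"] par(4)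
      by (smt (verit) mult_nonneg_nonneg mult_minus_left norm_ge_zero)
    then have "\<sigma> * \<beta> ^ i * (grad (Phi_FB P) (z k) \<bullet> ?d) \<le> 0"
      using par by (intro mult_nonneg_nonpos) auto
    then show ?thesis using i by (simp add: armijo_def)
  qed
qed

text \<open>
  The values decrease to some limit \<open>l\<close>, and infinitely many reductions by the factor \<open>q < 1\<close> give
  \<open>l \<le> q l\<close>.
\<close>

lemma Phi_FB_tendsto_0:
  assumes run: "newton_run P q \<tau> \<rho> \<sigma> \<beta> z N"
    and par: "0 < q" "q < 1" "0 \<le> \<tau>" "0 < \<rho>" "\<rho> < 1" "0 < \<sigma>" "0 < \<beta>"
    and inf: "infinite {k. ratio_test P q (z k) (N k)}"
  shows "(\<lambda>k. Phi_FB P (z k)) \<longlonglongrightarrow> 0"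
proof -
  note facts = run_properties[OF run par]
  have "decseq (\<lambda>k. Phi_FB P (z k))" using facts(4) by (intro decseq_SucI) simp
  then obtain l where l: "(\<lambda>k. Phi_FB P (z k)) \<longlonglongrightarrow> l"
    using decseq_convergent[of "\<lambda>k. Phi_FB P (z k)" 0] Phi_FB_nonneg by blast
  have "0 \<le> l" using LIMSEQ_le_const[OF l] Phi_FB_nonneg by blast
  moreover have "\<not> 0 < l"
  proof
    assume "0 < l"
    have "(\<lambda>k. Phi_FB P (z (Suc k)) - q * Phi_FB P (z k)) \<longlonglongrightarrow> l - q * l"
      by (intro tendsto_intros l LIMSEQ_Suc[OF l])
    moreover have "0 < l - q * l" using \<open>0 < l\<close> par by simp
    ultimately have "\<forall>\<^sub>F k in sequentially. 0 < Phi_FB P (z (Suc k)) - q * Phi_FB P (z k)"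
      by (rule order_tendstoD)
    then have "\<forall>\<^sub>F k in sequentially. \<not> ratio_test P q (z k) (N k)"
      by eventually_elim (use facts(3) in force)
    then have "finite {k. \<not> \<not> ratio_test P q (z k) (N k)}"
      by (simp only: cofinite_eq_sequentially[symmetric] eventually_cofinite)
    then show False using inf by simp
  qed
  ultimately show ?thesis using l by simp
qed

lemma Phi_FB_accumulation_point_eq_0:
  assumes "(z \<circ> r) \<longlonglongrightarrow> zb" "(\<lambda>k. Phi_FB P (z (r k))) \<longlonglongrightarrow> 0"
  shows "Phi_FB P zb = 0"
proof -
  have "(\<lambda>k. Phi_FB P ((z \<circ> r) k)) \<longlonglongrightarrow> Phi_FB P zb"
    by (rule isCont_tendsto_compose[OF continuous_Phi_FB assms(1)])
  then show ?thesis using assms(2) by (simp add: LIMSEQ_unique)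
qed

text \<open>
  If the ratio test holds only finitely often, the method becomes a line search method. At an
  accumulation point with nonzero gradient the search directions tend to \<open>0\<close>, so they cannot be the
  negative gradients and are Newton directions. But then \<open>F(z) = - DF(z) d\<close> tends to \<open>0\<close>, and the point
  minimizes \<open>Phi_FB\<close> after all.
\<close>

lemma accumulation_point_critical:
  assumes run: "newton_run P q \<tau> \<rho> \<sigma> \<beta> z N"
    and par: "0 < q" "q < 1" "0 \<le> \<tau>" "0 < \<rho>" "\<rho> < 1" "0 < \<sigma>" "\<sigma> < 1" "0 < \<beta>" "\<beta> < 1"
    and acc: "accumulation_point z zb"
  shows "grad (Phi_FB P) zb = 0"
proof -
  note par' = par(1-6) par(8)
  obtain r where r: "strict_mono r" "(z \<circ> r) \<longlonglongrightarrow> zb" using acc unfolding accumulation_point_def by blast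
  have zr: "(\<lambda>k. z (r k)) \<longlonglongrightarrow> zb" using r(2) by (simp add: o_def)
  have min: "grad (Phi_FB P) zb = 0" if "Phi_FB P zb = 0"
    by (rule cont_diff_minimum[OF cont_diff_Phi_FB]) (use that Phi_FB_nonneg in simp)
  show ?thesis
  proof (cases "infinite {k. ratio_test P q (z k) (N k)}")
    case True
    have "(\<lambda>k. Phi_FB P (z (r k))) \<longlonglongrightarrow> 0"
      using LIMSEQ_subseq_LIMSEQ[OF Phi_FB_tendsto_0[OF run par' True] r(1)] by (simp add: o_def)
    then show ?thesis by (intro min Phi_FB_accumulation_point_eq_0[OF r(2)])
  next
    case False
    then have "\<forall>\<^sub>F k in sequentially. \<not> ratio_test P q (z k) (N k)"
      by (simp only: cofinite_eq_sequentially[symmetric] eventually_cofinite not_not)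
    then obtain k\<^sub>0 where k0: "\<And>k. k \<ge> k\<^sub>0 \<Longrightarrow> \<not> ratio_test P q (z k) (N k)"
      unfolding eventually_sequentially by blast
    define d where "d k = search_direction P \<rho> (z k) (N k)" for k
    show ?thesis
    proof (rule ccontr)
      assume nz: "grad (Phi_FB P) zb \<noteq> 0"
      have step: "line_search_step (Phi_FB P) \<sigma> \<beta> (z k) (d k) (z (Suc k))" if "k \<ge> k\<^sub>0" for k
        using run k0[OF that] by (simp add: newton_run_def d_def)
      have angle: "grad (Phi_FB P) (z k) \<bullet> d k \<le> - \<rho> * norm (d k) * norm (grad (Phi_FB P) (z k))" for k
        unfolding d_def by (rule search_direction_angle[OF par(4,5)])
      have d0: "(\<lambda>k. d (r k)) \<longlonglongrightarrow> 0"
        by (rule line_search_accumulation[OF cont_diff_Phi_FB Phi_FB_nonneg par(6,7,4,8,9) step angle r nz])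
      have "isCont (grad (Phi_FB P)) zb"
        using continuous_on_grad[OF cont_diff_Phi_FB] unfolding continuous_on_eq_continuous_at[OF open_UNIV] by blast
      then have g: "(\<lambda>k. grad (Phi_FB P) (z (r k))) \<longlonglongrightarrow> grad (Phi_FB P) zb"
        by (rule isCont_tendsto_compose[OF _ zr])
      have "(\<lambda>k. norm (grad (Phi_FB P) (z (r k))) - norm (d (r k))) \<longlonglongrightarrow> norm (grad (Phi_FB P) zb) - norm (0 :: ('n, 'l, 'm, 'p) primal_dual)"
        by (intro tendsto_intros g d0)
      then have "\<forall>\<^sub>F k in sequentially. 0 < norm (grad (Phi_FB P) (z (r k))) - norm (d (r k))"
        by (rule order_tendstoD) (use nz in simp)
      then have "\<forall>\<^sub>F k in sequentially. DF P (z (r k)) (d (r k)) = - F P (z (r k))"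
      proof eventually_elim
        case (elim k)
        then have "d (r k) \<noteq> - grad (Phi_FB P) (z (r k))" by auto
        then have "N (r k) = Some (d (r k))"
          unfolding d_def search_direction_def by (auto split: option.splits if_splits)
        moreover have "newton_step P (z (r k)) (N (r k))" using run by (simp add: newton_run_def)
        ultimately show ?case by (simp add: newton_step_def)
      qed
      moreover have "(\<lambda>k. - DF P (z (r k)) (d (r k))) \<longlonglongrightarrow> - 0"
        by (intro tendsto_minus DF_tendsto_0[OF zr d0])
      ultimately have "(\<lambda>k. F P (z (r k))) \<longlonglongrightarrow> 0"
        by (auto elim!: Lim_transform_eventually eventually_mono)
      then have "(\<lambda>k. 242 * (norm (F P (z (r k))))\<^sup>2) \<longlonglongrightarrow> 242 * (norm (0 :: (real^'n) \<times> (real^'l) \<times> (real^'m) \<times> (real^2^'p)))\<^sup>2"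
        by (intro tendsto_intros)
      then have lim: "(\<lambda>k. 242 * (norm (F P (z (r k))))\<^sup>2) \<longlonglongrightarrow> 0" by simp
      have "\<forall>\<^sub>F k in sequentially. norm (Phi_FB P (z (r k))) \<le> 242 * (norm (F P (z (r k))))\<^sup>2"
        using Phi_FB_le_F Phi_FB_nonneg by (intro always_eventually allI) simp
      then have "(\<lambda>k. Phi_FB P (z (r k))) \<longlonglongrightarrow> 0"
        by (rule Lim_null_comparison[OF _ lim])
      then show False using nz min Phi_FB_accumulation_point_eq_0[OF r(2)] by blast
    qed
  qed
qed

text \<open>
  One iterate close enough to \<open>zb\<close> starts a chain of accepted Newton steps that halve the distance
  and therefore never leave the neighbourhood.
\<close>

lemma local_convergence:
  assumes run: "newton_run P q \<tau> \<rho> \<sigma> \<beta> z N"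
    and par: "0 < q" "q < 1" "0 \<le> \<tau>" "0 < \<rho>" "\<rho> < 1" "0 < \<sigma>" "0 < \<beta>"
    and acc: "accumulation_point z zb"
    and zero: "F P zb = 0" and licq: "MPCC_LICQ P (pr_x zb)" and ssoc: "MPCC_SSOC P (pr_x zb) (snd zb)"
  shows "z \<longlonglongrightarrow> zb" and "\<forall>\<^sub>F k in sequentially. z (Suc k) = z k + the (N k) \<and> DF P (z k) (the (N k)) = - F P (z k)"
proof -
  obtain \<delta> where \<delta>: "\<delta> > 0" and contr: "\<And>z N. dist z zb < \<delta> \<Longrightarrow> z \<noteq> zb \<Longrightarrow> newton_step P z N \<Longrightarrow>
     ratio_test P q z N \<and> norm (z + the N - zb) \<le> (1 / 2) * norm (z - zb)"
    using newton_step_accepted[OF zero licq ssoc par(1)] unfolding eventually_nhds_metric by blast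
  have ne: "z k \<noteq> zb" for k using run_F_nonzero[OF run par, of k] zero by metis
  have stepN: "newton_step P (z k) (N k)" for k using run by (simp add: newton_run_def)
  have step: "z (Suc k) = z k + the (N k) \<and> DF P (z k) (the (N k)) = - F P (z k) \<and> norm (z (Suc k) - zb) \<le> (1 / 2) * norm (z k - zb)"
    if "dist (z k) zb < \<delta>" for k
  proof -
    have rt: "ratio_test P q (z k) (N k)" "norm (z k + the (N k) - zb) \<le> (1 / 2) * norm (z k - zb)"
      using contr[OF that ne stepN] by auto
    then have "z (Suc k) = z k + the (N k)" using run by (simp add: newton_run_def)
    moreover have "DF P (z k) (the (N k)) = - F P (z k)"
      using rt(1) stepN[of k] by (auto simp: ratio_test_def newton_step_def split: option.splits)
    ultimately show ?thesis using rt(2) by simp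
  qed
  obtain r where r: "(z \<circ> r) \<longlonglongrightarrow> zb" using acc unfolding accumulation_point_def by blast
  from tendstoD[OF this \<delta>] obtain k\<^sub>0 where k0: "dist (z k\<^sub>0) zb < \<delta>"
    unfolding eventually_sequentially by auto
  have bound: "norm (z (n + k\<^sub>0) - zb) \<le> (1 / 2) ^ n * norm (z k\<^sub>0 - zb)" for n
  proof (induction n)
    case (Suc n)
    have "(1 / 2) ^ n * norm (z k\<^sub>0 - zb) \<le> 1 * norm (z k\<^sub>0 - zb)"
      by (intro mult_right_mono power_le_one) auto
    then have "dist (z (n + k\<^sub>0)) zb < \<delta>" using Suc k0 by (simp add: dist_norm)
    then have "norm (z (Suc (n + k\<^sub>0)) - zb) \<le> (1 / 2) * norm (z (n + k\<^sub>0) - zb)" using step by blast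
    then show ?case using Suc by simp
  qed simp
  have near: "dist (z k) zb < \<delta>" if "k \<ge> k\<^sub>0" for k
  proof -
    have "(1 / 2) ^ (k - k\<^sub>0) * norm (z k\<^sub>0 - zb) \<le> 1 * norm (z k\<^sub>0 - zb)"
      by (intro mult_right_mono power_le_one) auto
    then show ?thesis using bound[of "k - k\<^sub>0"] that k0 by (simp add: dist_norm)
  qed
  have "(\<lambda>n. (1 / 2) ^ n * norm (z k\<^sub>0 - zb)) \<longlonglongrightarrow> 0 * norm (z k\<^sub>0 - zb)"
    by (intro tendsto_intros LIMSEQ_power_zero) simp
  then have "(\<lambda>n. (1 / 2) ^ n * norm (z k\<^sub>0 - zb)) \<longlonglongrightarrow> 0" by simp
  then have "(\<lambda>n. z (n + k\<^sub>0) - zb) \<longlonglongrightarrow> 0"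
    by (rule Lim_null_comparison[OF always_eventually[OF allI[OF bound]]])
  then have "(\<lambda>n. z (n + k\<^sub>0)) \<longlonglongrightarrow> zb" by (rule LIM_zero_cancel)
  then show "z \<longlonglongrightarrow> zb" by (rule LIMSEQ_offset)
  show "\<forall>\<^sub>F k in sequentially. z (Suc k) = z k + the (N k) \<and> DF P (z k) (the (N k)) = - F P (z k)"
    using step near unfolding eventually_sequentially by blast
qed

lemma superlinear_convergence:
  assumes lim: "z \<longlonglongrightarrow> zb"
    and newton: "\<forall>\<^sub>F k in sequentially. z (Suc k) = z k + the (N k) \<and> DF P (z k) (the (N k)) = - F P (z k)"
    and zero: "F P zb = 0" and licq: "MPCC_LICQ P (pr_x zb)" and ssoc: "MPCC_SSOC P (pr_x zb) (snd zb)"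
  shows "converges_superlinearly z zb"
  unfolding converges_superlinearly_def
proof (intro conjI lim landau_o.smallI)
  fix c :: real assume "c > 0"
  from eventually_compose_filterlim[OF newton_superlinear[OF zero licq ssoc this] lim] newton
  show "\<forall>\<^sub>F k in sequentially. norm (norm (z (Suc k) - zb)) \<le> c * norm (norm (z k - zb))"
  proof eventually_elim
    case (elim k)
    then show ?case using elim(1)[rule_format, of "the (N k)"] by simp
  qed
qed

lemma quadratic_convergence:
  assumes lim: "z \<longlonglongrightarrow> zb"
    and newton: "\<forall>\<^sub>F k in sequentially. z (Suc k) = z k + the (N k) \<and> DF P (z k) (the (N k)) = - F P (z k)"
    and zero: "F P zb = 0" and licq: "MPCC_LICQ P (pr_x zb)" and ssoc: "MPCC_SSOC P (pr_x zb) (snd zb)"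
    and lip: "locally_lipschitz f''" "locally_lipschitz g''" "locally_lipschitz h''" "locally_lipschitz G''" "locally_lipschitz H''"
  shows "converges_quadratically z zb"
proof -
  have rem: "(\<lambda>z. newton_rem u u' (pr_x zb) (pr_x z)) \<in> O[nhds zb](\<lambda>z. (norm (z - zb))\<^sup>2)"
    if "\<And>x. (u has_derivative blinfun_apply (u' x)) (at x)" "locally_lipschitz u'" for u :: "real^'n \<Rightarrow> 'x::real_normed_vector" and u'
    by (rule primal_bigo_square[OF newton_rem_bigo[OF that(1) locally_lipschitz_bigo[OF that(2)]]])
  obtain C where C: "C > 0"
    "\<forall>\<^sub>F z in nhds zb. \<forall>d. DF P z d = - F P z \<longrightarrow> norm (z + d - zb) \<le> C * \<bar>(norm (z - zb))\<^sup>2\<bar>"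
    using newton_estimate[OF zero licq ssoc landau_o.big_refl rem[OF derivs'(1) lip(1)] rem[OF derivs'(2) lip(2)]
        rem[OF derivs'(3) lip(3)] rem[OF derivs'(4) lip(4)] rem[OF derivs'(5) lip(5)]] by blast
  have "\<forall>\<^sub>F k in sequentially. norm (norm (z (Suc k) - zb)) \<le> C * norm ((norm (z k - zb))\<^sup>2)"
    using eventually_compose_filterlim[OF C(2) lim] newton
  proof eventually_elim
    case (elim k)
    then show ?case using elim(1)[rule_format, of "the (N k)"] by simp
  qed
  then show ?thesis unfolding converges_quadratically_def using lim by (blast intro: bigoI)
qed

end

text \<open>
  Local Lipschitz continuity is assumed of some second derivative and is needed for the
  one fixed above.
\<close>

lemma second_derivative_unique:
  assumes "twice_diff f f' f''" "second_derivative f f2nd"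
  shows "f2nd = f''"
proof -
  obtain f2 where f2: "\<And>x. (f has_derivative blinfun_apply (f2 x)) (at x)" "\<And>x. (f2 has_derivative blinfun_apply (f2nd x)) (at x)"
    using assms(2) unfolding second_derivative_def by blast
  have f1: "\<And>x. (f has_derivative blinfun_apply (f' x)) (at x)" "\<And>x. (f' has_derivative blinfun_apply (f'' x)) (at x)"
    using assms(1) unfolding twice_diff_def by auto
  have "f2 x = f' x" for x
    using has_derivative_unique[OF f2(1) f1(1)] by (intro blinfun_eqI) metis
  then have "f2 = f'" by auto
  have "f2nd x = f'' x" for x
    using has_derivative_unique[OF f2(2)[unfolded \<open>f2 = f'\<close>] f1(2)] by (intro blinfun_eqI) metis
  then show ?thesis by auto
qed

lemma locally_lipschitz_second_derivativeD:
  assumes "twice_diff f f' f''" "locally_lipschitz_second_derivative f"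
  shows "locally_lipschitz f''"
  using assms second_derivative_unique unfolding locally_lipschitz_second_derivative_def by metis

lemma twice_continuously_differentiableE:
  assumes "twice_continuously_differentiable f"
  obtains f' f'' where "twice_diff f f' f''"
  using assms unfolding twice_continuously_differentiable_def second_derivative_def twice_diff_def by blast

theorem theorem5p2:
  fixes P :: "('n::finite, 'l::finite, 'm::finite, 'p::finite) mpcc"
    and q \<tau> \<rho> \<sigma> \<beta> :: real
    and z :: "nat \<Rightarrow> ('n, 'l, 'm, 'p) primal_dual"
    and N :: "nat \<Rightarrow> ('n, 'l, 'm, 'p) primal_dual option"
  assumes "twice_continuously_differentiable (obj P)"
    and "twice_continuously_differentiable (ineq P)"
    and "twice_continuously_differentiable (eqn P)"
    and "twice_continuously_differentiable (cG P)"
    and "twice_continuously_differentiable (cH P)"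
    and "0 < q" "q < 1"
    and "0 \<le> \<tau>" "\<tau> < 1"
    and "0 < \<rho>" "\<rho> < 1"
    and "0 < \<sigma>" "\<sigma> < 1"
    and "0 < \<beta>" "\<beta> < 1"
    and "newton_run P q \<tau> \<rho> \<sigma> \<beta> z N"
  shows "(infinite {k. ratio_test P q (z k) (N k)} \<longrightarrow>
            (\<lambda>k. Phi_FB P (z k)) \<longlonglongrightarrow> 0 \<and>
            (\<forall>zb. accumulation_point z zb \<longrightarrow> primal_dual_M_stationary P zb)) \<and>
         (\<forall>zb. accumulation_point z zb \<longrightarrow> stationary_point (Phi_FB P) zb) \<and>
         (\<forall>x lam \<eta> \<mu> \<nu>.
            accumulation_point z (x, lam, \<eta>, \<mu>, \<nu>) \<and>
            M_stationary P x \<and> MPCC_LICQ P x \<and>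
            (lam, \<eta>, \<mu>, \<nu>) \<in> M_multipliers P x \<and>
            MPCC_SSOC P x (lam, \<eta>, \<mu>, \<nu>) \<longrightarrow>
              converges_superlinearly z (x, lam, \<eta>, \<mu>, \<nu>) \<and>
              (locally_lipschitz_second_derivative (obj P) \<and>
               locally_lipschitz_second_derivative (ineq P) \<and>
               locally_lipschitz_second_derivative (eqn P) \<and>
               locally_lipschitz_second_derivative (cG P) \<and>
               locally_lipschitz_second_derivative (cH P) \<longrightarrow>
                 converges_quadratically z (x, lam, \<eta>, \<mu>, \<nu>)))"
proof -
  obtain f' f'' where f: "twice_diff (obj P) f' f''" using assms(1) by (rule twice_continuously_differentiableE)
  obtain g' g'' where g: "twice_diff (ineq P) g' g''" using assms(2) by (rule twice_continuously_differentiableE)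
  obtain h' h'' where h: "twice_diff (eqn P) h' h''" using assms(3) by (rule twice_continuously_differentiableE)
  obtain G' G'' where G: "twice_diff (cG P) G' G''" using assms(4) by (rule twice_continuously_differentiableE)
  obtain H' H'' where H: "twice_diff (cH P) H' H''" using assms(5) by (rule twice_continuously_differentiableE)
  interpret smooth_mpcc P f' f'' g' g'' h' h'' G' G'' H' H''
    by (rule smooth_mpcc.intro[OF f g h G H])
  note par = assms(6-8,10-15) and run = assms(16)
  note par' = par(1-6) par(8)
  show ?thesis
  proof (intro conjI impI allI)
    assume inf: "infinite {k. ratio_test P q (z k) (N k)}"
    show lim: "(\<lambda>k. Phi_FB P (z k)) \<longlonglongrightarrow> 0" by (rule Phi_FB_tendsto_0[OF run par' inf])
    fix zb assume "accumulation_point z zb"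
    then obtain r where r: "strict_mono r" "(z \<circ> r) \<longlonglongrightarrow> zb" unfolding accumulation_point_def by blast
    have "(\<lambda>k. Phi_FB P (z (r k))) \<longlonglongrightarrow> 0" using LIMSEQ_subseq_LIMSEQ[OF lim r(1)] by (simp add: o_def)
    then show "primal_dual_M_stationary P zb" using Phi_FB_accumulation_point_eq_0[OF r(2)] Phi_FB_eq_0_iff by blast
  next
    fix zb assume "accumulation_point z zb"
    then show "stationary_point (Phi_FB P) zb"
      using accumulation_point_critical[OF run par] GDERIV_grad[OF cont_diff_Phi_FB, of zb]
      by (simp add: stationary_point_def)
  next
    fix x lam \<eta> \<mu> \<nu>
    assume *: "accumulation_point z (x, lam, \<eta>, \<mu>, \<nu>) \<and> M_stationary P x \<and> MPCC_LICQ P x \<and>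
            (lam, \<eta>, \<mu>, \<nu>) \<in> M_multipliers P x \<and> MPCC_SSOC P x (lam, \<eta>, \<mu>, \<nu>)"
    let ?zb = "(x, lam, \<eta>, \<mu>, \<nu>)"
    have acc: "accumulation_point z ?zb" using * by blast
    have licq: "MPCC_LICQ P (pr_x ?zb)" and ssoc: "MPCC_SSOC P (pr_x ?zb) (snd ?zb)" using * by simp_all
    have "primal_dual_M_stationary P ?zb" using * by (simp add: M_stationary_def)
    then have zero: "F P ?zb = 0" by (simp only: primal_dual_M_stationary_iff)
    note conv = local_convergence[OF run par' acc zero licq ssoc]
    show "converges_superlinearly z ?zb" by (rule superlinear_convergence[OF conv zero licq ssoc])
    assume "locally_lipschitz_second_derivative (obj P) \<and> locally_lipschitz_second_derivative (ineq P) \<and>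
      locally_lipschitz_second_derivative (eqn P) \<and> locally_lipschitz_second_derivative (cG P) \<and>
      locally_lipschitz_second_derivative (cH P)"
    then have "locally_lipschitz f''" "locally_lipschitz g''" "locally_lipschitz h''" "locally_lipschitz G''" "locally_lipschitz H''"
      using locally_lipschitz_second_derivativeD[OF f] locally_lipschitz_second_derivativeD[OF g]
        locally_lipschitz_second_derivativeD[OF h] locally_lipschitz_second_derivativeD[OF G]
        locally_lipschitz_second_derivativeD[OF H] by auto
    then show "converges_quadratically z ?zb" by (rule quadratic_convergence[OF conv zero licq ssoc])
  qed
qed

end
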